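(* Let $R=\mathcal O_{\mathbb C^d,0}$ be the ring of germs of holomorphic functions at the origin of $\mathbb C^d$, and let $\mathfrak a=(f_1,\dots,f_s)$ and $\mathfrak b=(g_1,\dots,g_t)$ be ideals of $R$ with $f_i(0)=0$ and $g_j(0)=0$ for all $i,j$. Then the analytic and the algebraic Łojasiewicz exponents of $\mathfrak a$ with respect to $\mathfrak b$ agree: $$\mathcal L^{an}_{\mathfrak b}(\mathfrak a)=\mathcal L_{\mathfrak b}(\mathfrak a).$$
   Context: Write $\|f(x)\|:=\max_i|f_i(x)|$ and $\|g(x)\|:=\max_j|g_j(x)|$. Analytic exponent: $\mathcal L^{an}_{\mathfrak b}(\mathfrak a):=\inf\{\theta>0:\ \exists$ a neighborhood $U$ of $0$ and $C>0$ such that $C\|f(x)\|\ge\|g(x)\|^{\theta}$ for all $x\in U\}$. Algebraic exponent: $\mathcal L_{\mathfrak b}(\mathfrak a):=\inf\{\frac qp\in\mathbb Q_{>0}:\ p,q\in\mathbb Z_{\ge1},\ \mathfrak b^{qt}\subseteq\overline{\mathfrak a^{pt}}\text{ for all integers }t\gg1\}$, where $\overline{I}$ denotes the integral closure of an ideal $I$. In both cases $\inf\emptyset=\infty$. *)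

theory Defs
  imports
    "HOL-Analysis.Analysis"
    "HOL-Algebra.Ideal_Product"
    "HOL-Algebra.Algebraic_Closure_Type"
begin

section \<open>Germs of holomorphic functions at the origin\<close>

text \<open>A function on an open subset of complex \<open>d\<close>-space is holomorphic if it is
  (Frechet-)differentiable at every point with a complex-linear derivative.\<close>

definition holomorphic_vec_on :: "(complex ^ 'd \<Rightarrow> complex) \<Rightarrow> (complex ^ 'd) set \<Rightarrow> bool"
  where "holomorphic_vec_on f U \<longleftrightarrow>
    (\<forall>x\<in>U. \<exists>D. (f has_derivative D) (at x) \<and> (\<forall>c v. D (c *s v) = c * D v))"

definition holomorphic_near_0 :: "(complex ^ 'd \<Rightarrow> complex) \<Rightarrow> bool"
  where "holomorphic_near_0 f \<longleftrightarrow> (\<exists>U. open U \<and> 0 \<in> U \<and> holomorphic_vec_on f U)"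

lemma holomorphic_near_0_common:
  assumes "holomorphic_near_0 f" "holomorphic_near_0 g"
  obtains U where "open U" "0 \<in> U" "holomorphic_vec_on f U" "holomorphic_vec_on g U"
proof -
  from assms obtain U V where
    "open U" "0 \<in> U" "holomorphic_vec_on f U" "open V" "0 \<in> V" "holomorphic_vec_on g V"
    unfolding holomorphic_near_0_def by blast
  then show thesis
    by (intro that[of "U \<inter> V"]) (auto simp: holomorphic_vec_on_def)
qed

lemma holomorphic_near_0_const: "holomorphic_near_0 (\<lambda>_. c)"
  unfolding holomorphic_near_0_def holomorphic_vec_on_def
  by (intro exI[of _ UNIV]) (auto intro!: exI[of _ "\<lambda>_. 0"])

lemma holomorphic_near_0_add:
  assumes "holomorphic_near_0 f" "holomorphic_near_0 g"
  shows "holomorphic_near_0 (\<lambda>x. f x + g x)"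
proof -
  obtain U where U: "open U" "0 \<in> U" "holomorphic_vec_on f U" "holomorphic_vec_on g U"
    using holomorphic_near_0_common[OF assms] .
  have "holomorphic_vec_on (\<lambda>x. f x + g x) U"
    unfolding holomorphic_vec_on_def
  proof
    fix x assume "x \<in> U"
    with U obtain D E where
      "(f has_derivative D) (at x)" "\<forall>c v. D (c *s v) = c * D v"
      "(g has_derivative E) (at x)" "\<forall>c v. E (c *s v) = c * E v"
      unfolding holomorphic_vec_on_def by blast
    then show "\<exists>D. ((\<lambda>x. f x + g x) has_derivative D) (at x) \<and> (\<forall>c v. D (c *s v) = c * D v)"
      by (intro exI[of _ "\<lambda>h. D h + E h"] conjI has_derivative_add) (auto simp: algebra_simps)
  qed
  with U show ?thesis unfolding holomorphic_near_0_def by blast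
qed

lemma holomorphic_near_0_mult:
  assumes "holomorphic_near_0 f" "holomorphic_near_0 g"
  shows "holomorphic_near_0 (\<lambda>x. f x * g x)"
proof -
  obtain U where U: "open U" "0 \<in> U" "holomorphic_vec_on f U" "holomorphic_vec_on g U"
    using holomorphic_near_0_common[OF assms] .
  have "holomorphic_vec_on (\<lambda>x. f x * g x) U"
    unfolding holomorphic_vec_on_def
  proof
    fix x assume "x \<in> U"
    with U obtain D E where
      "(f has_derivative D) (at x)" "\<forall>c v. D (c *s v) = c * D v"
      "(g has_derivative E) (at x)" "\<forall>c v. E (c *s v) = c * E v"
      unfolding holomorphic_vec_on_def by blast
    then show "\<exists>D. ((\<lambda>x. f x * g x) has_derivative D) (at x) \<and> (\<forall>c v. D (c *s v) = c * D v)"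
      by (intro exI[of _ "\<lambda>h. f x * E h + D h * g x"] conjI has_derivative_mult)
        (auto simp: algebra_simps)
  qed
  with U show ?thesis unfolding holomorphic_near_0_def by blast
qed

lemma holomorphic_near_0_uminus:
  "holomorphic_near_0 f \<Longrightarrow> holomorphic_near_0 (\<lambda>x. - f x)"
  using holomorphic_near_0_mult[OF holomorphic_near_0_const[of "-1"], of f] by simp

definition germ_eq :: "(complex ^ 'd \<Rightarrow> complex) \<Rightarrow> (complex ^ 'd \<Rightarrow> complex) \<Rightarrow> bool"
  where "germ_eq f g \<longleftrightarrow>
    holomorphic_near_0 f \<and> holomorphic_near_0 g \<and> (\<forall>\<^sub>F x in nhds 0. f x = g x)"

lemma part_equivp_germ_eq: "part_equivp germ_eq"
proof (rule part_equivpI)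
  show "\<exists>f. germ_eq f f"
    using holomorphic_near_0_const[of 0] by (auto simp: germ_eq_def)
  show "symp germ_eq"
    by (auto simp: symp_def germ_eq_def elim: eventually_mono)
  show "transp germ_eq"
    by (auto simp: transp_def germ_eq_def elim: eventually_elim2)
qed

text \<open>The equivalence relation is partial: \<open>germ_of f\<close> is only meaningful if \<open>f\<close> is holomorphic
  on some neighbourhood of 0.\<close>

quotient_type 'd germ = "complex ^ 'd \<Rightarrow> complex" / partial: germ_eq
  morphisms rep_germ germ_of
  by (rule part_equivp_germ_eq)

instantiation germ :: (finite) comm_ring_1
begin

lift_definition zero_germ :: "'a germ" is "\<lambda>_. 0"
  by (simp add: germ_eq_def holomorphic_near_0_const)

lift_definition one_germ :: "'a germ" is "\<lambda>_. 1"
  by (simp add: germ_eq_def holomorphic_near_0_const)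

lift_definition plus_germ :: "'a germ \<Rightarrow> 'a germ \<Rightarrow> 'a germ" is "\<lambda>f g x. f x + g x"
  by (auto simp: germ_eq_def holomorphic_near_0_add elim: eventually_elim2)

lift_definition times_germ :: "'a germ \<Rightarrow> 'a germ \<Rightarrow> 'a germ" is "\<lambda>f g x. f x * g x"
  by (auto simp: germ_eq_def holomorphic_near_0_mult elim: eventually_elim2)

lift_definition uminus_germ :: "'a germ \<Rightarrow> 'a germ" is "\<lambda>f x. - f x"
  by (auto simp: germ_eq_def holomorphic_near_0_uminus elim: eventually_mono)

definition minus_germ :: "'a germ \<Rightarrow> 'a germ \<Rightarrow> 'a germ"
  where "minus_germ a b = a + - b"

instance
proof
  fix a b c :: "'a germ"
  show "a + b + c = a + (b + c)"
    by transfer (auto simp: germ_eq_def holomorphic_near_0_add add.assoc)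
  show "a + b = b + a"
    by transfer (auto simp: germ_eq_def holomorphic_near_0_add add.commute)
  show "0 + a = a"
    by transfer (auto simp: germ_eq_def)
  show "- a + a = 0"
    by transfer (auto simp: germ_eq_def holomorphic_near_0_const)
  show "a - b = a + - b"
    by (rule minus_germ_def)
  show "a * b * c = a * (b * c)"
    by transfer (auto simp: germ_eq_def holomorphic_near_0_mult mult.assoc)
  show "a * b = b * a"
    by transfer (auto simp: germ_eq_def holomorphic_near_0_mult mult.commute)
  show "1 * a = a"
    by transfer (auto simp: germ_eq_def)
  show "(a + b) * c = a * c + b * c"
    by transfer (auto simp: germ_eq_def holomorphic_near_0_mult holomorphic_near_0_add distrib_right)
  show "(0 :: 'a germ) \<noteq> 1"
  proof (transfer, rule notI)
    assume "germ_eq (\<lambda>_ :: complex ^ 'a. 0) (\<lambda>_. 1)"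
    then have "\<forall>\<^sub>F x :: complex ^ 'a in nhds 0. False"
      by (simp add: germ_eq_def)
    then show False
      using eventually_nhds_x_imp_x by blast
  qed
qed

end

abbreviation germ_ring :: "('d :: finite) germ ring"
  where "germ_ring \<equiv> ring_of_type_algebra"


section \<open>Integral closure of ideals\<close>

abbreviation ideal_power :: "('a, 'b) ring_scheme \<Rightarrow> 'a set \<Rightarrow> nat \<Rightarrow> 'a set"
  where "ideal_power R I n \<equiv> I [^]\<^bsub>ideals_set R\<^esub> n"

text \<open>Elements satisfying an equation of integral dependence
  \<open>r^n + a_1 r^(n-1) + ... + a_n = 0\<close> with \<open>a_i\<close> in the \<open>i\<close>-th power of \<open>I\<close>.\<close>

definition integral_closure :: "('a, 'b) ring_scheme \<Rightarrow> 'a set \<Rightarrow> 'a set"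
  where "integral_closure R I =
    {r \<in> carrier R. \<exists>n\<ge>1. \<exists>a. (\<forall>i\<in>{1..n}. a i \<in> ideal_power R I i) \<and>
       r [^]\<^bsub>R\<^esub> n \<oplus>\<^bsub>R\<^esub> (\<Oplus>\<^bsub>R\<^esub>i\<in>{1..n}. a i \<otimes>\<^bsub>R\<^esub> r [^]\<^bsub>R\<^esub> (n - i)) = \<zero>\<^bsub>R\<^esub>}"


section \<open>Lojasiewicz exponents\<close>

text \<open>Both infima are taken in the extended reals, where the infimum of the empty set
  is \<open>\<infinity>\<close>.\<close>

definition max_norm :: "nat \<Rightarrow> (nat \<Rightarrow> complex ^ 'd \<Rightarrow> complex) \<Rightarrow> complex ^ 'd \<Rightarrow> real"
  where "max_norm s f x = Max ((\<lambda>i. norm (f i x)) ` {1..s})"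

definition analytic_exponent ::
  "nat \<Rightarrow> (nat \<Rightarrow> complex ^ 'd \<Rightarrow> complex) \<Rightarrow> nat \<Rightarrow> (nat \<Rightarrow> complex ^ 'd \<Rightarrow> complex) \<Rightarrow> ereal"
  where "analytic_exponent s f t g =
    Inf {ereal \<theta> | \<theta>. \<theta> > 0 \<and>
      (\<exists>U C. open U \<and> 0 \<in> U \<and> C > 0 \<and>
         (\<forall>x\<in>U. C * max_norm s f x \<ge> max_norm t g x powr \<theta>))}"

definition algebraic_exponent :: "('a, 'b) ring_scheme \<Rightarrow> 'a set \<Rightarrow> 'a set \<Rightarrow> ereal"
  where "algebraic_exponent R \<aa> \<bb> =
    Inf {ereal (real q / real p) | p q :: nat. p \<ge> 1 \<and> q \<ge> 1 \<and>
      (\<forall>\<^sub>F t in sequentially.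
         ideal_power R \<bb> (q * t) \<subseteq> integral_closure R (ideal_power R \<aa> (p * t)))}"

end

theory Submission
  imports Defs "HOL-Complex_Analysis.Complex_Analysis" "Jordan_Normal_Form.Char_Poly"
begin

text \<open>An equation of integral dependence for \<open>g\<^sub>j\<^sup>q\<^sup>T\<close> over \<open>\<aa>\<^sup>p\<^sup>T\<close> bounds \<open>|g\<^sub>j|\<^sup>q\<^sup>T\<close> by a multiple of
  \<open>\<parallel>f\<parallel>\<^sup>p\<^sup>T\<close>, so every rational in the algebraic set belongs to the analytic one. Conversely, let
  \<open>\<parallel>g\<parallel>\<^sup>\<theta> \<le> C \<parallel>f\<parallel>\<close> and \<open>\<theta> < q'/p' < q/p\<close>. Then \<open>h = g\<^sub>j\<^sup>q\<^sup>'\<close> is dominated by the functions \<open>F\<^sub>i = f\<^sub>i\<^sup>p\<^sup>'\<close>,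
  hence vanishes near the origin on the zero set of the functions \<open>F\<^sub>i - y\<^sub>i h\<close> in the variables \<open>x\<close>
  and \<open>y\<close>. Rueckert's Nullstellensatz puts a power \<open>h\<^sup>k\<close> into the ideal generated by these functions,
  and expanding along \<open>y = \<tau> F(x)\<close> yields \<open>h\<^sup>k\<^sup>+\<^sup>m \<in> (F)\<^sup>m\<^sup>+\<^sup>1\<close> for all \<open>m\<close>. As \<open>q'/p' < q/p\<close>, the
  loss of the constant \<open>k\<close> is negligible for large \<open>T\<close>, and all monomials of degree \<open>qT\<close> in the \<open>g\<^sub>j\<close>
  lie in \<open>\<aa>\<^sup>p\<^sup>T\<close> itself.\<close>

section \<open>Bounded separately holomorphic functions\<close>

text \<open>An inequality between absolute values produces no algebraic relation by itself. The
  variables \<open>y\<close> are there to turn it into a vanishing statement: where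
  \<open>F_i = y_i h\<close> for all \<open>i\<close> and the \<open>y_i\<close> are smaller than
  \<open>1 / C\<close>, a bound of \<open>|h|\<close> by \<open>C max |F_i|\<close> leaves only
  \<open>h = 0\<close>. The Nullstellensatz can act on such a statement, and it is needed for the
  finitely many functions \<open>F_i - y_i h\<close> only. It is therefore proved in the form that
  finitely many elements of a prime ideal have common zeros outside the zero set of
  \<open>h\<close>, arbitrarily near the origin. The parameter \<tau> converts a single membership
  in the larger ring into one membership for each power of the ideal downstairs, with the same
  \<open>k\<close> throughout. The rational \<open>q'/p'\<close> does two things: it replaces the
  real exponent \<theta> by integral powers of germs, and its distance from \<open>q/p\<close> pays
  for rounding and for \<open>k\<close>. Both exponents being infima, moving slightly upwards from
  \<theta> changes nothing.\<close>

definition polydisc :: "'i set \<Rightarrow> ('i \<Rightarrow> real) \<Rightarrow> ('i \<Rightarrow> complex) set"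
  where "polydisc S r = {z. \<forall>i\<in>S. norm (z i) < r i}"

text \<open>Coordinates are indexed by an arbitrary type, and the set \<open>S\<close> of active variables is a value, so
  that one can induct on the number of variables and adjoin new ones. Boundedness on the polydisc
  takes the place of continuity: difference quotients are again bounded by the maximum principle,
  which gives uniform convergence wherever it is needed.\<close>

definition bhol :: "'i set \<Rightarrow> ('i \<Rightarrow> real) \<Rightarrow> real \<Rightarrow> (('i \<Rightarrow> complex) \<Rightarrow> complex) \<Rightarrow> bool"
  where "bhol S r B F \<longleftrightarrow>
    (\<forall>z z'. (\<forall>i\<in>S. z i = z' i) \<longrightarrow> F z = F z') \<and>
    (\<forall>z\<in>polydisc S r. norm (F z) \<le> B) \<and>
    (\<forall>z\<in>polydisc S r. \<forall>i\<in>S. (\<lambda>w. F (z(i := w))) holomorphic_on ball 0 (r i))"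

lemma bholI:
  assumes "\<And>z z'. (\<And>i. i \<in> S \<Longrightarrow> z i = z' i) \<Longrightarrow> F z = F z'"
    and "\<And>z. z \<in> polydisc S r \<Longrightarrow> norm (F z) \<le> B"
    and "\<And>z i. z \<in> polydisc S r \<Longrightarrow> i \<in> S \<Longrightarrow> (\<lambda>w. F (z(i := w))) holomorphic_on ball 0 (r i)"
  shows "bhol S r B F"
  using assms unfolding bhol_def by blast

lemma bhol_cong: "bhol S r B F \<Longrightarrow> (\<And>i. i \<in> S \<Longrightarrow> z i = z' i) \<Longrightarrow> F z = F z'"
  unfolding bhol_def by blast

lemma bhol_bound: "bhol S r B F \<Longrightarrow> z \<in> polydisc S r \<Longrightarrow> norm (F z) \<le> B"
  unfolding bhol_def by blast

lemma bhol_holo: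
  "bhol S r B F \<Longrightarrow> z \<in> polydisc S r \<Longrightarrow> i \<in> S \<Longrightarrow> (\<lambda>w. F (z(i := w))) holomorphic_on ball 0 (r i)"
  unfolding bhol_def by blast

lemma polydisc_upd: "z \<in> polydisc S r \<Longrightarrow> (i \<in> S \<Longrightarrow> norm w < r i) \<Longrightarrow> z(i := w) \<in> polydisc S r"
  unfolding polydisc_def by auto

lemma polydisc_D: "z \<in> polydisc S r \<Longrightarrow> i \<in> S \<Longrightarrow> norm (z i) < r i"
  unfolding polydisc_def by auto

lemma polydisc_mono: "(\<And>i. i \<in> T \<Longrightarrow> r i \<le> r' i) \<Longrightarrow> T \<subseteq> S \<Longrightarrow> polydisc S r \<subseteq> polydisc T r'"
  unfolding polydisc_def by force

lemma bhol_mono: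
  assumes F: "bhol T r' B' F" and "T \<subseteq> S" "\<And>i. i \<in> T \<Longrightarrow> r i \<le> r' i" "B' \<le> B"
  shows "bhol S r B F"
proof (rule bholI)
  have sub: "polydisc S r \<subseteq> polydisc T r'"
    using polydisc_mono assms by metis
  show "F z = F z'" if "\<And>i. i \<in> S \<Longrightarrow> z i = z' i" for z z'
    using bhol_cong[OF F] that assms(2) by blast
  show "norm (F z) \<le> B" if "z \<in> polydisc S r" for z
    using bhol_bound[OF F, of z] that sub assms(4) by force
  show "(\<lambda>w. F (z(i := w))) holomorphic_on ball 0 (r i)" if z: "z \<in> polydisc S r" and "i \<in> S" for z i
  proof (cases "i \<in> T")
    case True
    show ?thesis
      by (rule holomorphic_on_subset[OF bhol_holo[OF F _ True]]) (use sub z assms(3)[OF True] in auto)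
  next
    case False
    then have "(\<lambda>w. F (z(i := w))) = (\<lambda>w. F z)"
      by (intro ext bhol_cong[OF F]) auto
    then show ?thesis by simp
  qed
qed

lemma bhol_const: "norm c \<le> B \<Longrightarrow> bhol S r B (\<lambda>_. c)"
  by (rule bholI) auto

lemma bhol_coord: "i \<in> S \<Longrightarrow> bhol S r (r i) (\<lambda>z. z i)"
proof (rule bholI)
  show "(\<lambda>w. (z(j := w)) i) holomorphic_on ball 0 (r j)" for z :: "'a \<Rightarrow> complex" and j
    by (cases "j = i") (auto intro: holomorphic_intros)
qed (auto simp: polydisc_def less_imp_le)

lemma bhol_add:
  assumes F: "bhol S r B F" and G: "bhol S r C G"
  shows "bhol S r (B + C) (\<lambda>z. F z + G z)"
proof (rule bholI)
  show "F z + G z = F z' + G z'" if "\<And>i. i \<in> S \<Longrightarrow> z i = z' i" for z z'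
    using bhol_cong[OF F that] bhol_cong[OF G that] by simp
  show "norm (F z + G z) \<le> B + C" if "z \<in> polydisc S r" for z
    using norm_triangle_mono[OF bhol_bound[OF F that] bhol_bound[OF G that]] .
qed (intro holomorphic_intros bhol_holo[OF F] bhol_holo[OF G]; assumption)

lemma bhol_mult:
  assumes F: "bhol S r B F" and G: "bhol S r C G"
  shows "bhol S r (B * C) (\<lambda>z. F z * G z)"
proof (rule bholI)
  show "F z * G z = F z' * G z'" if "\<And>i. i \<in> S \<Longrightarrow> z i = z' i" for z z'
    using bhol_cong[OF F that] bhol_cong[OF G that] by simp
  show "norm (F z * G z) \<le> B * C" if "z \<in> polydisc S r" for z
    unfolding norm_mult
    by (rule mult_mono[OF bhol_bound[OF F that] bhol_bound[OF G that]])
       (use bhol_bound[OF F that] norm_ge_zero[of "F z"] in \<open>linarith, simp\<close>)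
qed (intro holomorphic_intros bhol_holo[OF F] bhol_holo[OF G]; assumption)

lemma bhol_cmult: "bhol S r B F \<Longrightarrow> bhol S r (norm c * B) (\<lambda>z. c * F z)"
  by (intro bhol_mult bhol_const) auto

lemma bhol_diff:
  assumes F: "bhol S r B F" and G: "bhol S r C G"
  shows "bhol S r (B + C) (\<lambda>z. F z - G z)"
  using bhol_add[OF F bhol_cmult[OF G, of "-1"]] by simp

lemma bhol_inverse:
  assumes F: "bhol S r B F" and "\<eta> > 0" "\<And>z. z \<in> polydisc S r \<Longrightarrow> \<eta> \<le> norm (F z)"
  shows "bhol S r (1 / \<eta>) (\<lambda>z. 1 / F z)"
proof (rule bholI)
  show "1 / F z = 1 / F z'" if "\<And>i. i \<in> S \<Longrightarrow> z i = z' i" for z z'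
    using bhol_cong[OF F that] by simp
  show "norm (1 / F z) \<le> 1 / \<eta>" if "z \<in> polydisc S r" for z
    using assms(2) assms(3)[OF that] by (simp add: norm_divide divide_simps)
  show "(\<lambda>w. 1 / F (z(i := w))) holomorphic_on ball 0 (r i)" if "z \<in> polydisc S r" "i \<in> S" for z i
  proof (intro holomorphic_intros bhol_holo[OF F that])
    fix w :: complex assume "w \<in> ball 0 (r i)"
    then have "\<eta> \<le> norm (F (z(i := w)))"
      using that by (intro assms(3) polydisc_upd) auto
    then show "F (z(i := w)) \<noteq> 0" using assms(2) by auto
  qed
qed

lemma bhol_upd:
  assumes F: "bhol S r B F" and "norm c < r i"
  shows "bhol (S - {i}) r B (\<lambda>z. F (z(i := c)))"
proof (rule bholI)
  have in_pd: "z(i := c) \<in> polydisc S r" if "z \<in> polydisc (S - {i}) r" for z :: "'a \<Rightarrow> complex"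
    using that assms(2) by (auto simp: polydisc_def)
  show "F (z(i := c)) = F (z'(i := c))" if "\<And>j. j \<in> S - {i} \<Longrightarrow> z j = z' j" for z z'
    using that by (intro bhol_cong[OF F]) auto
  show "norm (F (z(i := c))) \<le> B" if "z \<in> polydisc (S - {i}) r" for z
    using bhol_bound[OF F in_pd[OF that]] .
  show "(\<lambda>w. F (z(j := w, i := c))) holomorphic_on ball 0 (r j)"
    if "z \<in> polydisc (S - {i}) r" "j \<in> S - {i}" for z j
    using bhol_holo[OF F in_pd[OF that(1)], of j] that(2) by (simp add: fun_upd_twist[of j i])
qed

text \<open>Holomorphy is tested on coordinate discs only, so the one-variable theorem on uniform
  limits suffices. Independence of the coordinates outside \<open>S\<close> is assumed for
  \<open>G\<close>, because convergence says nothing off the polydisc.\<close>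

lemma bhol_uniform_limit:
  assumes F: "\<And>n. bhol S r (B n) (F n)"
    and cong: "\<And>z z'. (\<And>i. i \<in> S \<Longrightarrow> z i = z' i) \<Longrightarrow> G z = G z'"
    and unif: "uniform_limit (polydisc S r) F G sequentially"
    and B: "\<And>n. B n \<le> C"
  shows "bhol S r C G"
proof (rule bholI)
  show "G z = G z'" if "\<And>i. i \<in> S \<Longrightarrow> z i = z' i" for z z'
    using cong[OF that] .
  show "norm (G z) \<le> C" if "z \<in> polydisc S r" for z
  proof (rule tendsto_upperbound[OF tendsto_norm[OF tendsto_uniform_limitI[OF unif that]]])
    show "\<forall>\<^sub>F n in sequentially. norm (F n z) \<le> C"
      using bhol_bound[OF F that] B order_trans by (intro always_eventually allI) blast
  qed simp
  show "(\<lambda>w. G (z(i := w))) holomorphic_on ball 0 (r i)" if z: "z \<in> polydisc S r" and i: "i \<in> S" for z i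
  proof (rule holomorphic_uniform_sequence[where f = "\<lambda>n w. F n (z(i := w))"])
    show "(\<lambda>w. F n (z(i := w))) holomorphic_on ball 0 (r i)" for n
      using bhol_holo[OF F z i] .
    fix x :: complex assume "x \<in> ball 0 (r i)"
    then obtain d where d: "d > 0" "cball x d \<subseteq> ball 0 (r i)"
      using open_contains_cball open_ball by metis
    have "uniform_limit (cball x d) (\<lambda>n w. F n (z(i := w))) (\<lambda>w. G (z(i := w))) sequentially"
      by (rule uniform_limit_compose'[OF unif]) (use d z i in \<open>auto intro!: polydisc_upd\<close>)
    then show "\<exists>d>0. cball x d \<subseteq> ball 0 (r i) \<and>
       uniform_limit (cball x d) (\<lambda>n w. F n (z(i := w))) (\<lambda>w. G (z(i := w))) sequentially"
      using d by blast
  qed simp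
qed

section \<open>Difference quotients in one coordinate\<close>

definition dq :: "'i \<Rightarrow> (('i \<Rightarrow> complex) \<Rightarrow> complex) \<Rightarrow> ('i \<Rightarrow> complex) \<Rightarrow> complex"
  where "dq i F z =
    (if z i = 0 then deriv (\<lambda>w. F (z(i := w))) 0 else (F z - F (z(i := 0))) / z i)"

text \<open>Division of \<open>F - F(z_i = 0)\<close> by \<open>z_i\<close>. At
  \<open>z i = 0\<close> the factor \<open>z i\<close> hides the value of the quotient, which the
  definition fills in by the derivative to remove the singularity.\<close>

lemma dq_eq: "F z = F (z(i := 0)) + z i * dq i F z"
proof (cases "z i = 0")
  case True
  then have "z(i := 0) = z" by (metis fun_upd_triv)
  with True show ?thesis by simp
qed (simp add: dq_def)

text \<open>For \<open>\<rho> / 2 \<le> norm w\<close> the numerator is at most \<open>2 * B\<close>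
  and the denominator at least \<open>\<rho> / 2\<close>, whence \<open>4 * B / \<rho>\<close>; the
  maximum principle carries the bound into the smaller disc.\<close>

lemma slope_holomorphic_bound:
  fixes \<phi> :: "complex \<Rightarrow> complex"
  assumes \<phi>: "\<phi> holomorphic_on ball 0 \<rho>" and B: "\<And>w. norm w < \<rho> \<Longrightarrow> norm (\<phi> w) \<le> B" and \<rho>: "\<rho> > 0"
  defines "\<psi> \<equiv> \<lambda>w. if w = 0 then deriv \<phi> 0 else (\<phi> w - \<phi> 0) / w"
  shows "\<psi> holomorphic_on ball 0 \<rho>" and "\<And>w. norm w < \<rho> \<Longrightarrow> norm (\<psi> w) \<le> 4 * B / \<rho>"
proof -
  show hol: "\<psi> holomorphic_on ball 0 \<rho>"
  proof -
    have eq: "(\<lambda>z. if z = 0 then deriv \<phi> 0 else (\<phi> z - \<phi> 0) / (z - 0)) = \<psi>"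
      unfolding \<psi>_def by (intro ext) simp
    have "0 \<in> interior (ball 0 \<rho>)" using \<rho> by simp
    from pole_lemma[OF \<phi> this] show ?thesis by (simp only: eq)
  qed
  have B0: "B \<ge> 0" using order_trans[OF norm_ge_zero B[of 0]] \<rho> by simp
  have big: "norm (\<psi> w) \<le> 4 * B / \<rho>" if "norm w < \<rho>" "norm w \<ge> \<rho> / 2" for w
  proof -
    have "w \<noteq> 0" using that \<rho> by auto
    have "norm (\<phi> w - \<phi> 0) \<le> B + B"
      using norm_triangle_ineq4[of "\<phi> w" "\<phi> 0"] B[of w] B[of 0] that \<rho> by simp
    then have "norm (\<psi> w) \<le> (2 * B) / norm w"
      using \<open>w \<noteq> 0\<close> by (simp add: \<psi>_def norm_divide divide_right_mono)
    also have "\<dots> \<le> (2 * B) / (\<rho> / 2)"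
      using that \<rho> B0 \<open>w \<noteq> 0\<close> by (intro divide_left_mono) auto
    finally show ?thesis by simp
  qed
  show "norm (\<psi> w) \<le> 4 * B / \<rho>" if w: "norm w < \<rho>" for w
  proof (cases "norm w \<ge> \<rho> / 2")
    case False
    show ?thesis
    proof (rule maximum_modulus_frontier[of \<psi> "cball 0 (\<rho> / 2)"])
      show "\<psi> holomorphic_on interior (cball 0 (\<rho> / 2))"
        using \<rho> by (intro holomorphic_on_subset[OF hol]) auto
      show "continuous_on (closure (cball 0 (\<rho> / 2))) \<psi>"
        using \<rho> by (intro holomorphic_on_imp_continuous_on holomorphic_on_subset[OF hol]) auto
      show "norm (\<psi> v) \<le> 4 * B / \<rho>" if "v \<in> frontier (cball 0 (\<rho> / 2))" for v
        using that \<rho> by (intro big) auto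
    qed (use False in auto)
  qed (use big w in auto)
qed

lemma dq_upd:
  "dq i F (z(i := w)) = (if w = 0 then deriv (\<lambda>w. F (z(i := w))) 0 else (F (z(i := w)) - F (z(i := 0))) / w)"
  by (simp add: dq_def)

text \<open>In direction \<open>i\<close> this is the one-variable statement. In another direction
  \<open>j\<close> the quotient is an explicit difference of holomorphic functions as long as
  \<open>z i \<noteq> 0\<close>; the case \<open>z i = 0\<close>, where it is a derivative, is
  reached by a uniform limit.\<close>

lemma bhol_dq:
  assumes F: "bhol S r B F" and i: "i \<in> S"
  shows "bhol S r (4 * B / r i) (dq i F)"
proof (rule bholI)
  have slope: "(\<lambda>w. dq i F (z(i := w))) holomorphic_on ball 0 (r i)"
     "\<And>w. norm w < r i \<Longrightarrow> norm (dq i F (z(i := w))) \<le> 4 * B / r i"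
     and ri: "r i > 0" if z: "z \<in> polydisc S r" for z
  proof -
    show ri: "r i > 0" using polydisc_D[OF z i] norm_ge_zero[of "z i"] by linarith
    have "norm (F (z(i := w))) \<le> B" if "norm w < r i" for w
      by (intro bhol_bound[OF F] polydisc_upd z that)
    note * = slope_holomorphic_bound[OF bhol_holo[OF F z i] this ri]
    then show "(\<lambda>w. dq i F (z(i := w))) holomorphic_on ball 0 (r i)"
      "\<And>w. norm w < r i \<Longrightarrow> norm (dq i F (z(i := w))) \<le> 4 * B / r i"
      by (simp_all only: dq_upd)
  qed
  show "dq i F z = dq i F z'" if eq: "\<And>j. j \<in> S \<Longrightarrow> z j = z' j" for z z'
  proof -
    have "F (z(i := w)) = F (z'(i := w))" for w
      using eq by (intro bhol_cong[OF F]) auto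
    moreover have "F z = F z'" using eq by (rule bhol_cong[OF F])
    ultimately show ?thesis using eq[OF i] by (simp add: dq_def)
  qed
  show "norm (dq i F z) \<le> 4 * B / r i" if z: "z \<in> polydisc S r" for z
    using slope(2)[OF z, of "z i"] polydisc_D[OF z i] by simp
  show "(\<lambda>w. dq i F (z(j := w))) holomorphic_on ball 0 (r j)" if z: "z \<in> polydisc S r" and j: "j \<in> S" for z j
  proof (cases "j = i")
    case True
    then show ?thesis using slope(1)[OF z] by simp
  next
    case ji: False
    have nz: "(\<lambda>w. dq i F (z(j := w, i := t))) holomorphic_on ball 0 (r j)"
      if t: "t \<noteq> 0" "norm t < r i" for t
    proof -
      have "(\<lambda>w. dq i F (z(j := w, i := t))) = (\<lambda>w. (F (z(i := t, j := w)) - F (z(i := 0, j := w))) / t)"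
        unfolding dq_upd using t ji by (simp add: fun_upd_twist[of j i])
      moreover have "z(i := t) \<in> polydisc S r" "z(i := 0) \<in> polydisc S r"
        using z t ri[OF z] by (auto intro!: polydisc_upd)
      ultimately show ?thesis
        using bhol_holo[OF F _ j] t by (auto intro!: holomorphic_intros)
    qed
    show ?thesis
    proof (cases "z i = 0")
      case False
      have "z(j := w) = z(j := w, i := z i)" for w using ji by auto
      then have "(\<lambda>w. dq i F (z(j := w))) = (\<lambda>w. dq i F (z(j := w, i := z i)))" by presburger
      then show ?thesis using nz[OF False polydisc_D[OF z i]] by (simp only:)
    next
      case True
      \<comment> \<open>A null sequence of nonzero points; the summand \<open>2\<close> keeps even
        \<open>t 0\<close> strictly inside the disc.\<close>
      define t where "t n = complex_of_real (r i / (real n + 2))" for n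
      have rp: "r i > 0" using ri[OF z] .
      have tn: "norm (t n) = r i / (real n + 2)" for n
        using rp unfolding t_def norm_of_real by simp
      have t: "norm (t n) < r i" "norm (t n) > 0" for n
        using rp by (auto simp: tn divide_simps)
      then have t: "t n \<noteq> 0" "norm (t n) < r i" for n
        using norm_eq_zero[of "t n"] t[of n] by auto
      have z0: "z(j := w) = z(j := w, i := 0)" for w using ji True by auto
      \<comment> \<open>A Lipschitz constant in \<open>z i\<close>, uniform in \<open>w\<close>: the
        slope bound is applied a second time, now to \<open>dq i F\<close>, whose own bound is
        \<open>4 * B / r i\<close>.\<close>
      define K where "K = 4 * (4 * B / r i) / r i"
      have est: "norm (dq i F (z(j := w, i := t n)) - dq i F (z(j := w, i := 0))) \<le> norm (t n) * K"
        if w: "norm w < r j" for w n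
      proof -
        have zw: "z(j := w) \<in> polydisc S r" using z w by (intro polydisc_upd)
        note * = slope_holomorphic_bound(2)[OF slope(1)[OF zw] slope(2)[OF zw] rp t(2)[of n]]
        then have "norm ((dq i F (z(j := w, i := t n)) - dq i F (z(j := w, i := 0))) / t n) \<le> K"
          using t(1)[of n] unfolding K_def by (simp only: if_False)
        then show ?thesis using t(1)[of n] by (simp add: norm_divide divide_simps mult.commute)
      qed
      have lim0: "(\<lambda>n. norm (t n) * K) \<longlonglongrightarrow> 0"
      proof -
        have "(\<lambda>n. r i / (real n + 2) * K) \<longlonglongrightarrow> 0" by real_asymp
        then show ?thesis by (simp only: tn)
      qed
      have unif: "uniform_limit (ball 0 (r j)) (\<lambda>n w. dq i F (z(j := w, i := t n))) (\<lambda>w. dq i F (z(j := w, i := 0))) sequentially"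
      proof (rule uniform_limitI)
        fix e :: real assume "e > 0"
        then have "\<forall>\<^sub>F n in sequentially. norm (t n) * K < e"
          using order_tendstoD(2)[OF lim0] by blast
        then show "\<forall>\<^sub>F n in sequentially. \<forall>w\<in>ball 0 (r j).
            dist (dq i F (z(j := w, i := t n))) (dq i F (z(j := w, i := 0))) < e"
          by eventually_elim (intro ballI, unfold dist_norm, rule le_less_trans[OF est], auto)
      qed
      have "(\<lambda>w. dq i F (z(j := w, i := 0))) holomorphic_on ball 0 (r j)"
      proof (rule holomorphic_uniform_sequence[where f = "\<lambda>n w. dq i F (z(j := w, i := t n))"])
        fix x :: complex assume "x \<in> ball 0 (r j)"
        then obtain d where d: "d > 0" "cball x d \<subseteq> ball 0 (r j)"
          using open_contains_cball open_ball by metis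
        then show "\<exists>d>0. cball x d \<subseteq> ball 0 (r j) \<and>
          uniform_limit (cball x d) (\<lambda>n w. dq i F (z(j := w, i := t n))) (\<lambda>w. dq i F (z(j := w, i := 0))) sequentially"
          using uniform_limit_on_subset[OF unif] by blast
      qed (use nz t in auto)
      then show ?thesis using z0 by simp
    qed
  qed
qed

section \<open>Functions holomorphic near the origin\<close>

definition near :: "'i set \<Rightarrow> ('i \<Rightarrow> complex) filter"
  where "near S = (INF r\<in>{r. \<forall>i. 0 < r i}. principal (polydisc S r))"

text \<open>\<open>hg S\<close> consists of functions, not of germs; ideals will be required to be closed under equality
  near the origin instead of passing to a quotient.\<close>

definition hg :: "'i set \<Rightarrow> (('i \<Rightarrow> complex) \<Rightarrow> complex) set"
  where "hg S = {F. \<exists>r B. (\<forall>i. 0 < r i) \<and> bhol S r B F}"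

text \<open>The pointwise minimum of two radii shows that polydiscs form a base. Since only
  coordinates in \<open>S\<close> are constrained, more active variables give a finer filter, and
  statements pass to larger sets of variables.\<close>

lemma eventually_near:
  "eventually Q (near S) \<longleftrightarrow> (\<exists>r. (\<forall>i. 0 < r i) \<and> (\<forall>z\<in>polydisc S r. Q z))"
proof -
  have "eventually Q (near S) \<longleftrightarrow> (\<exists>r\<in>{r. \<forall>i. 0 < r i}. eventually Q (principal (polydisc S r)))"
    unfolding near_def
  proof (rule eventually_INF_base)
    show "{r :: 'a \<Rightarrow> real. \<forall>i. 0 < r i} \<noteq> {}" by (auto intro: exI[of _ "\<lambda>_. 1"])
    fix r r' :: "'a \<Rightarrow> real" assume "r \<in> {r. \<forall>i. 0 < r i}" "r' \<in> {r. \<forall>i. 0 < r i}"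
    then show "\<exists>x\<in>{r. \<forall>i. 0 < r i}. principal (polydisc S x) \<le> inf (principal (polydisc S r)) (principal (polydisc S r'))"
      by (intro bexI[of _ "\<lambda>i. min (r i) (r' i)"]) (auto simp: polydisc_def)
  qed
  then show ?thesis by (auto simp: eventually_principal)
qed

lemma eventually_near_mono: "T \<subseteq> S \<Longrightarrow> eventually Q (near T) \<Longrightarrow> eventually Q (near S)"
  unfolding eventually_near using polydisc_mono[of T] by (metis order_refl subsetD)

lemma eventually_near_polydisc: "(\<And>i. 0 < r i) \<Longrightarrow> eventually (\<lambda>z. z \<in> polydisc S r) (near S)"
  unfolding eventually_near by blast

lemma hgI: "(\<And>i. 0 < r i) \<Longrightarrow> bhol S r B F \<Longrightarrow> F \<in> hg S"
  unfolding hg_def by blast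

lemma hgE: assumes "F \<in> hg S" obtains r B where "\<And>i. 0 < r i" "bhol S r B F"
  using assms unfolding hg_def by blast

lemma hg_cong: "F \<in> hg S \<Longrightarrow> (\<And>i. i \<in> S \<Longrightarrow> z i = z' i) \<Longrightarrow> F z = F z'"
  by (metis hgE bhol_cong)

lemma hg_common:
  assumes "finite Fs" "Fs \<subseteq> hg S"
  shows "\<exists>r. (\<forall>i. 0 < r i) \<and> (\<forall>F\<in>Fs. \<exists>B. bhol S r B F)"
  using assms
proof (induction Fs)
  case empty
  then show ?case by (intro exI[of _ "\<lambda>_. 1"]) auto
next
  case (insert F Fs)
  then obtain r where r: "\<forall>i. 0 < r i" "\<forall>F\<in>Fs. \<exists>B. bhol S r B F" by auto
  from insert.prems have "F \<in> hg S" by simp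
  then obtain r' B where r': "\<And>i. 0 < r' i" "bhol S r' B F" by (rule hgE) (rule that; blast)
  show ?case
  proof (intro exI[of _ "\<lambda>i. min (r i) (r' i)"] conjI allI ballI)
    fix G assume "G \<in> insert F Fs"
    then obtain B' r'' where "bhol S r'' B' G" "r'' = r \<or> r'' = r'" using r r' by auto
    then show "\<exists>B. bhol S (\<lambda>i. min (r i) (r' i)) B G"
      by (intro exI[of _ B'], elim disjE) (rule bhol_mono[of S r'' B' G]; auto)+
  qed (use r r' in auto)
qed

lemma hg_common2:
  assumes "F \<in> hg S" "G \<in> hg S"
  obtains r B C where "\<And>i. 0 < r i" "bhol S r B F" "bhol S r C G"
proof -
  obtain r where r: "\<And>i. 0 < r i" "\<And>H. H \<in> {F, G} \<Longrightarrow> \<exists>B. bhol S r B H"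
    using hg_common[of "{F, G}" S] assms by auto
  obtain B C where "bhol S r B F" "bhol S r C G" using r(2)[of F] r(2)[of G] by auto
  with r(1) show thesis by (rule that)
qed

lemma hg_mono: "F \<in> hg T \<Longrightarrow> T \<subseteq> S \<Longrightarrow> F \<in> hg S"
  by (elim hgE) (rule hgI, assumption, rule bhol_mono, auto)

lemma hg_const: "(\<lambda>_. c) \<in> hg S"
  by (rule hgI[where r = "\<lambda>_. 1"]) (auto intro: bhol_const)

lemma hg_coord: "i \<in> S \<Longrightarrow> (\<lambda>z. z i) \<in> hg S"
  by (rule hgI[where r = "\<lambda>_. 1"]) (auto intro: bhol_coord)

lemma hg_add: "F \<in> hg S \<Longrightarrow> G \<in> hg S \<Longrightarrow> (\<lambda>z. F z + G z) \<in> hg S"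
  by (rule hg_common2, assumption+) (rule hgI, assumption, rule bhol_add)

lemma hg_mult: "F \<in> hg S \<Longrightarrow> G \<in> hg S \<Longrightarrow> (\<lambda>z. F z * G z) \<in> hg S"
  by (rule hg_common2, assumption+) (rule hgI, assumption, rule bhol_mult)

lemma hg_diff: "F \<in> hg S \<Longrightarrow> G \<in> hg S \<Longrightarrow> (\<lambda>z. F z - G z) \<in> hg S"
  by (rule hg_common2, assumption+) (rule hgI, assumption, rule bhol_diff)

lemma hg_cmult: "F \<in> hg S \<Longrightarrow> (\<lambda>z. c * F z) \<in> hg S"
  by (rule hg_mult[OF hg_const])

lemma hg_uminus: "F \<in> hg S \<Longrightarrow> (\<lambda>z. - F z) \<in> hg S"
  using hg_cmult[of F S "-1"] by simp

lemma hg_sum: "(\<And>a. a \<in> A \<Longrightarrow> F a \<in> hg S) \<Longrightarrow> (\<lambda>z. \<Sum>a\<in>A. F a z) \<in> hg S"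
  by (induction A rule: infinite_finite_induct) (auto intro: hg_add hg_const)

lemma hg_power: "F \<in> hg S \<Longrightarrow> (\<lambda>z. F z ^ n) \<in> hg S"
  by (induction n) (auto intro: hg_mult hg_const)

lemma hg_upd0: assumes "F \<in> hg S" shows "(\<lambda>z. F (z(i := 0))) \<in> hg (S - {i})"
proof -
  obtain r B where r: "\<And>i. 0 < r i" "bhol S r B F" by (rule hgE[OF assms]) (rule that; blast)
  show ?thesis using r(1) bhol_upd[OF r(2), of 0 i] by (intro hgI) auto
qed

lemma hg_dq: assumes "F \<in> hg S" "i \<in> S" shows "dq i F \<in> hg S"
proof -
  obtain r B where r: "\<And>i. 0 < r i" "bhol S r B F" by (rule hgE[OF assms(1)]) (rule that; blast)
  show ?thesis using r(1) bhol_dq[OF r(2) assms(2)] by (rule hgI)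
qed

section \<open>Expansions at a point and restrictions to complex lines\<close>

lemma bhol_bound_nonneg: "bhol S r B F \<Longrightarrow> (\<And>i. i \<in> S \<Longrightarrow> 0 < r i) \<Longrightarrow> 0 \<le> B"
  using order_trans[OF norm_ge_zero bhol_bound[of S r B F "\<lambda>_. 0"]] by (simp add: polydisc_def)

text \<open>Induction on the variables by \<open>F = F(z_i = 0) + z_i * dq i F\<close>: the first
  summand has one variable less, and the quotient is bounded by \<open>4 * B / r i\<close>.\<close>

lemma bhol_lipschitz_0:
  assumes "finite S" "\<And>i. i \<in> S \<Longrightarrow> 0 < r i" "bhol S r B F"
  shows "\<exists>K\<ge>0. \<forall>z\<in>polydisc S r. norm (F z - F (\<lambda>_. 0)) \<le> K * (\<Sum>i\<in>S. norm (z i))"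
  using assms
proof (induction S arbitrary: B F)
  case empty
  have "F z = F (\<lambda>_. 0)" for z using bhol_cong[OF empty(2)] by auto
  then have "norm (F z - F (\<lambda>_. 0)) = 0" for z by (metis cancel_comm_monoid_add_class.diff_cancel norm_zero)
  then show ?case by (intro exI[of _ 0]) simp
next
  case (insert i S)
  define G where "G = (\<lambda>z. F (z(i := 0)))"
  have G0: "G (\<lambda>_. 0) = F (\<lambda>_. 0)"
    unfolding G_def by (rule arg_cong[of _ _ F]) auto
  have eqS: "insert i S - {i} = S" using insert.hyps(2) by auto
  have "norm (0 :: complex) < r i" using insert.prems(1) by simp
  from bhol_upd[OF insert.prems(2) this] have "bhol S r B G" unfolding eqS G_def .
  from insert.IH[OF _ this] insert.prems obtain K where K: "K \<ge> 0"
    "\<And>z. z \<in> polydisc S r \<Longrightarrow> norm (G z - G (\<lambda>_. 0)) \<le> K * (\<Sum>i\<in>S. norm (z i))" by auto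
  define L where "L = 4 * B / r i"
  have B: "B \<ge> 0" using bhol_bound_nonneg insert.prems by blast
  have L: "L \<ge> 0" using B insert.prems(1)[of i] by (simp add: L_def)
  show ?case
  proof (intro exI[of _ "K + L"] conjI ballI)
    fix z assume z: "z \<in> polydisc (insert i S) r"
    have zS: "z \<in> polydisc S r" using z by (auto simp: polydisc_def)
    have H: "norm (dq i F z) \<le> L"
      unfolding L_def by (rule bhol_bound[OF bhol_dq[OF insert.prems(2)] z]) auto
    have s: "(\<Sum>i\<in>S. norm (z i)) \<ge> 0" by (intro sum_nonneg) auto
    have "norm (F z - F (\<lambda>_. 0)) = norm ((G z - G (\<lambda>_. 0)) + z i * dq i F z)"
      using dq_eq[of F z i] G0 by (simp add: G_def add.commute add_diff_eq)
    also have "\<dots> \<le> K * (\<Sum>i\<in>S. norm (z i)) + norm (z i) * L"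
      using K(2)[OF zS] mult_left_mono[OF H, of "norm (z i)"]
      by (intro norm_triangle_mono) (auto simp: norm_mult)
    also have "\<dots> \<le> (K + L) * (\<Sum>i\<in>insert i S. norm (z i))"
      using insert.hyps K(1) L s by (simp add: algebra_simps)
    finally show "norm (F z - F (\<lambda>_. 0)) \<le> (K + L) * (\<Sum>i\<in>insert i S. norm (z i))" .
  qed (use K L in auto)
qed

text \<open>The same splitting, with the Lipschitz estimate applied to the quotient, whose value at
  the origin becomes the linear coefficient of \<open>z_i\<close>. In this way boundedness and
  separate holomorphy yield total differentiability.\<close>

lemma bhol_second_order_0:
  assumes "finite S" "\<And>i. i \<in> S \<Longrightarrow> 0 < r i" "bhol S r B F"
  shows "\<exists>d K. K \<ge> 0 \<and> (\<forall>z\<in>polydisc S r.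
    norm (F z - F (\<lambda>_. 0) - (\<Sum>i\<in>S. d i * z i)) \<le> K * (\<Sum>i\<in>S. norm (z i))\<^sup>2)"
  using assms
proof (induction S arbitrary: B F)
  case empty
  have "F z = F (\<lambda>_. 0)" for z using bhol_cong[OF empty(2)] by auto
  then have "norm (F z - F (\<lambda>_. 0)) = 0" for z by (metis cancel_comm_monoid_add_class.diff_cancel norm_zero)
  then show ?case by (intro exI[of _ 0] exI[of _ "\<lambda>_. 0"]) simp
next
  case (insert i S)
  define G where "G = (\<lambda>z. F (z(i := 0)))"
  define H where "H = dq i F"
  have G0: "G (\<lambda>_. 0) = F (\<lambda>_. 0)"
    unfolding G_def by (rule arg_cong[of _ _ F]) auto
  have eqS: "insert i S - {i} = S" using insert.hyps(2) by auto
  have "norm (0 :: complex) < r i" using insert.prems(1) by simp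
  from bhol_upd[OF insert.prems(2) this] have "bhol S r B G" unfolding eqS G_def .
  from insert.IH[OF _ this] insert.prems obtain d K where K: "K \<ge> 0"
    "\<And>z. z \<in> polydisc S r \<Longrightarrow> norm (G z - G (\<lambda>_. 0) - (\<Sum>i\<in>S. d i * z i)) \<le> K * (\<Sum>i\<in>S. norm (z i))\<^sup>2" by auto
  have "bhol (insert i S) r (4 * B / r i) H" unfolding H_def by (rule bhol_dq[OF insert.prems(2)]) auto
  from bhol_lipschitz_0[OF _ _ this] insert obtain L where L: "L \<ge> 0"
     "\<And>z. z \<in> polydisc (insert i S) r \<Longrightarrow> norm (H z - H (\<lambda>_. 0)) \<le> L * (\<Sum>i\<in>insert i S. norm (z i))" by auto
  define d' where "d' = d(i := H (\<lambda>_. 0))"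
  show ?case
  proof (intro exI[of _ d'] exI[of _ "K + L"] conjI ballI)
    fix z assume z: "z \<in> polydisc (insert i S) r"
    have zS: "z \<in> polydisc S r" using z by (auto simp: polydisc_def)
    define s where "s = (\<Sum>i\<in>S. norm (z i))"
    define t where "t = (\<Sum>i\<in>insert i S. norm (z i))"
    have t: "t = norm (z i) + s" using insert.hyps by (simp add: s_def t_def)
    have s: "s \<ge> 0" unfolding s_def by (intro sum_nonneg) auto
    have d': "(\<Sum>j\<in>insert i S. d' j * z j) = H (\<lambda>_. 0) * z i + (\<Sum>j\<in>S. d j * z j)"
      using insert.hyps by (auto simp: d'_def intro!: sum.cong)
    have "F z - F (\<lambda>_. 0) - (\<Sum>j\<in>insert i S. d' j * z j)
        = (G z - G (\<lambda>_. 0) - (\<Sum>i\<in>S. d i * z i)) + z i * (H z - H (\<lambda>_. 0))"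
      using dq_eq[of F z i] G0 by (simp add: G_def d' H_def algebra_simps)
    also have "norm \<dots> \<le> K * s\<^sup>2 + norm (z i) * (L * t)"
      using K(2)[OF zS] mult_left_mono[OF L(2)[OF z], of "norm (z i)"]
      by (intro norm_triangle_mono) (auto simp: norm_mult s_def t_def)
    also have "\<dots> \<le> K * t\<^sup>2 + t * (L * t)"
      using K(1) L(1) s by (intro add_mono mult_left_mono mult_right_mono power_mono) (auto simp: t)
    also have "\<dots> = (K + L) * t\<^sup>2" by (simp add: algebra_simps power2_eq_square)
    finally show "norm (F z - F (\<lambda>_. 0) - (\<Sum>j\<in>insert i S. d' j * z j)) \<le> (K + L) * (\<Sum>i\<in>insert i S. norm (z i))\<^sup>2"
      unfolding t_def .
  qed (use K L in auto)
qed

text \<open>Moving the centre to \<open>c\<close> costs \<open>norm (c i)\<close> of each radius;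
  expansions at the origin thereby become expansions at any point.\<close>

lemma bhol_translate:
  assumes F: "bhol S r B F" and c: "c \<in> polydisc S r"
  shows "bhol S (\<lambda>i. r i - norm (c i)) B (\<lambda>z. F (\<lambda>i. c i + z i))"
proof (rule bholI)
  have pd: "(\<lambda>i. c i + z i) \<in> polydisc S r" if "z \<in> polydisc S (\<lambda>i. r i - norm (c i))" for z
    unfolding polydisc_def
  proof (intro CollectI ballI)
    fix i assume "i \<in> S"
    then show "norm (c i + z i) < r i"
      using that norm_triangle_ineq[of "c i" "z i"] by (force simp: polydisc_def)
  qed
  show "F (\<lambda>i. c i + z i) = F (\<lambda>i. c i + z' i)" if "\<And>i. i \<in> S \<Longrightarrow> z i = z' i" for z z'
    using that by (intro bhol_cong[OF F]) auto
  show "norm (F (\<lambda>i. c i + z i)) \<le> B" if "z \<in> polydisc S (\<lambda>i. r i - norm (c i))" for z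
    using bhol_bound[OF F pd[OF that]] .
  show "(\<lambda>w. F (\<lambda>j. c j + (z(i := w)) j)) holomorphic_on ball 0 (r i - norm (c i))"
    if z: "z \<in> polydisc S (\<lambda>i. r i - norm (c i))" and i: "i \<in> S" for z i
  proof -
    have eq: "(\<lambda>w. F (\<lambda>j. c j + (z(i := w)) j)) = (\<lambda>w. F ((\<lambda>j. c j + z j)(i := w))) \<circ> (\<lambda>w. c i + w)"
      by (auto simp: fun_eq_iff intro!: arg_cong[of _ _ F])
    have "(\<lambda>w. F ((\<lambda>j. c j + z j)(i := w))) \<circ> (\<lambda>w. c i + w) holomorphic_on ball 0 (r i - norm (c i))"
    proof (rule holomorphic_on_compose_gen[OF _ bhol_holo[OF F pd[OF z] i]])
      show "(\<lambda>w. c i + w) ` ball 0 (r i - norm (c i)) \<subseteq> ball 0 (r i)"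
      proof (intro image_subsetI)
        fix w :: complex assume "w \<in> ball 0 (r i - norm (c i))"
        then show "c i + w \<in> ball 0 (r i)" using norm_triangle_ineq[of "c i" w] by auto
      qed
    qed (intro holomorphic_intros)
    then show ?thesis by (simp only: eq)
  qed
qed

lemma bhol_second_order:
  assumes "finite S" "bhol S r B F" "c \<in> polydisc S r"
  shows "\<exists>d K. K \<ge> 0 \<and> (\<forall>z\<in>polydisc S (\<lambda>i. r i - norm (c i)).
    norm (F (\<lambda>i. c i + z i) - F c - (\<Sum>i\<in>S. d i * z i)) \<le> K * (\<Sum>i\<in>S. norm (z i))\<^sup>2)"
proof -
  have "0 < r i - norm (c i)" if "i \<in> S" for i using polydisc_D[OF assms(3) that] by simp
  from bhol_second_order_0[OF assms(1) this bhol_translate[OF assms(2,3)]] show ?thesis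
    by simp
qed

text \<open>The quadratic error, divided by \<open>\<tau>\<close>, is at most
  \<open>K * V\<^sup>2 * norm \<tau>\<close>, so the derivative is the linear form with coefficients
  \<open>d\<close> evaluated at \<open>v\<close>.\<close>

lemma bhol_line_deriv:
  assumes "finite S" "bhol S r B F" "c \<in> polydisc S r"
  shows "\<exists>D. ((\<lambda>\<tau>. F (\<lambda>i. c i + \<tau> * v i)) has_field_derivative D) (at 0)"
proof -
  obtain d K where K: "K \<ge> 0" "\<And>z. z \<in> polydisc S (\<lambda>i. r i - norm (c i)) \<Longrightarrow>
    norm (F (\<lambda>i. c i + z i) - F c - (\<Sum>i\<in>S. d i * z i)) \<le> K * (\<Sum>i\<in>S. norm (z i))\<^sup>2"
    using bhol_second_order[OF assms] by auto
  define D where "D = (\<Sum>i\<in>S. d i * v i)"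
  define V where "V = (\<Sum>i\<in>S. norm (v i))"
  have ev: "\<forall>\<^sub>F \<tau> in at 0. (\<lambda>i. \<tau> * v i) \<in> polydisc S (\<lambda>i. r i - norm (c i))"
    unfolding polydisc_def mem_Collect_eq
  proof (rule eventually_ball_finite[OF assms(1)], rule ballI)
    fix i assume "i \<in> S"
    then have "0 < r i - norm (c i)" using polydisc_D[OF assms(3)] by simp
    moreover have "((\<lambda>\<tau>. norm (\<tau> * v i)) \<longlongrightarrow> norm (0 * v i)) (at 0)" by (intro tendsto_intros)
    ultimately show "\<forall>\<^sub>F \<tau> in at 0. norm (\<tau> * v i) < r i - norm (c i)"
      by (intro order_tendstoD(2)) auto
  qed
  have "((\<lambda>\<tau>. (F (\<lambda>i. c i + \<tau> * v i) - F c) / \<tau> - D) \<longlongrightarrow> 0) (at 0)"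
  proof (rule Lim_null_comparison[where g = "\<lambda>\<tau>. K * V\<^sup>2 * norm \<tau>"])
    show "\<forall>\<^sub>F \<tau> in at 0. norm ((F (\<lambda>i. c i + \<tau> * v i) - F c) / \<tau> - D) \<le> K * V\<^sup>2 * norm \<tau>"
      using ev eventually_neq_at_within[of 0 0 UNIV]
    proof eventually_elim
      case (elim \<tau>)
      have "norm (F (\<lambda>i. c i + \<tau> * v i) - F c - \<tau> * D) \<le> K * (norm \<tau> * V)\<^sup>2"
        using K(2)[OF elim(1)] by (simp add: D_def V_def sum_distrib_left norm_mult mult.left_commute)
      moreover have "(F (\<lambda>i. c i + \<tau> * v i) - F c) / \<tau> - D = (F (\<lambda>i. c i + \<tau> * v i) - F c - \<tau> * D) / \<tau>"
        using elim(2) by (simp add: field_simps)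
      ultimately show ?case using elim(2) by (simp add: norm_divide divide_simps power2_eq_square mult_ac)
    qed
    have "((\<lambda>\<tau>::complex. K * V\<^sup>2 * norm \<tau>) \<longlongrightarrow> K * V\<^sup>2 * norm (0::complex)) (at 0)" by (intro tendsto_intros)
    then show "((\<lambda>\<tau>::complex. K * V\<^sup>2 * norm \<tau>) \<longlongrightarrow> 0) (at 0)" by simp
  qed
  then have "((\<lambda>\<tau>. F (\<lambda>i. c i + \<tau> * v i)) has_field_derivative D) (at 0)"
    unfolding has_field_derivative_iff by (simp add: LIM_zero_iff)
  then show ?thesis ..
qed

text \<open>Lines not parallel to an axis occur in shears and in analytic continuation towards the
  origin. Differentiability at \<open>\<tau>\<close> is differentiability at \<open>0\<close> on the
  recentred line.\<close>

lemma bhol_line_holo: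
  assumes "finite S" "bhol S r B F" "open U" "\<And>\<tau>. \<tau> \<in> U \<Longrightarrow> (\<lambda>i. c i + \<tau> * v i) \<in> polydisc S r"
  shows "(\<lambda>\<tau>. F (\<lambda>i. c i + \<tau> * v i)) holomorphic_on U"
  unfolding holomorphic_on_open[OF assms(3)]
proof
  fix \<tau> assume "\<tau> \<in> U"
  from bhol_line_deriv[OF assms(1,2) assms(4)[OF this], of v] obtain D where
    "((\<lambda>\<sigma>. F (\<lambda>i. c i + \<tau> * v i + \<sigma> * v i)) has_field_derivative D) (at 0)" by auto
  then have "((\<lambda>\<sigma>. F (\<lambda>i. c i + (\<sigma> + \<tau>) * v i)) has_field_derivative D) (at 0)"
    by (simp add: algebra_simps)
  then have "((\<lambda>\<sigma>. F (\<lambda>i. c i + \<sigma> * v i)) has_field_derivative D) (at (0 + \<tau>))"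
    using DERIV_shift[of "\<lambda>\<sigma>. F (\<lambda>i. c i + \<sigma> * v i)" D 0 \<tau>] by simp
  then show "\<exists>f'. ((\<lambda>\<tau>. F (\<lambda>i. c i + \<tau> * v i)) has_field_derivative f') (at \<tau>)" by auto
qed

text \<open>A linear automorphism that preserves the coordinate \<open>i\<close> and sends the
  \<open>i\<close>-th axis to the line with direction \<open>c\<close>, where \<open>c i\<close> is
  read as \<open>1\<close>. It serves to make a given function regular in
  \<open>z i\<close>.\<close>

definition shear :: "'i \<Rightarrow> ('i \<Rightarrow> complex) \<Rightarrow> ('i \<Rightarrow> complex) \<Rightarrow> 'i \<Rightarrow> complex"
  where "shear i c z = (\<lambda>j. if j = i then z i else z j + c j * z i)"

lemma shear_shear_minus: "shear i (\<lambda>j. - c j) (shear i c z) = z" "shear i c (shear i (\<lambda>j. - c j) z) = z"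
  by (auto simp: shear_def)

lemma shear_polydisc:
  assumes "finite S" "\<And>i. 0 < r i" and i: "i \<in> S"
  shows "\<exists>r'. (\<forall>i. 0 < r' i) \<and> (\<forall>z\<in>polydisc S r'. shear i c z \<in> polydisc S r)"
proof -
  \<comment> \<open>Coordinates \<open>j \<noteq> i\<close> keep half of their radius, and the
    minimum of \<open>R\<close> keeps \<open>c j * z i\<close> within the other half. The summand
    \<open>1\<close> allows for \<open>c j = 0\<close>.\<close>
  define R where "R = insert (r i) ((\<lambda>j. r j / (2 * (norm (c j) + 1))) ` S)"
  define \<rho> where "\<rho> = Min R"
  have "\<rho> \<in> R" unfolding \<rho>_def by (rule Min_in) (auto simp: R_def assms)
  then have \<rho>: "\<rho> > 0" using assms(2) by (auto simp: R_def add_nonneg_pos)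
  have \<rho>i: "\<rho> \<le> r i" unfolding \<rho>_def by (rule Min_le) (auto simp: R_def assms)
  have \<rho>j: "\<rho> \<le> r j / (2 * (norm (c j) + 1))" if "j \<in> S" for j
    unfolding \<rho>_def by (rule Min_le) (use that in \<open>auto simp: R_def assms\<close>)
  define r' where "r' j = (if j = i then \<rho> else r j / 2)" for j
  show ?thesis
  proof (intro exI[of _ r'] conjI allI ballI)
    show "0 < r' j" for j using \<rho> assms(2) by (auto simp: r'_def)
    fix z assume z: "z \<in> polydisc S r'"
    have zi: "norm (z i) < \<rho>" using polydisc_D[OF z i] by (simp add: r'_def)
    show "shear i c z \<in> polydisc S r"
      unfolding polydisc_def
    proof (intro CollectI ballI)
      fix j assume j: "j \<in> S"
      show "norm (shear i c z j) < r j"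
      proof (cases "j = i")
        case False
        have "norm (c j * z i) \<le> (norm (c j) + 1) * \<rho>"
          unfolding norm_mult using zi by (intro mult_mono) auto
        also have "\<dots> \<le> (norm (c j) + 1) * (r j / (2 * (norm (c j) + 1)))"
          by (rule mult_left_mono[OF \<rho>j[OF j]]) auto
        also have "\<dots> = r j / 2"
        proof -
          have "norm (c j) + 1 \<noteq> 0" using norm_ge_zero[of "c j"] by linarith
          moreover have "q * (x / (2 * q)) = x / 2" if "q \<noteq> 0" for q x :: real using that by simp
          ultimately show ?thesis by blast
        qed
        finally have "norm (c j * z i) \<le> r j / 2" .
        moreover have "norm (z j) < r j / 2" using polydisc_D[OF z j] False by (simp add: r'_def)
        ultimately have "norm (z j + c j * z i) < r j"
          using norm_triangle_ineq[of "z j" "c j * z i"] by linarith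
        then show ?thesis using False by (simp add: shear_def)
      qed (use zi \<rho>i in \<open>simp add: shear_def\<close>)
    qed
  qed
qed

lemma eventually_near_shear:
  assumes "finite S" "i \<in> S" "eventually Q (near S)"
  shows "eventually (\<lambda>z. Q (shear i c z)) (near S)"
proof -
  obtain r where r: "\<And>i. 0 < r i" "\<And>z. z \<in> polydisc S r \<Longrightarrow> Q z"
    using assms(3) unfolding eventually_near by blast
  obtain r' where "\<And>i. 0 < r' i" "\<And>z. z \<in> polydisc S r' \<Longrightarrow> shear i c z \<in> polydisc S r"
    using shear_polydisc[of S r i c, OF assms(1) r(1) assms(2)] by auto
  with r assms(2) show ?thesis unfolding eventually_near by blast
qed

lemma hg_shear:
  assumes fin: "finite S" and i: "i \<in> S" and F: "F \<in> hg S"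
  shows "(\<lambda>z. F (shear i c z)) \<in> hg S"
proof -
  obtain r B where r: "\<And>i. 0 < r i" "bhol S r B F" by (rule hgE[OF F]) (rule that; blast)
  obtain r' where r': "\<And>i. 0 < r' i" "\<And>z. z \<in> polydisc S r' \<Longrightarrow> shear i c z \<in> polydisc S r"
    using shear_polydisc[of S r i c, OF fin r(1) i] by auto
  show ?thesis
  proof (rule hgI[OF r'(1)], rule bholI)
    show "F (shear i c z) = F (shear i c z')" if "\<And>j. j \<in> S \<Longrightarrow> z j = z' j" for z z'
      using that i by (intro bhol_cong[OF r(2)]) (auto simp: shear_def)
    show "norm (F (shear i c z)) \<le> B" if "z \<in> polydisc S r'" for z
      using bhol_bound[OF r(2) r'(2)[OF that]] .
    fix z k assume z: "z \<in> polydisc S r'" and k: "k \<in> S"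
    have pd: "shear i c (z(k := w)) \<in> polydisc S r" if "norm w < r' k" for w
      using that z k by (intro r'(2) polydisc_upd) auto
    \<comment> \<open>When the coordinate \<open>k\<close> varies, the sheared point runs through
      the line \<open>b + w * v\<close>, which is parallel to an axis unless
      \<open>k = i\<close>.\<close>
    define b where "b = (if k = i then z(i := 0) else shear i c (z(k := 0)))"
    define v where "v j = (if k = i then if j = i then 1 else c j else if j = k then 1 else 0)" for j
    have eq: "shear i c (z(k := w)) = (\<lambda>j. b j + w * v j)" for w
      by (auto simp: shear_def b_def v_def fun_eq_iff)
    have "(\<lambda>w. F (\<lambda>j. b j + w * v j)) holomorphic_on ball 0 (r' k)"
      by (rule bhol_line_holo[OF fin r(2)]) (use pd eq in auto)
    then show "(\<lambda>w. F (shear i c (z(k := w)))) holomorphic_on ball 0 (r' k)"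
      by (simp only: eq)
  qed
qed

lemma hg_tendsto_0:
  assumes "finite S" "F \<in> hg S" "e > 0"
  shows "eventually (\<lambda>z. norm (F z - F (\<lambda>_. 0)) < e) (near S)"
proof -
  obtain r B where r: "\<And>i. 0 < r i" "bhol S r B F" by (rule hgE[OF assms(2)]) (rule that; blast)
  obtain K where K: "K \<ge> 0" "\<And>z. z \<in> polydisc S r \<Longrightarrow> norm (F z - F (\<lambda>_. 0)) \<le> K * (\<Sum>i\<in>S. norm (z i))"
    using bhol_lipschitz_0[OF assms(1) r] by blast
  define \<delta> where "\<delta> = e / ((K + 1) * (real (card S) + 1))"
  have \<delta>: "\<delta> > 0" unfolding \<delta>_def using K(1) assms(3) by (simp add: add_nonneg_pos)
  have "eventually (\<lambda>z. z \<in> polydisc S r) (near S)" "eventually (\<lambda>z. z \<in> polydisc S (\<lambda>_. \<delta>)) (near S)"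
    using r(1) \<delta> by (auto intro: eventually_near_polydisc)
  then show ?thesis
  proof eventually_elim
    case (elim z)
    have "K * (\<Sum>i\<in>S. norm (z i)) \<le> K * (real (card S) * \<delta>)"
      using K(1) sum_bounded_above[of S "\<lambda>i. norm (z i)" \<delta>] polydisc_D[OF elim(2)]
      by (intro mult_left_mono) (auto intro: less_imp_le)
    also have "\<dots> = K * (real (card S)) * \<delta>" by simp
    also have "\<dots> < (K + 1) * (real (card S) + 1) * \<delta>"
      using K(1) \<delta> by (intro mult_strict_right_mono) (auto simp: algebra_simps add_nonneg_pos)
    also have "\<dots> = e" using K(1) by (simp add: \<delta>_def add_nonneg_eq_0_iff)
    finally show ?case using K(2)[OF elim(1)] by linarith
  qed
qed

text \<open>By continuity \<open>norm (F z)\<close> stays above half of its value at the origin,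
  which bounds the reciprocal.\<close>

lemma hg_inverse:
  assumes "finite S" "F \<in> hg S" "F (\<lambda>_. 0) \<noteq> 0"
  shows "(\<lambda>z. 1 / F z) \<in> hg S" "eventually (\<lambda>z. F z \<noteq> 0) (near S)"
proof -
  define \<eta> where "\<eta> = norm (F (\<lambda>_. 0)) / 2"
  have \<eta>: "\<eta> > 0" using assms(3) by (simp add: \<eta>_def)
  obtain r B where r: "\<And>i. 0 < r i" "bhol S r B F" by (rule hgE[OF assms(2)]) (rule that; blast)
  have ev: "eventually (\<lambda>z. \<eta> \<le> norm (F z)) (near S)"
    using hg_tendsto_0[OF assms(1,2) \<eta>]
  proof eventually_elim
    case (elim z)
    then show ?case using norm_triangle_ineq2[of "F (\<lambda>_. 0)" "F z"]
      by (simp add: norm_minus_commute) (simp add: \<eta>_def)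
  qed
  from ev show "eventually (\<lambda>z. F z \<noteq> 0) (near S)"
    by eventually_elim (use \<eta> in auto)
  obtain r' where r': "\<And>i. 0 < r' i" "\<And>z. z \<in> polydisc S r' \<Longrightarrow> \<eta> \<le> norm (F z)"
    using ev unfolding eventually_near by blast
  have b: "bhol S (\<lambda>i. min (r i) (r' i)) B F" by (rule bhol_mono[OF r(2)]) auto
  show "(\<lambda>z. 1 / F z) \<in> hg S"
    by (rule hgI[OF _ bhol_inverse[OF b \<eta>]]) (use r r' in \<open>auto simp: polydisc_def\<close>)
qed

section \<open>Weierstrass division\<close>

lemma bhol_sharpen: "bhol S r B F \<Longrightarrow> (\<And>z. z \<in> polydisc S r \<Longrightarrow> norm (F z) \<le> C) \<Longrightarrow> bhol S r C F"
  unfolding bhol_def by blast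

lemma bhol_differentiable_0:
  assumes "bhol S r B F" "i \<in> S" "z \<in> polydisc S r"
  shows "(\<lambda>w. F (z(i := w))) field_differentiable at 0"
proof -
  have "0 < r i" using polydisc_D[OF assms(3,2)] norm_ge_zero[of "z i"] by linarith
  then show ?thesis
    by (intro holomorphic_on_imp_differentiable_at[OF bhol_holo[OF assms(1,3,2)]]) auto
qed

lemma dq_diff:
  assumes "bhol S r B F" "bhol S r C G" "i \<in> S" "z \<in> polydisc S r"
  shows "dq i (\<lambda>z. F z - G z) z = dq i F z - dq i G z"
  using bhol_differentiable_0[OF assms(1,3,4)] bhol_differentiable_0[OF assms(2,3,4)]
  by (simp add: dq_def diff_divide_distrib)

lemma dq_cong:
  assumes eq: "\<And>z. z \<in> polydisc S r \<Longrightarrow> F z = G z" and z: "z \<in> polydisc S r" and i: "i \<in> S"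
  shows "dq i F z = dq i G z"
proof -
  have r: "0 < r i" using polydisc_D[OF z i] norm_ge_zero[of "z i"] by linarith
  have e: "F (z(i := w)) = G (z(i := w))" if "norm w < r i" for w
    using eq polydisc_upd[OF z that] by blast
  have "\<forall>\<^sub>F w in nhds 0. F (z(i := w)) = G (z(i := w))"
    by (rule eventually_nhds_in_open[of "ball 0 (r i)", THEN eventually_mono]) (use r e in auto)
  then have "deriv (\<lambda>w. F (z(i := w))) 0 = deriv (\<lambda>w. G (z(i := w))) 0"
    by (rule deriv_cong_ev) simp
  then show ?thesis using eq[OF z] e[of 0] r by (simp add: dq_def)
qed

lemma bhol_funpow_dq:
  assumes "bhol S r B F" "i \<in> S"
  shows "bhol S r ((4 / r i) ^ m * B) ((dq i ^^ m) F)"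
proof (induction m)
  case (Suc m)
  then show ?case using bhol_dq[OF Suc assms(2)] by (simp add: mult.assoc)
qed (use assms in simp)

lemma hg_funpow_dq: "F \<in> hg S \<Longrightarrow> i \<in> S \<Longrightarrow> (dq i ^^ m) F \<in> hg S"
  by (induction m) (auto intro: hg_dq)

lemma funpow_dq_diff:
  assumes "bhol S r B F" "bhol S r C G" "i \<in> S" "z \<in> polydisc S r"
  shows "(dq i ^^ m) (\<lambda>z. F z - G z) z = (dq i ^^ m) F z - (dq i ^^ m) G z"
  using assms(4)
proof (induction m arbitrary: z)
  case (Suc m)
  show ?case
    using dq_cong[of S r "(dq i ^^ m) (\<lambda>z. F z - G z)" "\<lambda>z. (dq i ^^ m) F z - (dq i ^^ m) G z" z i]
      Suc dq_diff[OF bhol_funpow_dq[OF assms(1,3)] bhol_funpow_dq[OF assms(2,3)] assms(3) Suc.prems] assms(3)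
    by simp
qed simp

lemma funpow_dq_cong:
  assumes "\<And>z. z \<in> polydisc S r \<Longrightarrow> F z = G z" "z \<in> polydisc S r" "i \<in> S"
  shows "(dq i ^^ m) F z = (dq i ^^ m) G z"
  using assms(2)
proof (induction m arbitrary: z)
  case (Suc m)
  then show ?case using dq_cong[of S r "(dq i ^^ m) F" "(dq i ^^ m) G" z i] assms(3) by simp
qed (use assms in auto)

lemma dq_coord_mult:
  assumes "bhol S r B F" "i \<in> S" "z \<in> polydisc S r"
  shows "dq i (\<lambda>z. z i * F z) z = F z"
proof (cases "z i = 0")
  case True
  have "deriv (\<lambda>w. w * F (z(i := w))) 0 = F (z(i := 0))"
    using bhol_differentiable_0[OF assms] by (subst deriv_mult) auto
  moreover have "z(i := 0) = z" using True by auto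
  ultimately show ?thesis using True by (simp add: dq_def)
qed (simp add: dq_def)

lemma funpow_dq_coord_power:
  assumes "bhol S r B F" "i \<in> S" "z \<in> polydisc S r"
  shows "(dq i ^^ m) (\<lambda>z. z i ^ m * F z) z = F z"
  using assms(3)
proof (induction m arbitrary: z)
  case (Suc m)
  have "bhol S r (r i ^ m * B) (\<lambda>z. z i ^ m * F z)"
  proof (intro bhol_mult[OF _ assms(1)])
    show "bhol S r (r i ^ m) (\<lambda>z. z i ^ m)"
    proof (induction m)
      case (Suc m)
      then show ?case using bhol_mult[OF bhol_coord[OF assms(2)] Suc] by simp
    qed (auto intro: bhol_const)
  qed
  from dq_coord_mult[OF this assms(2)]
  have *: "dq i (\<lambda>z. z i ^ Suc m * F z) z = z i ^ m * F z" if "z \<in> polydisc S r" for z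
    using that by (simp add: mult.assoc)
  have "(dq i ^^ Suc m) (\<lambda>z. z i ^ Suc m * F z) z = (dq i ^^ m) (dq i (\<lambda>z. z i ^ Suc m * F z)) z"
    by (simp only: funpow_Suc_right comp_apply)
  also have "\<dots> = (dq i ^^ m) (\<lambda>z. z i ^ m * F z) z"
    by (rule funpow_dq_cong[OF * Suc.prems assms(2)])
  finally show ?case using Suc by simp
qed (use assms in auto)

text \<open>\<open>dq_eq\<close> is applied again to each remainder \<open>(dq i ^^ m) F\<close>.
  Thus \<open>dq i ^^ m\<close> acts as division by the \<open>m\<close>-th power of
  \<open>z i\<close> after removal of the lower terms.\<close>

lemma dq_taylor:
  "F z = (\<Sum>l<m. (dq i ^^ l) F (z(i := 0)) * z i ^ l) + z i ^ m * (dq i ^^ m) F z"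
proof (induction m)
  case (Suc m)
  have "z i ^ m * (dq i ^^ m) F z = (dq i ^^ m) F (z(i := 0)) * z i ^ m + z i ^ Suc m * (dq i ^^ Suc m) F z"
    by (subst dq_eq[of "(dq i ^^ m) F" z i]) (simp add: distrib_left mult.commute mult.left_commute)
  with Suc show ?case by (simp only: sum.lessThan_Suc add.assoc)
qed simp

text \<open>Letting \<open>x\<close> tend to \<open>0\<close> kills the constant term, and division
  by \<open>x\<close> lowers both sides by one degree. It serves to compare coefficients when the
  error term is merely bounded.\<close>

lemma poly_small_imp_zero:
  fixes e :: "nat \<Rightarrow> complex"
  assumes "\<delta> > 0" "\<And>x. x \<noteq> 0 \<Longrightarrow> norm x < \<delta> \<Longrightarrow> norm (\<Sum>l<m. e l * x ^ l) \<le> K * norm x ^ m" "l < m"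
  shows "e l = 0"
  using assms(2,3)
proof (induction m arbitrary: e l)
  case (Suc m)
  have ev: "\<forall>\<^sub>F x in at 0. norm (\<Sum>l<Suc m. e l * x ^ l) \<le> K * norm x ^ Suc m"
    unfolding eventually_at using assms(1) Suc.prems(1) by (intro exI[of _ \<delta>]) auto
  have "((\<lambda>x. norm (\<Sum>l<Suc m. e l * x ^ l)) \<longlongrightarrow> norm (\<Sum>l<Suc m. e l * 0 ^ l)) (at 0)"
    by (intro tendsto_intros)
  moreover have "(\<Sum>l<Suc m. e l * 0 ^ l) = e 0" by (simp add: sum.lessThan_Suc_shift del: sum.lessThan_Suc)
  moreover have "((\<lambda>x::complex. K * norm x ^ Suc m) \<longlongrightarrow> K * norm (0 :: complex) ^ Suc m) (at 0)"
    by (intro tendsto_intros)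
  ultimately have "norm (e 0) \<le> K * norm (0 :: complex) ^ Suc m"
    using tendsto_le[OF _ _ _ ev] by fastforce
  then have e0: "e 0 = 0" by simp
  have "norm (\<Sum>l<m. e (Suc l) * x ^ l) \<le> K * norm x ^ m" if x: "x \<noteq> 0" "norm x < \<delta>" for x
  proof -
    have "(\<Sum>l<Suc m. e l * x ^ l) = x * (\<Sum>l<m. e (Suc l) * x ^ l)"
      by (simp add: sum.lessThan_Suc_shift e0 sum_distrib_left mult_ac del: sum.lessThan_Suc)
    then have "norm x * norm (\<Sum>l<m. e (Suc l) * x ^ l) \<le> norm x * (K * norm x ^ m)"
      using Suc.prems(1)[OF x] by (simp add: norm_mult mult_ac del: sum.lessThan_Suc)
    then show ?thesis using x(1) by simp
  qed
  from Suc.IH[of "\<lambda>l. e (Suc l)", OF this] have "e (Suc l) = 0" if "l < m" for l using that by simp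
  then show ?case using e0 Suc.prems(2) by (cases l) auto
qed simp

text \<open>The Taylor remainder is at most \<open>(norm w * (4 / r i)) ^ l * B\<close>, which tends
  to \<open>0\<close> for \<open>norm w < r i / 4\<close>; the identity theorem covers the rest of
  the disc.\<close>

lemma dq_all_zero_imp_axis_zero:
  assumes F: "bhol S r B F" and r: "\<And>i. 0 < r i" and i: "i \<in> S"
    and zero: "\<And>l. (dq i ^^ l) F (\<lambda>_. 0) = 0" and w: "norm w < r i"
  shows "F ((\<lambda>_. 0)(i := w)) = 0"
proof -
  define \<phi> where "\<phi> w = F ((\<lambda>_. 0)(i := w))" for w
  have pd: "(\<lambda>_. 0)(i := w) \<in> polydisc S r" if "norm w < r i" for w
    using that r by (auto simp: polydisc_def)
  have u: "(\<lambda>_. 0)(i := 0 :: complex) = (\<lambda>_. 0)" by auto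
  have small: "\<phi> w = 0" if w: "norm w < r i / 4" for w
  proof -
    have w': "norm w < r i" using w r[of i] by simp
    have "norm (\<phi> w) \<le> (norm w * (4 / r i)) ^ l * B" for l
    proof -
      have "\<phi> w = w ^ l * (dq i ^^ l) F ((\<lambda>_. 0)(i := w))"
        using dq_taylor[of F "(\<lambda>_. 0)(i := w)" i l] zero by (simp add: u \<phi>_def)
      also have "norm \<dots> \<le> norm w ^ l * ((4 / r i) ^ l * B)"
        unfolding norm_mult norm_power
        by (intro mult_left_mono bhol_bound[OF bhol_funpow_dq[OF F i]] pd w') auto
      finally show ?thesis by (simp only: power_mult_distrib mult.assoc)
    qed
    moreover have "(\<lambda>l. (norm w * (4 / r i)) ^ l * B) \<longlonglongrightarrow> 0 * B"
    proof (rule tendsto_mult_right, rule LIMSEQ_realpow_zero)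
      show "norm w * (4 / r i) < 1" using w r[of i] by (simp add: field_simps)
      show "0 \<le> norm w * (4 / r i)" using r[of i] by (intro mult_nonneg_nonneg) auto
    qed
    ultimately have "norm (\<phi> w) \<le> 0 * B"
      by (intro tendsto_lowerbound[of "\<lambda>l. (norm w * (4 / r i)) ^ l * B"]) auto
    then show ?thesis by simp
  qed
  have "\<phi> w = 0"
  proof (rule analytic_continuation[of \<phi> "ball 0 (r i)" "ball 0 (r i / 4)" 0])
    have "(\<lambda>_. 0) \<in> polydisc S r" using r by (auto simp: polydisc_def)
    from bhol_holo[OF F this i] show "\<phi> holomorphic_on ball 0 (r i)" by (simp only: \<phi>_def[abs_def])
    show "(0 :: complex) islimpt ball 0 (r i / 4)" using r[of i] by (intro interior_limit_point) simp
  qed (use small w r[of i] in auto)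
  then show ?thesis by (simp add: \<phi>_def)
qed

text \<open>The order of vanishing at the origin of the restriction of \<open>f\<close> to the
  \<open>i\<close>-th axis, classically: \<open>f\<close> is regular of order \<open>m\<close> in
  \<open>z i\<close>.\<close>

definition order_along :: "'i \<Rightarrow> (('i \<Rightarrow> complex) \<Rightarrow> complex) \<Rightarrow> nat \<Rightarrow> bool"
  where "order_along i f m \<longleftrightarrow> (\<forall>l<m. (dq i ^^ l) f (\<lambda>_. 0) = 0) \<and> (dq i ^^ m) f (\<lambda>_. 0) \<noteq> 0"

text \<open>With \<open>f = low + z\<^sub>i\<^sup>m u\<close> and \<open>u\<close> a unit, the quotient is \<open>q = p / u\<close>, where \<open>p\<close> solves
  \<open>p = dq\<^sup>m g - dq\<^sup>m (p low / u)\<close>. After shrinking the polydisc in the other variables \<open>low\<close> is so small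
  that the right-hand side is a contraction in the supremum norm.\<close>

theorem weierstrass_division:
  assumes fin: "finite S" and i: "i \<in> S" and f: "f \<in> hg S" and g: "g \<in> hg S"
    and reg: "order_along i f m"
  shows "\<exists>q\<in>hg S. \<exists>c. (\<forall>l<m. c l \<in> hg (S - {i})) \<and>
    (\<forall>\<^sub>F z in near S. g z = q z * f z + (\<Sum>l<m. c l z * z i ^ l))"
proof -
  have ord: "\<And>l. l < m \<Longrightarrow> (dq i ^^ l) f (\<lambda>_. 0) = 0" "(dq i ^^ m) f (\<lambda>_. 0) \<noteq> 0"
    using reg by (auto simp: order_along_def)
  define u where "u = (dq i ^^ m) f"
  have u_hg: "u \<in> hg S" unfolding u_def by (rule hg_funpow_dq[OF f i])
  have u0: "u (\<lambda>_. 0) \<noteq> 0" using ord(2) by (simp add: u_def)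
  note inv = hg_inverse[OF fin u_hg u0]
  define a where "a l z = (dq i ^^ l) f (z(i := 0))" for l z
  have a_hg: "a l \<in> hg (S - {i})" for l
    unfolding a_def by (rule hg_upd0[OF hg_funpow_dq[OF f i]])
  have a0: "a l (\<lambda>_. 0) = 0" if "l < m" for l
    using ord(1)[OF that] by (simp add: a_def fun_upd_triv[of "\<lambda>_. 0", simplified])
  define low where "low z = (\<Sum>l<m. a l z * z i ^ l)" for z
  have f_eq: "f z = low z + z i ^ m * u z" for z
    unfolding low_def a_def u_def by (rule dq_taylor)
  have low_hg: "low \<in> hg S"
    unfolding low_def
    by (intro hg_sum hg_mult hg_power hg_coord i hg_mono[OF a_hg]) auto
  obtain r1 where r1: "\<forall>i. 0 < r1 i" "\<forall>F\<in>{f, g, u, \<lambda>z. 1 / u z, low}. \<exists>B. bhol S r1 B F"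
    using hg_common[of "{f, g, u, \<lambda>z. 1 / u z, low}" S] f g u_hg inv(1) low_hg by blast
  obtain r2 where r2: "\<And>j. 0 < r2 j" "\<And>z. z \<in> polydisc S r2 \<Longrightarrow> u z \<noteq> 0"
    using inv(2) unfolding eventually_near by blast
  define r where "r j = min (r1 j) (r2 j)" for j
  have r: "0 < r j" for j using r1(1) r2(1) by (simp add: r_def)
  have "\<exists>M. bhol S r1 M (\<lambda>z. 1 / u z)" using r1(2) by simp
  then obtain M where M: "bhol S r1 M (\<lambda>z. 1 / u z)" by blast
  have M0: "M \<ge> 0" using bhol_bound_nonneg[OF M] r1 by auto
  \<comment> \<open>The factors bound \<open>1 / u\<close>, the powers of \<open>z i\<close> and the
    operator \<open>dq i ^^ m\<close>. Once all \<open>a l\<close> are below \<open>e\<close>, the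
    operator \<open>T\<close> defined below has norm at most \<open>1 / 2\<close>.\<close>
  define K where "K = M * (\<Sum>l<m. r i ^ l) * (4 / r i) ^ m"
  have K0: "K \<ge> 0" unfolding K_def using M0 r[of i] by (auto intro!: mult_nonneg_nonneg sum_nonneg)
  define e where "e = 1 / (2 * (K + 1))"
  have e: "e > 0" "K * e \<le> 1 / 2" using K0 by (auto simp: e_def divide_simps)
  have "\<forall>\<^sub>F z in near (S - {i}). \<forall>l\<in>{..<m}. norm (a l z) < e"
  proof (intro eventually_ball_finite ballI)
    fix l assume "l \<in> {..<m}"
    then show "\<forall>\<^sub>F z in near (S - {i}). norm (a l z) < e"
      using hg_tendsto_0[OF _ a_hg[of l] e(1)] fin a0[of l] by simp
  qed simp
  then obtain r3 where r3: "\<And>j. 0 < r3 j" "\<And>z l. z \<in> polydisc (S - {i}) r3 \<Longrightarrow> l < m \<Longrightarrow> norm (a l z) < e"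
    unfolding eventually_near by blast
  \<comment> \<open>The radius for \<open>z i\<close> is kept, because \<open>K\<close> and hence
    \<open>e\<close> were computed from it. Shrinking the other radii is enough, as
    \<open>a l\<close> does not depend on \<open>z i\<close>.\<close>
  define \<rho> where "\<rho> j = (if j = i then r i else min (r j) (r3 j))" for j
  have \<rho>: "0 < \<rho> j" for j using r r3(1) by (simp add: \<rho>_def)
  have \<rho>_le: "\<rho> j \<le> r1 j" "\<rho> j \<le> r2 j" for j by (auto simp: \<rho>_def r_def)
  have pd2: "z \<in> polydisc S r2" if "z \<in> polydisc S \<rho>" for z
    using subsetD[OF polydisc_mono[OF \<rho>_le(2) order_refl] that] .
  have pd3: "z \<in> polydisc (S - {i}) r3" if "z \<in> polydisc S \<rho>" for z
    using that by (auto simp: polydisc_def \<rho>_def split: if_splits)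
  have to_\<rho>: "\<exists>B. bhol S \<rho> B F" if "F \<in> {f, g, u, \<lambda>z. 1 / u z, low}" for F
  proof -
    from r1(2) that have "\<exists>B. bhol S r1 B F" by (rule bspec)
    then obtain B where "bhol S r1 B F" ..
    from bhol_mono[OF this order_refl \<rho>_le(1) order_refl] show ?thesis ..
  qed
  define v where "v z = low z * (1 / u z)" for z
  define \<epsilon> where "\<epsilon> = M * (\<Sum>l<m. r i ^ l) * e"
  have \<epsilon>0: "\<epsilon> \<ge> 0" unfolding \<epsilon>_def using M0 r[of i] e by (auto intro!: mult_nonneg_nonneg sum_nonneg)
  have \<epsilon>: "(4 / \<rho> i) ^ m * \<epsilon> \<le> 1 / 2"
    using e(2) by (simp add: \<epsilon>_def K_def \<rho>_def mult_ac)
  have v: "bhol S \<rho> \<epsilon> v"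
  proof -
    obtain B B' where B: "bhol S \<rho> B low" "bhol S \<rho> B' (\<lambda>z. 1 / u z)" using to_\<rho> by blast
    have "norm (v z) \<le> \<epsilon>" if z: "z \<in> polydisc S \<rho>" for z
    proof -
      have "norm (low z) \<le> (\<Sum>l<m. norm (a l z * z i ^ l))"
        unfolding low_def by (rule norm_sum)
      also have "\<dots> \<le> (\<Sum>l<m. e * r i ^ l)"
      proof (rule sum_mono)
        fix l assume "l \<in> {..<m}"
        then have "norm (a l z) \<le> e" using r3(2)[OF pd3[OF z]] by (simp add: less_imp_le)
        moreover have "norm (z i) \<le> r i" using polydisc_D[OF z i] by (simp add: \<rho>_def)
        ultimately show "norm (a l z * z i ^ l) \<le> e * r i ^ l"
          unfolding norm_mult norm_power using e by (intro mult_mono power_mono) auto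
      qed
      finally have 1: "norm (low z) \<le> e * (\<Sum>l<m. r i ^ l)" by (simp add: sum_distrib_left)
      have "z \<in> polydisc S r1" using subsetD[OF polydisc_mono[OF \<rho>_le(1) order_refl] z] .
      from bhol_bound[OF M this] have 2: "norm (1 / u z) \<le> M" .
      have "norm (v z) \<le> (e * (\<Sum>l<m. r i ^ l)) * M"
        unfolding v_def norm_mult using 1 2 M0
        by (intro mult_mono) (auto intro: order_trans[OF norm_ge_zero])
      then show ?thesis by (simp add: \<epsilon>_def mult_ac)
    qed
    with bhol_sharpen[OF bhol_mult[OF B]] show ?thesis unfolding v_def by blast
  qed
  define T where "T p = (dq i ^^ m) (\<lambda>z. p z * v z)" for p
  have T_bound: "bhol S \<rho> (B / 2) (T p)" if p: "bhol S \<rho> B p" for p B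
  proof (rule bhol_mono)
    show "bhol S \<rho> ((4 / \<rho> i) ^ m * (B * \<epsilon>)) (T p)"
      unfolding T_def by (rule bhol_funpow_dq[OF bhol_mult[OF p v] i])
    have "B \<ge> 0" using bhol_bound_nonneg[OF p] \<rho> by auto
    then show "(4 / \<rho> i) ^ m * (B * \<epsilon>) \<le> B / 2"
      using mult_left_mono[OF \<epsilon>, of B] by (simp add: mult_ac)
  qed auto
  have T_diff: "T (\<lambda>z. p z - p' z) z = T p z - T p' z"
    if "bhol S \<rho> B p" "bhol S \<rho> B' p'" "z \<in> polydisc S \<rho>" for p p' B B' z
    unfolding T_def
    using funpow_dq_diff[OF bhol_mult[OF that(1) v] bhol_mult[OF that(2) v] i that(3)]
    by (simp add: left_diff_distrib)
  obtain Bg where Bg: "bhol S \<rho> Bg g" using to_\<rho> by blast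
  define G where "G = (dq i ^^ m) g"
  define C where "C = (4 / \<rho> i) ^ m * Bg"
  have G: "bhol S \<rho> C G" unfolding G_def C_def by (rule bhol_funpow_dq[OF Bg i])
  have C0: "C \<ge> 0" using bhol_bound_nonneg[OF G] \<rho> by auto
  \<comment> \<open>Picard iteration for \<open>p = G - T p\<close>; the bound on the increments
    halves with each step.\<close>
  define s where "s = rec_nat (\<lambda>_. 0) (\<lambda>_ p z. G z - T p z)"
  have s_simps: "s 0 = (\<lambda>_. 0)" "s (Suc k) = (\<lambda>z. G z - T (s k) z)" for k
    by (simp_all add: s_def)
  have s: "bhol S \<rho> (2 * C) (s k)" for k
  proof (induction k)
    case 0
    then show ?case unfolding s_simps using C0 by (intro bhol_const) auto
  next
    case (Suc k)
    show ?case unfolding s_simps using bhol_diff[OF G T_bound[OF Suc]] by simp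
  qed
  have s_step: "norm (s (Suc k) z - s k z) \<le> C * (1 / 2) ^ k" if "z \<in> polydisc S \<rho>" for k z
    using that
  proof (induction k arbitrary: z)
    case 0
    have "dq i (\<lambda>_. 0) = (\<lambda>_. 0)" by (auto simp: dq_def)
    then have "(dq i ^^ m) (\<lambda>_. 0) = (\<lambda>_. 0)" by (induction m) auto
    then have "T (s 0) = (\<lambda>_. 0)" by (simp add: T_def s_simps)
    then show ?case using bhol_bound[OF G 0] by (simp add: s_simps(2)) (simp add: s_simps(1))
  next
    case (Suc k)
    have "bhol S \<rho> (C * (1 / 2) ^ k) (\<lambda>z. s (Suc k) z - s k z)"
      by (rule bhol_sharpen[OF bhol_diff[OF s s]]) (rule Suc.IH)
    note * = bhol_bound[OF T_bound[OF this] Suc.prems]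
    have "s (Suc (Suc k)) z - s (Suc k) z = - (T (s (Suc k)) z - T (s k) z)"
      by (simp add: s_simps(2)[of "Suc k"] s_simps(2)[of k])
    also have "\<dots> = - T (\<lambda>z. s (Suc k) z - s k z) z"
      using T_diff[OF s s Suc.prems] by simp
    finally show ?case using * by simp
  qed
  define p where "p z = (if z \<in> polydisc S \<rho> then \<Sum>k. s (Suc k) z - s k z else 0)" for z
  have unif: "uniform_limit (polydisc S \<rho>) s p sequentially"
  proof -
    have "uniform_limit (polydisc S \<rho>) (\<lambda>n z. \<Sum>k<n. s (Suc k) z - s k z) (\<lambda>z. \<Sum>k. s (Suc k) z - s k z) sequentially"
      by (rule Weierstrass_m_test[OF s_step]) (auto intro!: summable_mult summable_geometric)
    moreover have "(\<Sum>k<n. s (Suc k) z - s k z) = s n z" for n and z :: "'a \<Rightarrow> complex"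
      using sum_lessThan_telescope[of "\<lambda>k. s k z" n] by (simp add: s_simps(1))
    ultimately show ?thesis
      by (rule_tac uniform_limit_cong'[THEN iffD1, rotated 2]) (auto simp: p_def)
  qed
  have p: "bhol S \<rho> (2 * C) p"
  proof (rule bhol_uniform_limit[OF s _ unif])
    fix z z' :: "'a \<Rightarrow> complex" assume eq: "\<And>j. j \<in> S \<Longrightarrow> z j = z' j"
    have "s k z = s k z'" for k using bhol_cong[OF s eq] .
    moreover have "z \<in> polydisc S \<rho> \<longleftrightarrow> z' \<in> polydisc S \<rho>" using eq by (simp add: polydisc_def)
    ultimately show "p z = p z'" by (simp add: p_def)
  qed simp
  have p_fix: "p z = G z - T p z" if z: "z \<in> polydisc S \<rho>" for z
  proof -
    have "(\<lambda>k. T (s k) z) \<longlonglongrightarrow> T p z"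
    proof (rule LIMSEQ_I)
      fix d :: real assume d: "d > 0"
      then obtain N where N: "\<And>n x. n \<ge> N \<Longrightarrow> x \<in> polydisc S \<rho> \<Longrightarrow> dist (s n x) (p x) < d"
        using unif unfolding uniform_limit_sequentially_iff by meson
      have "norm (T (s n) z - T p z) < d" if n: "n \<ge> N" for n
      proof -
        have "bhol S \<rho> d (\<lambda>z. s n z - p z)"
          by (rule bhol_sharpen[OF bhol_diff[OF s p]]) (use N[OF n] in \<open>force simp: dist_norm\<close>)
        from bhol_bound[OF T_bound[OF this] z] show ?thesis
          using T_diff[OF s p z] d by simp
      qed
      then show "\<exists>no. \<forall>n\<ge>no. norm (T (s n) z - T p z) < d" by blast
    qed
    then have "(\<lambda>k. s (Suc k) z) \<longlonglongrightarrow> G z - T p z"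
      unfolding s_simps by (intro tendsto_intros)
    moreover have "(\<lambda>k. s (Suc k) z) \<longlonglongrightarrow> p z"
      using tendsto_uniform_limitI[OF unif z] by (rule LIMSEQ_Suc)
    ultimately show ?thesis using LIMSEQ_unique by blast
  qed
  obtain Bu where Bu: "bhol S \<rho> Bu (\<lambda>z. 1 / u z)" using to_\<rho> by blast
  obtain Bf where Bf: "bhol S \<rho> Bf f" using to_\<rho> by blast
  define q where "q z = p z * (1 / u z)" for z
  have q: "bhol S \<rho> (2 * C * Bu) q" unfolding q_def by (rule bhol_mult[OF p Bu])
  define R where "R z = g z - q z * f z" for z
  note qf = bhol_mult[OF q Bf]
  have R: "bhol S \<rho> (Bg + 2 * C * Bu * Bf) R"
    unfolding R_def by (rule bhol_diff[OF Bg qf])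
  \<comment> \<open>Since \<open>q f\<close> is \<open>p v\<close> plus \<open>p\<close> times the
    \<open>m\<close>-th power of \<open>z i\<close>, its image under \<open>dq i ^^ m\<close> is
    \<open>T p + p = G\<close>. The remainder \<open>R\<close> therefore has no terms of order
    \<open>m\<close> or higher in \<open>z i\<close>.\<close>
  have "(dq i ^^ m) R z = 0" if z: "z \<in> polydisc S \<rho>" for z
  proof -
    have "(dq i ^^ m) (\<lambda>z. q z * f z) z - T p z = (dq i ^^ m) (\<lambda>z. q z * f z - p z * v z) z"
      unfolding T_def using funpow_dq_diff[OF qf bhol_mult[OF p v] i z] by simp
    also have "\<dots> = (dq i ^^ m) (\<lambda>z. z i ^ m * p z) z"
    proof (rule funpow_dq_cong[OF _ z i])
      fix x assume "x \<in> polydisc S \<rho>"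
      then have "u x \<noteq> 0" using r2(2) pd2 by blast
      then show "q x * f x - p x * v x = x i ^ m * p x"
        by (simp add: q_def v_def f_eq field_simps)
    qed
    also have "\<dots> = p z" by (rule funpow_dq_coord_power[OF p i z])
    finally have "(dq i ^^ m) (\<lambda>z. q z * f z) z = G z" using p_fix[OF z] by (simp add: algebra_simps)
    then show ?thesis
      unfolding R_def using funpow_dq_diff[OF Bg qf i z] by (simp add: G_def)
  qed
  then have R_eq: "R z = (\<Sum>l<m. (dq i ^^ l) R (z(i := 0)) * z i ^ l)" if "z \<in> polydisc S \<rho>" for z
    using dq_taylor[of R z i m] that by simp
  have R_hg: "R \<in> hg S" by (rule hgI[OF \<rho> R])
  show ?thesis
  proof (intro bexI[of _ q] exI[of _ "\<lambda>l z. (dq i ^^ l) R (z(i := 0))"] conjI allI impI)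
    show "(\<lambda>z. (dq i ^^ l) R (z(i := 0))) \<in> hg (S - {i})" for l
      by (rule hg_upd0[OF hg_funpow_dq[OF R_hg i]])
    have "\<forall>\<^sub>F z in near S. z \<in> polydisc S \<rho>" by (rule eventually_near_polydisc[OF \<rho>])
    then show "\<forall>\<^sub>F z in near S. g z = q z * f z + (\<Sum>l<m. (dq i ^^ l) R (z(i := 0)) * z i ^ l)"
      by eventually_elim (use R_eq in \<open>simp add: R_def algebra_simps\<close>)
    show "q \<in> hg S" by (rule hgI[OF \<rho> q])
  qed
qed

section \<open>Characteristic polynomials\<close>

text \<open>By the Leibniz formula. There are two uses: complex entries with
  \<open>K = hg S\<close>, and polynomial entries with \<open>K\<close> the families whose
  coefficients lie in \<open>hg S\<close>, which covers characteristic polynomials.\<close>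

lemma det_closed:
  fixes K :: "('a \<Rightarrow> 'r :: comm_ring_1) set"
  assumes const: "\<And>c. (\<lambda>_. c) \<in> K"
    and add: "\<And>F G. F \<in> K \<Longrightarrow> G \<in> K \<Longrightarrow> (\<lambda>x. F x + G x) \<in> K"
    and mult: "\<And>F G. F \<in> K \<Longrightarrow> G \<in> K \<Longrightarrow> (\<lambda>x. F x * G x) \<in> K"
    and A: "\<And>x. A x \<in> carrier_mat n n"
    and entries: "\<And>i j. i < n \<Longrightarrow> j < n \<Longrightarrow> (\<lambda>x. A x $$ (i, j)) \<in> K"
  shows "(\<lambda>x. Determinant.det (A x)) \<in> K"
proof -
  have sum: "(\<lambda>x. \<Sum>a\<in>I. F a x) \<in> K" if "\<And>a. a \<in> I \<Longrightarrow> F a \<in> K" for I :: "(nat \<Rightarrow> nat) set" and F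
    using that by (induction I rule: infinite_finite_induct) (auto intro: const add)
  have prod: "(\<lambda>x. \<Prod>a\<in>I. F a x) \<in> K" if "\<And>a. a \<in> I \<Longrightarrow> F a \<in> K" for I :: "nat set" and F
    using that by (induction I rule: infinite_finite_induct) (auto intro: const mult)
  have "(\<lambda>x. \<Sum>p\<in>{p. p permutes {0..<n}}. signof p * (\<Prod>i\<in>{0..<n}. A x $$ (i, p i))) \<in> K"
  proof (intro sum mult const prod entries)
    show "p i < n" if "p \<in> {p. p permutes {0..<n}}" "i \<in> {0..<n}" for p i
      using that permutes_in_image[of p "{0..<n}" i] by simp
  qed auto
  then show ?thesis by (simp add: det_def'[OF A])
qed

lemma poly_char_poly_eq_det:
  fixes c :: "nat \<Rightarrow> nat \<Rightarrow> complex"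
  shows "poly (char_poly (Matrix.mat m m (\<lambda>(i, j). c i j))) u =
    Determinant.det (Matrix.mat m m (\<lambda>(i, j). (if i = j then u else 0) - c i j))"
  unfolding char_poly_def
  by (rule poly_det_cong[of _ m]) (auto simp: char_poly_matrix_def)

text \<open>The determinant trick: \<open>N\<close> maps the vector \<open>v\<close> to
  \<open>b\<close>, and row \<open>0\<close> of the adjugate isolates \<open>v 0\<close> with the
  factor \<open>det N\<close>. In the application \<open>v l\<close> is the \<open>l\<close>-th
  power of \<open>z i\<close>, so \<open>v 0 = 1\<close>, and \<open>b l\<close> is a multiple of
  \<open>f\<close>.\<close>

lemma char_poly_cayley_hamilton:
  fixes c :: "nat \<Rightarrow> nat \<Rightarrow> complex"
  assumes "0 < m" and eq: "\<And>l. l < m \<Longrightarrow> u * v l = b l + (\<Sum>k<m. c l k * v k)"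
  defines "N \<equiv> Matrix.mat m m (\<lambda>(i, j). (if i = j then u else 0) - c i j)"
  shows "poly (char_poly (Matrix.mat m m (\<lambda>(i, j). c i j))) u * v 0 = (\<Sum>l<m. adj_mat N $$ (0, l) * b l)"
proof -
  have N: "N \<in> carrier_mat m m" by (simp add: N_def)
  have adj: "adj_mat N \<in> carrier_mat m m" using adj_mat(1)[OF N] .
  have row: "(\<Sum>k<m. N $$ (l, k) * v k) = b l" if "l < m" for l
  proof -
    have "(\<Sum>k<m. N $$ (l, k) * v k) = (\<Sum>k<m. (if l = k then u * v k else 0) - c l k * v k)"
      using that by (intro sum.cong) (auto simp: N_def algebra_simps)
    also have "\<dots> = u * v l - (\<Sum>k<m. c l k * v k)"
      using that by (simp add: sum_subtractf)
    finally show ?thesis using eq[OF that] by simp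
  qed
  have entry: "(\<Sum>l<m. adj_mat N $$ (0, l) * N $$ (l, k)) = (if k = 0 then Determinant.det N else 0)" if "k < m" for k
  proof -
    have "(adj_mat N * N) $$ (0, k) = (\<Sum>l<m. adj_mat N $$ (0, l) * N $$ (l, k))"
      using that assms(1) N adj by (simp add: scalar_prod_def lessThan_atLeast0)
    then show ?thesis using that assms(1) by (cases "k = 0") (simp_all add: adj_mat(3)[OF N])
  qed
  have "(\<Sum>l<m. adj_mat N $$ (0, l) * b l) = (\<Sum>l<m. \<Sum>k<m. adj_mat N $$ (0, l) * N $$ (l, k) * v k)"
    by (intro sum.cong) (auto simp: row[symmetric] sum_distrib_left mult.assoc)
  also have "\<dots> = (\<Sum>k<m. (\<Sum>l<m. adj_mat N $$ (0, l) * N $$ (l, k)) * v k)"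
    by (subst sum.swap) (simp add: sum_distrib_right)
  also have "\<dots> = (\<Sum>k<m. if k = 0 then Determinant.det N * v 0 else 0)"
    by (intro sum.cong) (auto simp: entry)
  also have "\<dots> = Determinant.det N * v 0" using assms(1) by simp
  finally show ?thesis unfolding poly_char_poly_eq_det N_def by simp
qed

text \<open>The kernel is taken on the left because row \<open>l\<close> of \<open>c\<close>
  expresses \<open>u\<close> times the \<open>l\<close>-th power of \<open>z i\<close>. A left
  kernel vector is then the coefficient vector of a polynomial in \<open>z i\<close> whose product
  with \<open>u\<close> is a multiple of \<open>f\<close>.\<close>

lemma char_poly_zero_imp_left_kernel:
  fixes c :: "nat \<Rightarrow> nat \<Rightarrow> complex"
  assumes "poly (char_poly (Matrix.mat m m (\<lambda>(i, j). c i j))) 0 = 0"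
  shows "\<exists>v. (\<exists>l<m. v l \<noteq> 0) \<and> (\<forall>k<m. (\<Sum>l<m. v l * c l k) = 0)"
proof -
  define A where "A = Matrix.mat m m (\<lambda>(i, j). - c j i)"
  have A: "A \<in> carrier_mat m m" by (simp add: A_def)
  have "A = transpose_mat (Matrix.mat m m (\<lambda>(i, j). (if i = j then 0 else 0) - c i j))"
    by (auto simp: A_def)
  then have "Determinant.det A = 0"
    using assms unfolding poly_char_poly_eq_det by (simp add: det_transpose[of _ m])
  then obtain v where v: "v \<in> carrier_vec m" "v \<noteq> 0\<^sub>v m" "A *\<^sub>v v = 0\<^sub>v m"
    using det_0_iff_vec_prod_zero[OF A] by blast
  have "\<exists>l<m. vec_index v l \<noteq> 0"
  proof (rule ccontr)
    assume "\<not> ?thesis"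
    then have "v = 0\<^sub>v m" using v(1) by (intro eq_vecI) auto
    with v(2) show False ..
  qed
  moreover have "(\<Sum>l<m. vec_index v l * c l k) = 0" if "k < m" for k
  proof -
    have "vec_index (A *\<^sub>v v) k = (\<Sum>l<m. - c l k * vec_index v l)"
      using that v(1) A by (simp add: scalar_prod_def A_def lessThan_atLeast0)
    also have "\<dots> = - (\<Sum>l<m. vec_index v l * c l k)"
      by (simp add: sum_negf mult.commute)
    finally show ?thesis using v(3) that by simp
  qed
  ultimately show ?thesis by blast
qed

text \<open>At a root \<open>a\<close> of \<open>W\<close> either \<open>\<phi> a = 0\<close>, or
  \<open>a\<close> is also a root of \<open>V\<close> and the factor \<open>w - a\<close> can be
  cancelled. Both degrees drop by one, so \<open>V\<close> runs out of roots before \<open>W\<close>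
  does.\<close>

lemma poly_multiple_imp_common_zero:
  fixes V W :: "complex poly"
  assumes "V \<noteq> 0" "Polynomial.degree V < Polynomial.degree W" "\<And>a. poly W a = 0 \<Longrightarrow> norm a < \<rho>"
    and "continuous_on (ball 0 \<rho>) \<phi>" "continuous_on (ball 0 \<rho>) \<psi>"
    and "\<And>w. norm w < \<rho> \<Longrightarrow> \<phi> w * poly V w = \<psi> w * poly W w"
  shows "\<exists>a. poly W a = 0 \<and> \<phi> a = 0"
  using assms(1,2,3,6)
proof (induction "Polynomial.degree W" arbitrary: V W)
  case (Suc m)
  from Suc.hyps(2) have "\<not> constant (poly W)" by (simp add: constant_degree)
  from Fundamental_Theorem_Algebra.fundamental_theorem_of_algebra[OF this] obtain a where a: "poly W a = 0" ..
  have ad: "norm a < \<rho>" using Suc.prems(3)[OF a] .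
  show ?case
  proof (cases "\<phi> a = 0")
    case False
    then have "poly V a = 0" using Suc.prems(4)[OF ad] a by simp
    then obtain V' where V': "V = [:-a, 1:] * V'" by (auto simp: poly_eq_0_iff_dvd)
    obtain W' where W': "W = [:-a, 1:] * W'" using a by (auto simp: poly_eq_0_iff_dvd)
    have nz: "V' \<noteq> 0" "W' \<noteq> 0" using Suc.prems(1,2) V' W' by auto
    have degs: "Polynomial.degree V = Suc (Polynomial.degree V')" "Polynomial.degree W = Suc (Polynomial.degree W')"
      using nz by (simp_all add: V' W' Polynomial.degree_mult_eq del: mult_pCons_left)
    \<comment> \<open>Off \<open>a\<close> the factor cancels; at \<open>a\<close> the identity
      follows by continuity of \<open>\<phi>\<close> and \<open>\<psi>\<close>.\<close>
    have eq: "\<phi> w * poly V' w = \<psi> w * poly W' w" if w: "norm w < \<rho>" for w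
    proof -
      define g where "g w = \<phi> w * poly V' w - \<psi> w * poly W' w" for w
      have ne: "g w = 0" if "norm w < \<rho>" "w \<noteq> a" for w
      proof -
        have "(w - a) * g w = 0"
          using Suc.prems(4)[OF that(1)] by (simp add: g_def V' W' algebra_simps)
        then show ?thesis using that(2) by simp
      qed
      have "continuous_on (ball 0 \<rho>) g"
        unfolding g_def by (intro continuous_intros assms(4,5))
      then have "isCont g a" using ad by (simp add: continuous_on_eq_continuous_at)
      then have "(g \<longlongrightarrow> g a) (at a)" by (simp add: isCont_def)
      moreover have "\<forall>\<^sub>F w in at a. w \<in> ball 0 \<rho>"
        using ad by (intro eventually_at_in_open') auto
      then have "\<forall>\<^sub>F w in at a. g w = 0"
        using eventually_neq_at_within[of a a UNIV] by eventually_elim (use ne in auto)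
      then have "(g \<longlongrightarrow> 0) (at a)" by (rule tendsto_eventually)
      ultimately have "g a = 0" using LIM_unique by blast
      with ne w have "g w = 0" by blast
      then show ?thesis by (simp add: g_def)
    qed
    have "\<exists>b. poly W' b = 0 \<and> \<phi> b = 0"
    proof (rule Suc.hyps(1)[of W' V'])
      show "m = Polynomial.degree W'" "Polynomial.degree V' < Polynomial.degree W'" using Suc.hyps(2) Suc.prems(2) degs by auto
      show "norm b < \<rho>" if "poly W' b = 0" for b using Suc.prems(3)[of b] that by (simp add: W')
    qed (use nz eq in auto)
    then show ?thesis by (auto simp: W')
  qed (use a in blast)
qed simp

lemma coeff_family_mult:
  assumes "\<And>k. (\<lambda>z. Polynomial.coeff (P z) k) \<in> hg S" "\<And>k. (\<lambda>z. Polynomial.coeff (Q z) k) \<in> hg S"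
  shows "(\<lambda>z. Polynomial.coeff (P z * Q z) k) \<in> hg S"
  unfolding coeff_mult by (intro hg_sum hg_mult assms)

lemma hg_coeff_char_poly:
  assumes c: "\<And>i j. i < m \<Longrightarrow> j < m \<Longrightarrow> (\<lambda>z. c z i j) \<in> hg S"
  shows "(\<lambda>z. Polynomial.coeff (char_poly (Matrix.mat m m (\<lambda>(i, j). c z i j))) k) \<in> hg S"
proof -
  define K where "K = {P :: ('a \<Rightarrow> complex) \<Rightarrow> complex poly. \<forall>k. (\<lambda>z. Polynomial.coeff (P z) k) \<in> hg S}"
  have "(\<lambda>z. Determinant.det (char_poly_matrix (Matrix.mat m m (\<lambda>(i, j). c z i j)))) \<in> K"
  proof (rule det_closed[of K _ m])
    show "(\<lambda>x. F x * G x) \<in> K" if "F \<in> K" "G \<in> K" for F G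
      using that coeff_family_mult[of F S G] by (simp add: K_def)
    show "(\<lambda>z. char_poly_matrix (Matrix.mat m m (\<lambda>(i, j). c z i j)) $$ (i, j)) \<in> K"
      if ij: "i < m" "j < m" for i j
    proof -
      have "char_poly_matrix (Matrix.mat m m (\<lambda>(i, j). c z i j)) $$ (i, j) =
          (if i = j then [:0, 1:] else 0) + [:- c z i j:]" for z
        using ij by (simp add: char_poly_matrix_def)
      moreover have "(\<lambda>z. Polynomial.coeff ((if i = j then [:0, 1:] else 0) + [:- c z i j:]) k) \<in> hg S" for k
        unfolding coeff_add by (intro hg_add hg_const) (cases k, auto intro: hg_const hg_uminus c[OF ij])
      ultimately show ?thesis by (simp add: K_def)
    qed
  qed (auto simp: K_def intro: hg_const hg_add)
  then show ?thesis by (simp add: K_def char_poly_def)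
qed

lemma hg_adj_mat:
  assumes c: "\<And>i j. i < m \<Longrightarrow> j < m \<Longrightarrow> (\<lambda>z. c z i j) \<in> hg S" and "i < m" "j < m"
  shows "(\<lambda>z. adj_mat (Matrix.mat m m (\<lambda>(i, j). c z i j)) $$ (i, j)) \<in> hg S"
proof -
  have "(\<lambda>z. Determinant.det (mat_delete (Matrix.mat m m (\<lambda>(i, j). c z i j)) j i)) \<in> hg S"
  proof (rule det_closed[of "hg S" _ "m - 1"])
    fix k l assume kl: "k < m - 1" "l < m - 1"
    define k' where "k' = (if k < j then k else Suc k)"
    define l' where "l' = (if l < i then l else Suc l)"
    have "mat_delete (Matrix.mat m m (\<lambda>(i, j). c z i j)) j i $$ (k, l) = c z k' l'" for z
      using kl by (auto simp: mat_delete_def k'_def l'_def)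
    moreover have "k' < m" "l' < m" using kl by (auto simp: k'_def l'_def)
    ultimately show "(\<lambda>z. mat_delete (Matrix.mat m m (\<lambda>(i, j). c z i j)) j i $$ (k, l)) \<in> hg S"
      using c by simp
  qed (auto intro: hg_const hg_add hg_mult simp: mat_delete_def)
  from hg_cmult[OF this, of "(-1) ^ (j + i)"] show ?thesis
    using assms(2,3) by (simp add: adj_mat_def cofactor_def)
qed

section \<open>Weierstrass polynomials and elimination of one coordinate\<close>

lemma near_upd:
  assumes "i \<in> S" "z \<in> polydisc (S - {i}) r" "norm a < r i"
  shows "z(i := a) \<in> polydisc S r"
  using assms by (auto simp: polydisc_def)

text \<open>Division of the \<open>m\<close>-th power of \<open>z i\<close> by \<open>f\<close>. On
  the axis, the polynomial with coefficients \<open>\<omega> l\<close> at the origin equals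
  \<open>x ^ m * E\<close> for \<open>E = 1 - q * D\<close>, and a polynomial of degree below
  \<open>m\<close> of that size is zero. Then \<open>E\<close> vanishes on the punctured axis, hence
  at the origin, and \<open>q\<close> is a unit.\<close>

lemma weierstrass_polynomial:
  assumes fin: "finite S" and i: "i \<in> S" and f: "f \<in> hg S"
    and reg: "order_along i f m"
  shows "\<exists>q\<in>hg S. \<exists>\<omega>. q (\<lambda>_. 0) \<noteq> 0 \<and> (\<forall>l<m. \<omega> l \<in> hg (S - {i}) \<and> \<omega> l (\<lambda>_. 0) = 0) \<and>
    (\<forall>\<^sub>F z in near S. z i ^ m = q z * f z + (\<Sum>l<m. \<omega> l z * z i ^ l))"
proof -
  have ord: "\<And>l. l < m \<Longrightarrow> (dq i ^^ l) f (\<lambda>_. 0) = 0" "(dq i ^^ m) f (\<lambda>_. 0) \<noteq> 0"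
    using reg by (auto simp: order_along_def)
  obtain q \<omega> where q: "q \<in> hg S" and \<omega>: "\<forall>l<m. \<omega> l \<in> hg (S - {i})"
    and ev: "\<forall>\<^sub>F z in near S. z i ^ m = q z * f z + (\<Sum>l<m. \<omega> l z * z i ^ l)"
    using weierstrass_division[OF fin i f hg_power[OF hg_coord[OF i], of m] reg] by blast
  define D where "D = (dq i ^^ m) f"
  define E where "E z = 1 - q z * D z" for z
  have E: "E \<in> hg S"
    unfolding E_def D_def by (intro hg_diff hg_const hg_mult q hg_funpow_dq f i)
  obtain r1 B where r1: "\<And>i. 0 < r1 i" and B: "bhol S r1 B E" by (rule hgE[OF E]) (rule that; blast)
  obtain r2 where r2: "\<And>j. 0 < r2 j" "\<And>z. z \<in> polydisc S r2 \<Longrightarrow> z i ^ m = q z * f z + (\<Sum>l<m. \<omega> l z * z i ^ l)"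
    using ev unfolding eventually_near by auto
  have u0: "(\<lambda>_. 0)(i := 0 :: complex) = (\<lambda>_. 0)" by auto
  have key: "(\<Sum>l<m. \<omega> l (\<lambda>_. 0) * x ^ l) = x ^ m * E ((\<lambda>_. 0)(i := x))" if x: "norm x < r2 i" for x
  proof -
    define z where "z = (\<lambda>_. 0)(i := x)"
    have "z \<in> polydisc S r2" using x r2(1) by (auto simp: z_def polydisc_def)
    moreover have "\<omega> l z = \<omega> l (\<lambda>_. 0)" if "l < m" for l
      using hg_cong[of "\<omega> l" "S - {i}" z "\<lambda>_. 0"] \<omega> that by (auto simp: z_def)
    ultimately have "x ^ m = q z * f z + (\<Sum>l<m. \<omega> l (\<lambda>_. 0) * x ^ l)"
      using r2(2)[of z] by (simp add: z_def)
    then have "(\<Sum>l<m. \<omega> l (\<lambda>_. 0) * x ^ l) = x ^ m - q z * f z" by (simp only: add_diff_cancel_left')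
    also have "f z = x ^ m * D z"
      using dq_taylor[of f z i m] ord(1) by (simp add: z_def u0 D_def)
    finally show ?thesis by (simp add: E_def z_def right_diff_distrib mult_ac fun_upd_def)
  qed
  have \<omega>0: "\<omega> l (\<lambda>_. 0) = 0" if "l < m" for l
  proof (rule poly_small_imp_zero[OF _ _ that])
    show "0 < min (r1 i) (r2 i)" using r1 r2(1) by simp
    fix x :: complex assume x: "norm x < min (r1 i) (r2 i)"
    have "(\<lambda>_. 0)(i := x) \<in> polydisc S r1" using x r1 by (auto simp: polydisc_def)
    from mult_left_mono[OF bhol_bound[OF B this], of "norm x ^ m"]
    show "norm (\<Sum>l<m. \<omega> l (\<lambda>_. 0) * x ^ l) \<le> B * norm x ^ m"
      using key[of x] x by (simp add: norm_mult norm_power mult.commute)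
  qed
  have "E (\<lambda>_. 0) = 0"
  proof (rule ccontr)
    assume "E (\<lambda>_. 0) \<noteq> 0"
    then have "\<forall>\<^sub>F z in near S. norm (E z - E (\<lambda>_. 0)) < norm (E (\<lambda>_. 0))"
      by (intro hg_tendsto_0[OF fin E]) auto
    then obtain r3 where r3: "\<And>j. 0 < r3 j" "\<And>z. z \<in> polydisc S r3 \<Longrightarrow> norm (E z - E (\<lambda>_. 0)) < norm (E (\<lambda>_. 0))"
      unfolding eventually_near by auto
    define t where "t = min (r2 i) (r3 i) / 2"
    define x where "x = complex_of_real t"
    have t: "t > 0" "t < r2 i" "t < r3 i" using r2(1)[of i] r3(1)[of i] by (auto simp: t_def min_def)
    then have x: "x \<noteq> 0" "norm x < r2 i" "norm x < r3 i" by (auto simp: x_def)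
    have "x ^ m * E ((\<lambda>_. 0)(i := x)) = 0" using key[OF x(2)] \<omega>0 by simp
    then have "E ((\<lambda>_. 0)(i := x)) = 0" using x(1) by simp
    moreover have "(\<lambda>_. 0)(i := x) \<in> polydisc S r3" using x r3(1) by (auto simp: polydisc_def)
    ultimately show False using r3(2) by fastforce
  qed
  then have "q (\<lambda>_. 0) \<noteq> 0" by (auto simp: E_def)
  with q \<omega> \<omega>0 ev show ?thesis by blast
qed

text \<open>For a root with \<open>\<sigma> \<le> norm a\<close>, each of the \<open>m\<close> terms
  on the right is at most \<open>norm a ^ m / (m + 1)\<close>, too little to add up to
  \<open>norm a ^ m\<close>. The choice \<open>\<sigma> \<le> 1\<close> ensures
  \<open>\<sigma> ^ m \<le> \<sigma> ^ (m - l)\<close>.\<close>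

lemma monic_roots_small:
  assumes fin: "finite T" and \<omega>: "\<And>l. l < m \<Longrightarrow> \<omega> l \<in> hg T" "\<And>l. l < m \<Longrightarrow> \<omega> l (\<lambda>_. 0) = 0" and \<rho>: "\<rho> > 0"
  shows "\<forall>\<^sub>F z in near T. \<forall>a. a ^ m = (\<Sum>l<m. \<omega> l z * a ^ l) \<longrightarrow> norm a < \<rho>"
proof -
  define \<sigma> where "\<sigma> = min \<rho> 1"
  have \<sigma>: "0 < \<sigma>" "\<sigma> \<le> 1" "\<sigma> \<le> \<rho>" using \<rho> by (auto simp: \<sigma>_def)
  define e where "e = \<sigma> ^ m / (real m + 1)"
  have e: "e > 0" using \<sigma> by (simp add: e_def add_nonneg_pos)
  have "\<forall>\<^sub>F z in near T. \<forall>l\<in>{..<m}. norm (\<omega> l z) < e"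
  proof (intro eventually_ball_finite ballI)
    fix l assume "l \<in> {..<m}"
    then show "\<forall>\<^sub>F z in near T. norm (\<omega> l z) < e"
      using hg_tendsto_0[OF fin \<omega>(1)[of l] e] \<omega>(2)[of l] by simp
  qed simp
  then show ?thesis
  proof eventually_elim
    case (elim z)
    show ?case
    proof (intro allI impI, rule ccontr)
      fix a assume a: "a ^ m = (\<Sum>l<m. \<omega> l z * a ^ l)" and "\<not> norm a < \<rho>"
      then have a_ge: "\<sigma> \<le> norm a" using \<sigma> by linarith
      have term_le: "norm a ^ l * \<sigma> ^ m \<le> norm a ^ m" if "l < m" for l
      proof -
        have "\<sigma> ^ m \<le> \<sigma> ^ (m - l)" using \<sigma> by (intro power_decreasing) auto
        also have "\<dots> \<le> norm a ^ (m - l)" using a_ge \<sigma> by (intro power_mono) auto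
        finally have "norm a ^ l * \<sigma> ^ m \<le> norm a ^ l * norm a ^ (m - l)" by (intro mult_left_mono) auto
        also have "\<dots> = norm a ^ m" using that by (simp flip: power_add)
        finally show ?thesis .
      qed
      have "norm a ^ m = norm (\<Sum>l<m. \<omega> l z * a ^ l)" using a by (metis norm_power)
      also have "\<dots> \<le> (\<Sum>l<m. norm (\<omega> l z * a ^ l))" by (rule norm_sum)
      also have "\<dots> \<le> (\<Sum>l<m. norm a ^ m / (real m + 1))"
      proof (rule sum_mono)
        fix l assume l: "l \<in> {..<m}"
        then have "norm (\<omega> l z * a ^ l) \<le> e * norm a ^ l"
          unfolding norm_mult norm_power using elim by (intro mult_right_mono) (auto intro: less_imp_le)
        also have "\<dots> \<le> norm a ^ m / (real m + 1)"
          using term_le[of l] l by (simp add: e_def divide_right_mono mult.commute)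
        finally show "norm (\<omega> l z * a ^ l) \<le> norm a ^ m / (real m + 1)" .
      qed
      also have "\<dots> = norm a ^ m * (real m / (real m + 1))" by simp
      also have "\<dots> < norm a ^ m * 1"
        using a_ge \<sigma> by (intro mult_strict_left_mono zero_less_power) (auto simp: divide_simps)
      finally show False by simp
    qed
  qed
qed

text \<open>Division yields a matrix \<open>c\<close> of multiplication by \<open>u\<close> on the
  powers \<open>0\<close> to \<open>m - 1\<close> of \<open>z i\<close> modulo \<open>f\<close>; the
  \<open>\<xi> k\<close> are the coefficients of its characteristic polynomial, and \<open>Q\<close>
  comes from the adjugate. The last clause expresses the left kernel of \<open>c\<close> where its
  determinant vanishes. It names a radius because \<open>w\<close> has to range over a whole disc
  for fixed \<open>z\<close>.\<close>

lemma char_poly_family: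
  assumes fin: "finite S" and i: "i \<in> S" and f: "f \<in> hg S" and u: "u \<in> hg S" and m: "0 < m"
    and reg: "order_along i f m"
  shows "\<exists>\<xi> q Q. (\<forall>k. \<xi> k \<in> hg (S - {i})) \<and> \<xi> m = (\<lambda>_. 1) \<and> Q \<in> hg S \<and> (\<forall>l. q l \<in> hg S) \<and>
    (\<forall>\<^sub>F z in near S. (\<Sum>k\<le>m. \<xi> k z * u z ^ k) = Q z * f z) \<and>
    (\<exists>r. (\<forall>j. 0 < r j) \<and> (\<forall>z\<in>polydisc S r. \<xi> 0 z = 0 \<longrightarrow>
       (\<exists>v. (\<exists>l<m. v l \<noteq> 0) \<and> (\<forall>w. norm w < r i \<longrightarrow>
          u (z(i := w)) * (\<Sum>l<m. v l * w ^ l) = (\<Sum>l<m. v l * q l (z(i := w))) * f (z(i := w))))))"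
proof -
  have "\<forall>l. \<exists>q c. q \<in> hg S \<and> (\<forall>k<m. c k \<in> hg (S - {i})) \<and>
    (\<forall>\<^sub>F z in near S. u z * z i ^ l = q z * f z + (\<Sum>k<m. c k z * z i ^ k))"
    using weierstrass_division[OF fin i f hg_mult[OF u hg_power[OF hg_coord[OF i]]] reg] by blast
  then obtain q c where q: "\<And>l. q l \<in> hg S" and c: "\<And>l k. k < m \<Longrightarrow> c l k \<in> hg (S - {i})"
    and ev: "\<And>l. \<forall>\<^sub>F z in near S. u z * z i ^ l = q l z * f z + (\<Sum>k<m. c l k z * z i ^ k)"
    unfolding choice_iff by blast
  have "\<forall>\<^sub>F z in near S. \<forall>l\<in>{..<m}. u z * z i ^ l = q l z * f z + (\<Sum>k<m. c l k z * z i ^ k)"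
    by (intro eventually_ball_finite) (auto intro: ev)
  then obtain r where r: "\<forall>j. 0 < r j"
    "\<And>z l. z \<in> polydisc S r \<Longrightarrow> l < m \<Longrightarrow> u z * z i ^ l = q l z * f z + (\<Sum>k<m. c l k z * z i ^ k)"
    unfolding eventually_near by auto
  define M where "M z = Matrix.mat m m (\<lambda>(l, k). c l k z)" for z
  have M: "M z \<in> carrier_mat m m" for z by (simp add: M_def)
  define \<xi> where "\<xi> k z = Polynomial.coeff (char_poly (M z)) k" for k z
  have poly_eq: "poly (char_poly (M z)) x = (\<Sum>k\<le>m. \<xi> k z * x ^ k)" for z x
    using degree_monic_char_poly[OF M[of z]] by (simp add: poly_altdef \<xi>_def)
  define N where "N z = Matrix.mat m m (\<lambda>(l, k). (if l = k then u z else 0) - c l k z)" for z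
  define Q where "Q z = (\<Sum>l<m. adj_mat (N z) $$ (0, l) * q l z)" for z
  have cS: "c l k \<in> hg S" if "k < m" for l k using c[OF that] by (rule hg_mono) auto
  have Q_hg: "Q \<in> hg S"
    unfolding Q_def N_def
  proof (intro hg_sum hg_mult q hg_adj_mat)
    show "(\<lambda>z. (if l = k then u z else 0) - c l k z) \<in> hg S" if "k < m" for l k
      using that by (cases "l = k") (auto intro: hg_diff hg_uminus hg_const u cS)
  qed (use m in auto)
  have \<xi>_hg: "\<xi> k \<in> hg (S - {i})" for k
    unfolding \<xi>_def M_def using c by (intro hg_coeff_char_poly) auto
  have \<xi>_m: "\<xi> m = (\<lambda>_. 1)" using degree_monic_char_poly[OF M] by (auto simp: \<xi>_def)
  have ch: "\<forall>\<^sub>F z in near S. (\<Sum>k\<le>m. \<xi> k z * u z ^ k) = Q z * f z"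
  proof -
    have "\<forall>\<^sub>F z in near S. z \<in> polydisc S r" using r(1) by (intro eventually_near_polydisc) auto
    then show ?thesis
    proof eventually_elim
      case (elim z)
      have "poly (char_poly (M z)) (u z) * z i ^ 0 = (\<Sum>l<m. adj_mat (N z) $$ (0, l) * (q l z * f z))"
        unfolding M_def N_def by (rule char_poly_cayley_hamilton[OF m r(2)[OF elim]])
      then show ?case by (simp add: poly_eq Q_def sum_distrib_right mult.assoc)
    qed
  qed
  have ker: "\<exists>v. (\<exists>l<m. v l \<noteq> 0) \<and> (\<forall>w. norm w < r i \<longrightarrow>
      u (z(i := w)) * (\<Sum>l<m. v l * w ^ l) = (\<Sum>l<m. v l * q l (z(i := w))) * f (z(i := w)))"
    if z: "z \<in> polydisc S r" and "\<xi> 0 z = 0" for z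
  proof -
    have "poly (char_poly (M z)) 0 = 0" using that(2) by (simp add: \<xi>_def poly_0_coeff_0)
    then obtain v where v: "\<exists>l<m. v l \<noteq> 0" "\<And>k. k < m \<Longrightarrow> (\<Sum>l<m. v l * c l k z) = 0"
      unfolding M_def using char_poly_zero_imp_left_kernel[of m "\<lambda>l k. c l k z"] by blast
    have "u (z(i := w)) * (\<Sum>l<m. v l * w ^ l) = (\<Sum>l<m. v l * q l (z(i := w))) * f (z(i := w))"
      if w: "norm w < r i" for w
    proof -
      have z': "z(i := w) \<in> polydisc S r" using z w by (intro polydisc_upd)
      have c': "c l k (z(i := w)) = c l k z" if "k < m" for l k
        by (rule hg_cong[OF c[OF that]]) auto
      have "u (z(i := w)) * (\<Sum>l<m. v l * w ^ l) = (\<Sum>l<m. v l * (u (z(i := w)) * (z(i := w)) i ^ l))"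
        by (simp add: sum_distrib_left mult_ac)
      also have "\<dots> = (\<Sum>l<m. v l * (q l (z(i := w)) * f (z(i := w)) + (\<Sum>k<m. c l k z * w ^ k)))"
        using r(2)[OF z'] c' by (intro sum.cong refl) simp
      also have "\<dots> = (\<Sum>l<m. v l * q l (z(i := w))) * f (z(i := w)) + (\<Sum>l<m. \<Sum>k<m. v l * c l k z * w ^ k)"
        by (simp add: distrib_left sum.distrib sum_distrib_right sum_distrib_left mult.assoc)
      also have "(\<Sum>l<m. \<Sum>k<m. v l * c l k z * w ^ k) = (\<Sum>k<m. (\<Sum>l<m. v l * c l k z) * w ^ k)"
        by (subst sum.swap) (simp add: sum_distrib_right)
      also have "\<dots> = 0" using v(2) by simp
      finally show ?thesis by (simp add: fun_upd_def)
    qed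
    with v(1) show ?thesis by blast
  qed
  show ?thesis
    by (intro exI[of _ \<xi>] exI[of _ q] exI[of _ Q] exI[of _ r] conjI allI ballI impI
        \<xi>_hg \<xi>_m Q_hg q ch ker) (use r(1) in auto)
qed

text \<open>The coefficients are evaluated at \<open>z\<close>, which leaves a complex polynomial
  whose roots exist and can be counted.\<close>

definition wpoly :: "nat \<Rightarrow> (nat \<Rightarrow> ('i \<Rightarrow> complex) \<Rightarrow> complex) \<Rightarrow> ('i \<Rightarrow> complex) \<Rightarrow> complex poly"
  where "wpoly m \<omega> z = Polynomial.monom 1 m - (\<Sum>l<m. Polynomial.monom (\<omega> l z) l)"

lemma poly_wpoly: "poly (wpoly m \<omega> z) a = a ^ m - (\<Sum>l<m. \<omega> l z * a ^ l)"
  by (simp add: wpoly_def poly_sum Polynomial.poly_monom)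

lemma degree_wpoly: "0 < m \<Longrightarrow> Polynomial.degree (wpoly m \<omega> z) = m"
proof -
  assume m: "0 < m"
  have "Polynomial.degree (\<Sum>l<m. Polynomial.monom (\<omega> l z) l) \<le> m - 1"
    by (rule degree_sum_le) (auto intro!: order_trans[OF degree_monom_le])
  then have "Polynomial.degree (- (\<Sum>l<m. Polynomial.monom (\<omega> l z) l)) < Polynomial.degree (Polynomial.monom (1 :: complex) m)"
    using m by (simp add: Polynomial.degree_monom_eq)
  from degree_add_eq_left[OF this] show ?thesis by (simp add: wpoly_def Polynomial.degree_monom_eq)
qed

text \<open>On the fibre over \<open>z\<close> the Weierstrass polynomial \<open>W\<close> is
  \<open>q0 * f\<close>. The relation between \<open>u\<close> and \<open>f\<close> thus becomes
  \<open>u * q0 * V = ... * W\<close> with \<open>V\<close> of degree below \<open>m\<close>, which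
  forces \<open>u * q0\<close> to vanish at a root of \<open>W\<close>; and \<open>q0\<close> has no
  zeros there.\<close>

lemma fiber_zero:
  assumes fin: "finite S" and i: "i \<in> S" and f: "f \<in> hg S" and u: "u \<in> hg S" and m: "0 < m"
    and q0: "q0 \<in> hg S" "q0 (\<lambda>_. 0) \<noteq> 0"
    and \<omega>: "\<And>l. l < m \<Longrightarrow> \<omega> l \<in> hg (S - {i})" "\<And>l. l < m \<Longrightarrow> \<omega> l (\<lambda>_. 0) = 0"
    and ev: "\<forall>\<^sub>F z in near S. z i ^ m = q0 z * f z + (\<Sum>l<m. \<omega> l z * z i ^ l)"
    and q: "\<And>l. q l \<in> hg S" and \<xi>0: "\<xi>0 \<in> hg (S - {i})"
    and r: "\<And>j. 0 < r j" "\<And>z. z \<in> polydisc S r \<Longrightarrow> \<xi>0 z = 0 \<Longrightarrow>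
       \<exists>v. (\<exists>l<m. v l \<noteq> 0) \<and> (\<forall>w. norm w < r i \<longrightarrow>
          u (z(i := w)) * (\<Sum>l<m. v l * w ^ l) = (\<Sum>l<m. v l * q l (z(i := w))) * f (z(i := w)))"
  shows "\<forall>\<^sub>F z in near (S - {i}). \<xi>0 z = 0 \<longrightarrow> (\<exists>a. poly (wpoly m \<omega> z) a = 0 \<and> u (z(i := a)) = 0)"
proof -
  obtain r1 where r1: "\<And>j. 0 < r1 j" "\<And>z. z \<in> polydisc S r1 \<Longrightarrow> z i ^ m = q0 z * f z + (\<Sum>l<m. \<omega> l z * z i ^ l)"
    using ev unfolding eventually_near by auto
  obtain r2 where r2: "\<And>j. 0 < r2 j" "\<And>z. z \<in> polydisc S r2 \<Longrightarrow> q0 z \<noteq> 0"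
    using hg_inverse(2)[OF fin q0] unfolding eventually_near by auto
  have "finite (insert u (insert q0 (q ` {..<m})))" "insert u (insert q0 (q ` {..<m})) \<subseteq> hg S"
    using u q0 q by auto
  from hg_common[OF this] obtain r3 where r3: "\<And>j. 0 < r3 j"
    "\<exists>B. bhol S r3 B u" "\<exists>B. bhol S r3 B q0" "\<And>l. l < m \<Longrightarrow> \<exists>B. bhol S r3 B (q l)"
    by auto
  define R where "R j = min (min (r j) (r1 j)) (min (r2 j) (r3 j))" for j
  have R: "0 < R j" for j using r(1) r1(1) r2(1) r3(1) by (simp add: R_def)
  have R_le: "R j \<le> r j" "R j \<le> r1 j" "R j \<le> r2 j" "R j \<le> r3 j" for j by (auto simp: R_def)
  have "\<forall>\<^sub>F z in near (S - {i}). z \<in> polydisc (S - {i}) R"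
    using R by (rule eventually_near_polydisc)
  moreover have "\<forall>\<^sub>F z in near (S - {i}). \<forall>a. a ^ m = (\<Sum>l<m. \<omega> l z * a ^ l) \<longrightarrow> norm a < R i"
    using monic_roots_small[of "S - {i}" m \<omega> "R i"] \<omega> R fin by simp
  ultimately show ?thesis
  proof eventually_elim
    case (elim z)
    have pdR: "z(i := w) \<in> polydisc S R" if "norm w < R i" for w
      using near_upd[OF i elim(1) that] .
    have pd: "z(i := w) \<in> polydisc S r" "z(i := w) \<in> polydisc S r1"
       "z(i := w) \<in> polydisc S r2" "z(i := w) \<in> polydisc S r3" if "norm w < R i" for w
      using subsetD[OF polydisc_mono[OF _ order_refl] pdR[OF that]] R_le by blast+
    have Ri: "norm (0 :: complex) < R i" using R by simp
    have holo: "continuous_on (ball 0 (R i)) (\<lambda>w. F (z(i := w)))" if "\<exists>B. bhol S r3 B F" for F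
    proof -
      from that obtain B where "bhol S r3 B F" ..
      from bhol_holo[OF this pd(4)[OF Ri] i] have "(\<lambda>w. F (z(i := w))) holomorphic_on ball 0 (r3 i)" by simp
      then have "(\<lambda>w. F (z(i := w))) holomorphic_on ball 0 (R i)"
        by (rule holomorphic_on_subset) (use R_le(4)[of i] in auto)
      then show ?thesis by (rule holomorphic_on_imp_continuous_on)
    qed
    show ?case
    proof
      assume "\<xi>0 z = 0"
      moreover have "\<xi>0 (z(i := 0)) = \<xi>0 z" by (rule hg_cong[OF \<xi>0]) auto
      ultimately obtain v where v: "\<exists>l<m. v l \<noteq> 0" "\<And>w. norm w < r i \<Longrightarrow>
          u (z(i := w)) * (\<Sum>l<m. v l * w ^ l) = (\<Sum>l<m. v l * q l (z(i := w))) * f (z(i := w))"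
        using r(2)[OF pd(1)[OF Ri]] by auto
      define V where "V = (\<Sum>l<m. Polynomial.monom (v l) l)"
      have poly_V: "poly V w = (\<Sum>l<m. v l * w ^ l)" for w
        by (simp add: V_def poly_sum Polynomial.poly_monom)
      have coeff_V: "Polynomial.coeff V l = v l" if "l < m" for l
        using that by (simp add: V_def Polynomial.coeff_sum Polynomial.coeff_monom)
      have "\<exists>a. poly (wpoly m \<omega> z) a = 0 \<and> u (z(i := a)) * q0 (z(i := a)) = 0"
      proof (rule poly_multiple_imp_common_zero[of V _ "R i" _ "\<lambda>w. \<Sum>l<m. v l * q l (z(i := w))"])
        show "V \<noteq> 0" using v(1) coeff_V by auto
        have "Polynomial.degree V \<le> m - 1"
          unfolding V_def by (rule degree_sum_le) (auto intro!: order_trans[OF degree_monom_le])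
        then show "Polynomial.degree V < Polynomial.degree (wpoly m \<omega> z)"
          using m by (simp add: degree_wpoly)
        show "norm a < R i" if "poly (wpoly m \<omega> z) a = 0" for a
          using elim(2) that by (simp add: poly_wpoly)
        show "continuous_on (ball 0 (R i)) (\<lambda>a. u (z(i := a)) * q0 (z(i := a)))"
          by (intro continuous_intros holo r3)
        show "continuous_on (ball 0 (R i)) (\<lambda>w. \<Sum>l<m. v l * q l (z(i := w)))"
          by (intro continuous_intros holo r3) auto
        fix w :: complex assume w: "norm w < R i"
        have wr: "norm w < r i" using w R_le(1)[of i] by simp
        have "\<omega> l (z(i := w)) = \<omega> l z" if "l < m" for l
          by (rule hg_cong[OF \<omega>(1)[OF that]]) auto
        then have "poly (wpoly m \<omega> z) w = q0 (z(i := w)) * f (z(i := w))"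
          using r1(2)[OF pd(2)[OF w]] by (simp add: poly_wpoly)
        then show "u (z(i := w)) * q0 (z(i := w)) * poly V w = (\<Sum>l<m. v l * q l (z(i := w))) * poly (wpoly m \<omega> z) w"
          using v(2)[OF wr] by (simp add: poly_V mult_ac)
      qed
      then obtain a where a: "poly (wpoly m \<omega> z) a = 0" "u (z(i := a)) * q0 (z(i := a)) = 0" by blast
      have "norm a < R i" using elim(2) a(1) by (simp add: poly_wpoly)
      then have "q0 (z(i := a)) \<noteq> 0" using r2(2)[OF pd(3)] by blast
      with a show "\<exists>a. poly (wpoly m \<omega> z) a = 0 \<and> u (z(i := a)) = 0" by auto
    qed
  qed
qed

section \<open>Prime ideals and the Nullstellensatz\<close>

definition hg_ideal :: "'i set \<Rightarrow> (('i \<Rightarrow> complex) \<Rightarrow> complex) set \<Rightarrow> bool"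
  where "hg_ideal S P \<longleftrightarrow> P \<subseteq> hg S \<and> (\<lambda>_. 0) \<in> P \<and>
    (\<forall>F\<in>P. \<forall>G\<in>P. (\<lambda>z. F z + G z) \<in> P) \<and>
    (\<forall>F\<in>hg S. \<forall>G\<in>P. (\<lambda>z. F z * G z) \<in> P) \<and>
    (\<forall>F\<in>P. \<forall>G\<in>hg S. (\<forall>\<^sub>F z in near S. F z = G z) \<longrightarrow> G \<in> P)"

definition hg_prime :: "'i set \<Rightarrow> (('i \<Rightarrow> complex) \<Rightarrow> complex) set \<Rightarrow> bool"
  where "hg_prime S P \<longleftrightarrow> hg_ideal S P \<and> (\<lambda>_. 1) \<notin> P \<and>
    (\<forall>F\<in>hg S. \<forall>G\<in>hg S. (\<lambda>z. F z * G z) \<in> P \<longrightarrow> F \<in> P \<or> G \<in> P)"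

lemma hg_ideal_sub: "hg_ideal S P \<Longrightarrow> F \<in> P \<Longrightarrow> F \<in> hg S"
  by (auto simp: hg_ideal_def)

lemma hg_ideal_zero: "hg_ideal S P \<Longrightarrow> (\<lambda>_. 0) \<in> P"
  by (auto simp: hg_ideal_def)

lemma hg_ideal_add: "hg_ideal S P \<Longrightarrow> F \<in> P \<Longrightarrow> G \<in> P \<Longrightarrow> (\<lambda>z. F z + G z) \<in> P"
  by (auto simp: hg_ideal_def)

lemma hg_ideal_mult: "hg_ideal S P \<Longrightarrow> F \<in> hg S \<Longrightarrow> G \<in> P \<Longrightarrow> (\<lambda>z. F z * G z) \<in> P"
  by (auto simp: hg_ideal_def)

lemma hg_ideal_mult_right: "hg_ideal S P \<Longrightarrow> F \<in> P \<Longrightarrow> G \<in> hg S \<Longrightarrow> (\<lambda>z. F z * G z) \<in> P"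
  using hg_ideal_mult[of S P G F] by (simp add: mult.commute)

lemma hg_ideal_cong:
  "hg_ideal S P \<Longrightarrow> F \<in> P \<Longrightarrow> G \<in> hg S \<Longrightarrow> \<forall>\<^sub>F z in near S. F z = G z \<Longrightarrow> G \<in> P"
  by (auto simp: hg_ideal_def)

lemma hg_ideal_diff: "hg_ideal S P \<Longrightarrow> F \<in> P \<Longrightarrow> G \<in> P \<Longrightarrow> (\<lambda>z. F z - G z) \<in> P"
  using hg_ideal_add[of S P F "\<lambda>z. -1 * G z"] hg_ideal_mult[of S P "\<lambda>_. -1" G] hg_const[of "-1" S] by simp

lemma hg_ideal_sum:
  "hg_ideal S P \<Longrightarrow> (\<And>a. a \<in> A \<Longrightarrow> F a \<in> P) \<Longrightarrow> (\<lambda>z. \<Sum>a\<in>A. F a z) \<in> P"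
  by (induction A rule: infinite_finite_induct) (auto intro: hg_ideal_zero hg_ideal_add)

lemma hg_prime_ideal: "hg_prime S P \<Longrightarrow> hg_ideal S P"
  by (simp add: hg_prime_def)

lemma hg_prime_one: "hg_prime S P \<Longrightarrow> (\<lambda>_. 1) \<notin> P"
  by (simp add: hg_prime_def)

lemma hg_primeD:
  "hg_prime S P \<Longrightarrow> F \<in> hg S \<Longrightarrow> G \<in> hg S \<Longrightarrow> (\<lambda>z. F z * G z) \<in> P \<Longrightarrow> F \<in> P \<or> G \<in> P"
  by (simp add: hg_prime_def)

lemma hg_prime_power:
  assumes P: "hg_prime S P" and "h \<in> hg S" "G \<in> hg S" "(\<lambda>z. h z ^ n * G z) \<in> P" "h \<notin> P"
  shows "G \<in> P"
  using assms(4)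
proof (induction n)
  case (Suc n)
  then have "(\<lambda>z. h z * (h z ^ n * G z)) \<in> P" by (simp add: mult.assoc)
  with hg_primeD[OF P assms(2) hg_mult[OF hg_power[OF assms(2)] assms(3)]] Suc.IH assms(5)
  show ?case by blast
qed simp

text \<open>A nonzero value at the origin would make \<open>F\<close> a unit and put
  \<open>1\<close> into \<open>P\<close>. As a consequence the order of an element of
  \<open>P\<close> along an axis is positive.\<close>

lemma hg_prime_vanish:
  assumes fin: "finite S" and P: "hg_prime S P" and F: "F \<in> P"
  shows "F (\<lambda>_. 0) = 0"
proof (rule ccontr)
  assume "F (\<lambda>_. 0) \<noteq> 0"
  note I = hg_prime_ideal[OF P]
  note inv = hg_inverse[OF fin hg_ideal_sub[OF I F] \<open>F (\<lambda>_. 0) \<noteq> 0\<close>]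
  have "(\<lambda>z. 1 / F z * F z) \<in> P" by (rule hg_ideal_mult[OF I inv(1) F])
  then have "(\<lambda>_. 1) \<in> P"
    by (rule hg_ideal_cong[OF I _ hg_const]) (use inv(2) in \<open>auto elim: eventually_mono\<close>)
  with hg_prime_one[OF P] show False ..
qed

lemma hg_prime_restrict:
  assumes P: "hg_prime S P" and "T \<subseteq> S"
  shows "hg_prime T (P \<inter> hg T)"
proof -
  note I = hg_prime_ideal[OF P]
  have mono: "F \<in> hg S" if "F \<in> hg T" for F using that assms(2) by (rule hg_mono)
  have "hg_ideal T (P \<inter> hg T)"
    unfolding hg_ideal_def
    by (auto intro: hg_ideal_zero[OF I] hg_const hg_ideal_add[OF I] hg_add hg_ideal_mult[OF I] hg_mult mono
        hg_ideal_cong[OF I _ _ eventually_near_mono[OF assms(2)]])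
  then show ?thesis
    unfolding hg_prime_def using hg_prime_one[OF P] hg_primeD[OF P mono mono] by blast
qed

text \<open>Composition with a shear is an endomorphism of the ring \<open>hg S\<close>, and
  preimages of prime ideals are prime.\<close>

lemma hg_prime_shear:
  assumes fin: "finite S" and i: "i \<in> S" and P: "hg_prime S P"
  shows "hg_prime S {F \<in> hg S. (\<lambda>z. F (shear i c z)) \<in> P}"
proof -
  note I = hg_prime_ideal[OF P]
  have sh: "(\<lambda>z. F (shear i c z)) \<in> hg S" if "F \<in> hg S" for F
    by (rule hg_shear[OF fin i that])
  have "hg_ideal S {F \<in> hg S. (\<lambda>z. F (shear i c z)) \<in> P}"
    unfolding hg_ideal_def
  proof (intro conjI ballI impI)
    fix F G assume F: "F \<in> {F \<in> hg S. (\<lambda>z. F (shear i c z)) \<in> P}" and G: "G \<in> hg S"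
      and "\<forall>\<^sub>F z in near S. F z = G z"
    from eventually_near_shear[OF fin i this(3)] F G
    show "G \<in> {F \<in> hg S. (\<lambda>z. F (shear i c z)) \<in> P}"
      using hg_ideal_cong[OF I _ sh] by blast
  qed (auto intro: hg_const hg_add hg_mult hg_ideal_zero[OF I] hg_ideal_add[OF I] hg_ideal_mult[OF I sh])
  then show ?thesis
    unfolding hg_prime_def using hg_prime_one[OF P] hg_primeD[OF P sh sh] by auto
qed

lemma card_bounded_fibers:
  assumes "finite A" "finite C" "\<And>c. c \<in> C \<Longrightarrow> \<exists>a\<in>A. R c a" "card A * N < card C"
  shows "\<exists>a\<in>A. N < card {c\<in>C. R c a}"
proof (rule ccontr)
  assume "\<not> ?thesis"
  then have le: "card {c\<in>C. R c a} \<le> N" if "a \<in> A" for a using that by force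
  have "C \<subseteq> (\<Union>a\<in>A. {c\<in>C. R c a})" using assms(3) by blast
  then have "card C \<le> card (\<Union>a\<in>A. {c\<in>C. R c a})" using assms(1,2) by (intro card_mono) auto
  also have "\<dots> \<le> (\<Sum>a\<in>A. card {c\<in>C. R c a})" by (rule card_UN_le[OF assms(1)])
  also have "\<dots> \<le> (\<Sum>a\<in>A. N)" by (rule sum_mono) (rule le)
  finally show False using assms(4) by simp
qed

lemma poly_many_zeros:
  fixes p :: "nat \<Rightarrow> complex"
  assumes "finite C" "N < card {c\<in>C. (\<Sum>n<N. p n * of_nat c ^ n) = 0}" "n < N"
  shows "p n = 0"
proof (rule ccontr)
  assume "p n \<noteq> 0"
  define V where "V = (\<Sum>n<N. Polynomial.monom (p n) n)"
  have "Polynomial.coeff V n = p n"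
    using assms(3) by (simp add: V_def Polynomial.coeff_sum Polynomial.coeff_monom)
  with \<open>p n \<noteq> 0\<close> have V0: "V \<noteq> 0" by auto
  have "Polynomial.degree V \<le> N - 1"
    unfolding V_def by (rule degree_sum_le) (auto intro!: order_trans[OF degree_monom_le])
  have "of_nat ` {c\<in>C. (\<Sum>n<N. p n * of_nat c ^ n) = 0} \<subseteq> {x. poly V x = 0}"
    by (auto simp: V_def poly_sum Polynomial.poly_monom)
  then have "card ((of_nat :: nat \<Rightarrow> complex) ` {c\<in>C. (\<Sum>n<N. p n * of_nat c ^ n) = 0}) \<le> card {x. poly V x = 0}"
    by (rule card_mono[OF poly_roots_finite[OF V0]])
  also have "\<dots> \<le> Polynomial.degree V" by (rule card_poly_roots_bound[OF V0])
  finally show False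
    using assms(2) \<open>Polynomial.degree V \<le> N - 1\<close> by (simp add: card_image inj_on_def)
qed

text \<open>Elimination of \<open>z\<^sub>i\<close>: the constant coefficients of the characteristic polynomials of
  multiplication by elements of \<open>P\<close> on the finite free module \<open>hg S / (f)\<close> lie in \<open>P\<close>, and over each
  of their zeros the corresponding element of \<open>P\<close> vanishes at a zero of the Weierstrass polynomial.
  A common zero of all of \<open>Fs\<close> results from applying this to sufficiently many combinations
  \<open>\<Sum>n. d\<^sup>n p\<^sub>n\<close>, by the pigeonhole principle and a Vandermonde argument. The condition \<open>h \<noteq> 0\<close> is
  carried down as \<open>\<xi> j \<noteq> 0\<close> for the first coefficient \<open>\<xi> j\<close> of the characteristic polynomial of
  \<open>h\<close> that is not in \<open>P\<close>.\<close>

lemma nullstellensatz_step: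
  assumes fin: "finite S" and i: "i \<in> S" and P: "hg_prime S P" and f: "f \<in> P"
    and reg: "order_along i f m"
    and h: "h \<in> hg S" "h \<notin> P" and Fs: "finite Fs" "Fs \<subseteq> P"
    and IH: "\<And>P' h' Fs'. hg_prime (S - {i}) P' \<Longrightarrow> h' \<in> hg (S - {i}) \<Longrightarrow> h' \<notin> P' \<Longrightarrow>
      finite Fs' \<Longrightarrow> Fs' \<subseteq> P' \<Longrightarrow> \<exists>\<^sub>F z in near (S - {i}). (\<forall>p\<in>Fs'. p z = 0) \<and> h' z \<noteq> 0"
  shows "\<exists>\<^sub>F z in near S. (\<forall>p\<in>Fs. p z = 0) \<and> h z \<noteq> 0"
proof -
  note I = hg_prime_ideal[OF P]
  have f_hg: "f \<in> hg S" using hg_ideal_sub[OF I f] .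
  have m: "0 < m"
    using reg hg_prime_vanish[OF fin P f] by (cases m) (auto simp: order_along_def)
  obtain q0 \<omega> where q0: "q0 \<in> hg S" "q0 (\<lambda>_. 0) \<noteq> 0"
    and \<omega>: "\<And>l. l < m \<Longrightarrow> \<omega> l \<in> hg (S - {i})" "\<And>l. l < m \<Longrightarrow> \<omega> l (\<lambda>_. 0) = 0"
    and ev: "\<forall>\<^sub>F z in near S. z i ^ m = q0 z * f z + (\<Sum>l<m. \<omega> l z * z i ^ l)"
    using weierstrass_polynomial[OF fin i f_hg reg] by blast
  have mono: "F \<in> hg S" if "F \<in> hg (S - {i})" for F using that by (rule hg_mono) auto
  have char_in: "(\<lambda>z. \<Sum>k\<le>m. \<xi> k z * u z ^ k) \<in> P"
    if "\<And>k. \<xi> k \<in> hg (S - {i})" "u \<in> hg S" "Q \<in> hg S"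
      "\<forall>\<^sub>F z in near S. (\<Sum>k\<le>m. \<xi> k z * u z ^ k) = Q z * f z" for \<xi> u Q
    using hg_ideal_mult[OF I that(3) f]
    by (rule hg_ideal_cong[OF I])
       (use that(4) in \<open>auto intro!: hg_sum hg_mult[OF mono[OF that(1)] hg_power[OF that(2)]] elim: eventually_mono\<close>)
  have fiber: "\<exists>\<xi>0. \<xi>0 \<in> P \<inter> hg (S - {i}) \<and>
      (\<forall>\<^sub>F z in near (S - {i}). \<xi>0 z = 0 \<longrightarrow> (\<exists>a. poly (wpoly m \<omega> z) a = 0 \<and> u (z(i := a)) = 0))"
    if u: "u \<in> P" for u
  proof -
    have u_hg: "u \<in> hg S" using hg_ideal_sub[OF I u] .
    from char_poly_family[OF fin i f_hg u_hg m reg]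
    obtain \<xi> q Q r where c: "\<And>k. \<xi> k \<in> hg (S - {i})" "Q \<in> hg S" "\<And>l. q l \<in> hg S"
      "\<forall>\<^sub>F z in near S. (\<Sum>k\<le>m. \<xi> k z * u z ^ k) = Q z * f z" "\<And>j. 0 < r j"
      "\<And>z. z \<in> polydisc S r \<Longrightarrow> \<xi> 0 z = 0 \<Longrightarrow>
       (\<exists>v. (\<exists>l<m. v l \<noteq> 0) \<and> (\<forall>w. norm w < r i \<longrightarrow>
          u (z(i := w)) * (\<Sum>l<m. v l * w ^ l) = (\<Sum>l<m. v l * q l (z(i := w))) * f (z(i := w))))"
      by (elim exE conjE) blast
    \<comment> \<open>All terms with \<open>k > 0\<close> are divisible by \<open>u\<close> and lie
      in \<open>P\<close>; what the characteristic equation leaves over is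
      \<open>\<xi> 0\<close>.\<close>
    have "(\<lambda>z. (\<Sum>k\<le>m. \<xi> k z * u z ^ k) - (\<Sum>k\<in>{0<..m}. \<xi> k z * u z ^ k)) \<in> P"
    proof (rule hg_ideal_diff[OF I char_in[OF c(1) u_hg c(2,4)]], rule hg_ideal_sum[OF I])
      fix k assume "k \<in> {0<..m}"
      then obtain k' where "k = Suc k'" by (cases k) auto
      then have "(\<lambda>z. \<xi> k z * u z ^ k) = (\<lambda>z. (\<xi> k z * u z ^ k') * u z)" by (simp add: mult_ac)
      also have "\<dots> \<in> P" by (intro hg_ideal_mult[OF I _ u] hg_mult mono c(1) hg_power u_hg)
      finally show "(\<lambda>z. \<xi> k z * u z ^ k) \<in> P" .
    qed
    moreover have "(\<Sum>k\<le>m. \<xi> k z * u z ^ k) - (\<Sum>k\<in>{0<..m}. \<xi> k z * u z ^ k) = \<xi> 0 z" for z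
    proof -
      have "{..m} = insert 0 {0<..m}" by auto
      then show ?thesis by simp
    qed
    ultimately have "\<xi> 0 \<in> P" by simp
    with c(1) fiber_zero[where \<omega> = \<omega> and q = q and r = r, OF fin i f_hg u_hg m q0 \<omega> ev c(3) c(1)[of 0] c(5,6)]
    show ?thesis by blast
  qed
  from char_poly_family[OF fin i f_hg h(1) m reg]
  obtain \<xi> Q where c: "\<And>k. \<xi> k \<in> hg (S - {i})" "\<xi> m = (\<lambda>_. 1)" "Q \<in> hg S"
      "\<forall>\<^sub>F z in near S. (\<Sum>k\<le>m. \<xi> k z * h z ^ k) = Q z * f z"
    by (elim exE conjE) blast
  define j where "j = (LEAST k. \<xi> k \<notin> P)"
  have "\<xi> m \<notin> P" using c(2) hg_prime_one[OF P] by simp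
  then have j: "\<xi> j \<notin> P" "j \<le> m" and j_least: "\<And>k. k < j \<Longrightarrow> \<xi> k \<in> P"
    unfolding j_def by (rule LeastI, rule Least_le) (use not_less_Least in blast)
  \<comment> \<open>The characteristic polynomial of \<open>h\<close> without the terms below
    \<open>j\<close>, which lie in \<open>P\<close>, and divided by \<open>h ^ j\<close>. Its term
    free of \<open>h\<close> is \<open>\<xi> j\<close>, so at a zero of \<open>ps\<close> with
    \<open>\<xi> j \<noteq> 0\<close> also \<open>h \<noteq> 0\<close>. Hence \<open>ps\<close>
    joins the functions whose common zero is sought.\<close>
  define ps where "ps z = (\<Sum>k\<in>{j..m}. \<xi> k z * h z ^ (k - j))" for z
  have ps_hg: "ps \<in> hg S" unfolding ps_def by (intro hg_sum hg_mult hg_power mono c(1) h(1))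
  have "(\<lambda>z. h z ^ j * ps z) \<in> P"
  proof -
    have "(\<lambda>z. (\<Sum>k\<le>m. \<xi> k z * h z ^ k) - (\<Sum>k<j. \<xi> k z * h z ^ k)) \<in> P"
      by (rule hg_ideal_diff[OF I char_in[OF c(1) h(1) c(3,4)]], rule hg_ideal_sum[OF I],
          intro hg_ideal_mult_right[OF I] hg_power h(1) j_least) auto
    moreover have "(\<Sum>k\<le>m. \<xi> k z * h z ^ k) - (\<Sum>k<j. \<xi> k z * h z ^ k) = h z ^ j * ps z" for z
    proof -
      have "{..m} = {..<j} \<union> {j..m}" using j(2) by auto
      then have "(\<Sum>k\<le>m. \<xi> k z * h z ^ k) = (\<Sum>k<j. \<xi> k z * h z ^ k) + (\<Sum>k\<in>{j..m}. \<xi> k z * h z ^ k)"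
        by (simp add: sum.union_disjoint ivl_disj_int_one(4))
      moreover have "(\<Sum>k\<in>{j..m}. \<xi> k z * h z ^ k) = h z ^ j * ps z"
        unfolding ps_def sum_distrib_left by (intro sum.cong) (auto simp: mult_ac simp flip: power_add)
      ultimately show ?thesis by simp
    qed
    ultimately show ?thesis by simp
  qed
  then have ps: "ps \<in> P" using hg_prime_power[OF P h(1) ps_hg _ h(2)] by blast
  have ps_nz: "h x \<noteq> 0" if "ps x = 0" "\<xi> j x \<noteq> 0" for x
  proof
    assume h0: "h x = 0"
    have "{j..m} = insert j {j<..m}" using j(2) by auto
    then have "ps x = \<xi> j x + (\<Sum>k\<in>{j<..m}. \<xi> k x * h x ^ (k - j))" by (simp add: ps_def)
    also have "(\<Sum>k\<in>{j<..m}. \<xi> k x * h x ^ (k - j)) = 0"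
      by (intro sum.neutral) (auto simp: h0)
    finally show False using that by simp
  qed
  define Gs where "Gs = insert ps Fs"
  have Gs: "finite Gs" "Gs \<subseteq> P" using Fs ps by (auto simp: Gs_def)
  define N where "N = card Gs"
  obtain p where p: "bij_betw p {..<N} Gs"
    using ex_bij_betw_nat_finite[OF Gs(1)] unfolding N_def atLeast0LessThan by blast
  have p_in: "p n \<in> P" if "n < N" for n using p Gs(2) that by (auto simp: bij_betw_def)
  \<comment> \<open>There are \<open>m * N + 1\<close> values \<open>d\<close> and at most
    \<open>m\<close> roots, so one root serves more than \<open>N\<close> values. This annihilates
    the coefficients of a polynomial in \<open>d\<close> of degree below \<open>N\<close>.\<close>
  define C where "C = {..m * N}"
  define pc where "pc d z = (\<Sum>n<N. p n z * of_nat d ^ n)" for d :: nat and z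
  have pc: "pc d \<in> P" for d
    unfolding pc_def by (intro hg_ideal_sum[OF I] hg_ideal_mult_right[OF I p_in] hg_const) auto
  have "\<forall>d. \<exists>\<xi>0. \<xi>0 \<in> P \<inter> hg (S - {i}) \<and>
      (\<forall>\<^sub>F z in near (S - {i}). \<xi>0 z = 0 \<longrightarrow> (\<exists>a. poly (wpoly m \<omega> z) a = 0 \<and> pc d (z(i := a)) = 0))"
    using fiber[OF pc] by blast
  then obtain \<zeta> where \<zeta>: "\<And>d. \<zeta> d \<in> P \<inter> hg (S - {i})"
     "\<And>d. \<forall>\<^sub>F z in near (S - {i}). \<zeta> d z = 0 \<longrightarrow> (\<exists>a. poly (wpoly m \<omega> z) a = 0 \<and> pc d (z(i := a)) = 0)"
    unfolding choice_iff by blast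
  \<comment> \<open>The contracted ideal in one variable less contains all \<open>\<zeta> d\<close>
    but not \<open>\<xi> j\<close>.\<close>
  have freq: "\<exists>\<^sub>F z in near (S - {i}). (\<forall>p\<in>\<zeta> ` C. p z = 0) \<and> \<xi> j z \<noteq> 0"
    by (rule IH[OF hg_prime_restrict[OF P]]) (use \<zeta>(1) c(1) j(1) in \<open>auto simp: C_def\<close>)
  show ?thesis
    unfolding frequently_def
  proof
    assume "\<forall>\<^sub>F z in near S. \<not> ((\<forall>p\<in>Fs. p z = 0) \<and> h z \<noteq> 0)"
    then obtain r where r: "\<And>j. 0 < r j"
      "\<And>z. z \<in> polydisc S r \<Longrightarrow> \<not> ((\<forall>p\<in>Fs. p z = 0) \<and> h z \<noteq> 0)"
      unfolding eventually_near by auto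
    have e1: "\<forall>\<^sub>F z in near (S - {i}). z \<in> polydisc (S - {i}) r"
      using r(1) by (rule eventually_near_polydisc)
    have e2: "\<forall>\<^sub>F z in near (S - {i}). \<forall>a. a ^ m = (\<Sum>l<m. \<omega> l z * a ^ l) \<longrightarrow> norm a < r i"
      using monic_roots_small[of "S - {i}" m \<omega> "r i"] \<omega> r(1) fin by simp
    have e3: "\<forall>\<^sub>F z in near (S - {i}). \<forall>d\<in>C. \<zeta> d z = 0 \<longrightarrow> (\<exists>a. poly (wpoly m \<omega> z) a = 0 \<and> pc d (z(i := a)) = 0)"
      by (intro eventually_ball_finite ballI \<zeta>(2)) (simp add: C_def)
    obtain z where "((\<forall>p\<in>\<zeta> ` C. p z = 0) \<and> \<xi> j z \<noteq> 0) \<and> z \<in> polydisc (S - {i}) r \<and>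
        (\<forall>a. a ^ m = (\<Sum>l<m. \<omega> l z * a ^ l) \<longrightarrow> norm a < r i) \<and>
        (\<forall>d\<in>C. \<zeta> d z = 0 \<longrightarrow> (\<exists>a. poly (wpoly m \<omega> z) a = 0 \<and> pc d (z(i := a)) = 0))"
      using frequently_ex[OF frequently_eventually_frequently[OF freq eventually_conj[OF e1 eventually_conj[OF e2 e3]]]] ..
    then have z: "\<And>d. d \<in> C \<Longrightarrow> \<zeta> d z = 0" "\<xi> j z \<noteq> 0" "z \<in> polydisc (S - {i}) r"
       "\<And>a. a ^ m = (\<Sum>l<m. \<omega> l z * a ^ l) \<Longrightarrow> norm a < r i"
       "\<And>d. d \<in> C \<Longrightarrow> \<zeta> d z = 0 \<Longrightarrow> (\<exists>a. poly (wpoly m \<omega> z) a = 0 \<and> pc d (z(i := a)) = 0)"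
      by simp_all
    define A where "A = {a. poly (wpoly m \<omega> z) a = 0}"
    have W0: "wpoly m \<omega> z \<noteq> 0" using degree_wpoly[OF m, of \<omega> z] m by auto
    have A: "finite A" "card A \<le> m"
      using poly_roots_finite[OF W0] card_poly_roots_bound[OF W0] degree_wpoly[OF m, of \<omega> z] by (auto simp: A_def)
    have "\<exists>a\<in>A. N < card {d\<in>C. pc d (z(i := a)) = 0}"
    proof (rule card_bounded_fibers[OF A(1)])
      have "card A * N \<le> m * N" using A(2) by (rule mult_le_mono1)
      then show "card A * N < card C" unfolding C_def card_atMost by (rule le_imp_less_Suc)
    qed (use z(1,5) in \<open>auto simp: A_def C_def\<close>)
    then obtain a where a: "a \<in> A" "N < card {d\<in>C. pc d (z(i := a)) = 0}" ..
    define x where "x = z(i := a)"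
    have "p n x = 0" if "n < N" for n
      using poly_many_zeros[of C N "\<lambda>n. p n x" n] a(2) that by (simp add: pc_def x_def C_def)
    then have zero: "G x = 0" if "G \<in> Gs" for G
      using that p by (auto simp: bij_betw_def)
    have "norm a < r i" using z(4)[of a] a(1) by (simp add: A_def poly_wpoly)
    then have "x \<in> polydisc S r" unfolding x_def by (rule near_upd[OF i z(3)])
    moreover have "\<xi> j x \<noteq> 0"
      using z(2) hg_cong[OF c(1), of x z j] by (simp add: x_def)
    then have "h x \<noteq> 0" using ps_nz zero by (simp add: Gs_def)
    ultimately show False using r(2) zero by (auto simp: Gs_def)
  qed
qed

text \<open>The parameters of the line through the origin and \<open>z\<close> that stay in the
  polydisc form a convex open set containing \<open>0\<close> and \<open>1\<close>; vanishing near
  \<open>0\<close> would spread to \<open>\<tau> = 1\<close>.\<close>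

lemma bhol_line_nonzero:
  assumes fin: "finite S" and F: "bhol S r B F" and z: "z \<in> polydisc S r" and "F z \<noteq> 0" and e: "e > 0"
  shows "\<exists>\<tau>. norm \<tau> < e \<and> F (\<lambda>i. \<tau> * z i) \<noteq> 0"
proof (rule ccontr)
  assume "\<not> ?thesis"
  then have zero: "F (\<lambda>i. \<tau> * z i) = 0" if "norm \<tau> < e" for \<tau> using that by blast
  define U where "U = (\<Inter>i\<in>S. (\<lambda>\<tau>. \<tau> * z i) -` ball 0 (r i))"
  have r: "0 < r i" if "i \<in> S" for i using polydisc_D[OF z that] norm_ge_zero[of "z i"] by linarith
  have "open U" unfolding U_def
    using fin by (intro open_INT ballI open_vimage) (auto intro!: continuous_intros)
  have "convex U"
    unfolding U_def
    by (intro convex_INT convex_linear_vimage convex_ball bounded_linear.linear[OF bounded_linear_mult_left])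
  have U: "0 \<in> U" "1 \<in> U" using r polydisc_D[OF z] by (auto simp: U_def)
  have "F (\<lambda>i. 1 * z i) = 0"
  proof (rule analytic_continuation[of "\<lambda>\<tau>. F (\<lambda>i. \<tau> * z i)" U "U \<inter> ball 0 e" 0])
    have "(\<lambda>\<tau>. F (\<lambda>i. 0 + \<tau> * z i)) holomorphic_on U"
      by (rule bhol_line_holo[OF fin F \<open>open U\<close>]) (auto simp: U_def polydisc_def)
    then show "(\<lambda>\<tau>. F (\<lambda>i. \<tau> * z i)) holomorphic_on U" by simp
    show "0 islimpt (U \<inter> ball 0 e)"
      using U e \<open>open U\<close> by (intro interior_limit_point) (simp add: interior_open)
  qed (use \<open>open U\<close> \<open>convex U\<close> U zero in \<open>auto intro: convex_connected\<close>)
  with assms(4) show False by simp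
qed

text \<open>Induction on the number of variables. If all elements of \<open>P\<close> vanish near
  the origin, it suffices that a function outside \<open>P\<close> does not. Otherwise a shear makes
  an element of \<open>P\<close> regular in one coordinate, which can then be eliminated.\<close>

theorem nullstellensatz:
  assumes "finite S" "hg_prime S P" "h \<in> hg S" "h \<notin> P" "finite Fs" "Fs \<subseteq> P"
  shows "\<exists>\<^sub>F z in near S. (\<forall>p\<in>Fs. p z = 0) \<and> h z \<noteq> 0"
  using assms
proof (induction "card S" arbitrary: S P h Fs rule: less_induct)
  case less
  note fin = less.prems(1) and P = less.prems(2) and h = less.prems(3,4) and Fs = less.prems(5,6)
  note I = hg_prime_ideal[OF P]
  show ?case
  proof (cases "\<forall>p\<in>P. \<forall>\<^sub>F z in near S. p z = 0")
    case True
    have "\<not> (\<forall>\<^sub>F z in near S. h z = 0)"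
    proof
      assume "\<forall>\<^sub>F z in near S. h z = 0"
      then have "\<forall>\<^sub>F z in near S. 0 = h z" by eventually_elim simp
      from hg_ideal_cong[OF I hg_ideal_zero[OF I] h(1) this] h(2) show False by simp
    qed
    then have "\<exists>\<^sub>F z in near S. h z \<noteq> 0" by (simp add: frequently_def)
    moreover have "\<forall>\<^sub>F z in near S. \<forall>p\<in>Fs. p z = 0"
      using True Fs by (intro eventually_ball_finite) auto
    ultimately show ?thesis
      by (rule frequently_eventually_frequently[THEN frequently_elim1]) auto
  next
    case False
    then obtain p0 where p0: "p0 \<in> P" "\<not> (\<forall>\<^sub>F z in near S. p0 z = 0)" by blast
    obtain r B where r: "\<And>j. 0 < r j" and B: "bhol S r B p0"
      by (rule hgE[OF hg_ideal_sub[OF I p0(1)]]) (rule that; blast)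
    have "\<not> (\<forall>z\<in>polydisc S r. p0 z = 0)"
    proof
      assume "\<forall>z\<in>polydisc S r. p0 z = 0"
      then have "\<forall>\<^sub>F z in near S. p0 z = 0"
        using r unfolding eventually_near by (intro exI[of _ r]) simp
      with p0(2) show False ..
    qed
    then obtain y where y: "y \<in> polydisc S r" "p0 y \<noteq> 0" by blast
    have "\<exists>i\<in>S. y i \<noteq> 0"
    proof (rule ccontr)
      assume "\<not> ?thesis"
      then have "p0 y = p0 (\<lambda>_. 0)" by (intro bhol_cong[OF B]) auto
      with y(2) hg_prime_vanish[OF fin P p0(1)] show False by simp
    qed
    then obtain i where i: "i \<in> S" "y i \<noteq> 0" by blast
    \<comment> \<open>The shear takes the \<open>i\<close>-th axis to the line through
      \<open>y\<close>, on which \<open>p0\<close> is not identically zero; this gives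
      \<open>f\<close> a finite order.\<close>
    define c where "c j = y j / y i" for j
    define f where "f z = p0 (shear i c z)" for z
    have f_hg: "f \<in> hg S" unfolding f_def by (rule hg_shear[OF fin i(1) hg_ideal_sub[OF I p0(1)]])
    define P1 where "P1 = {F \<in> hg S. (\<lambda>z. F (shear i (\<lambda>j. - c j) z)) \<in> P}"
    have P1: "hg_prime S P1" unfolding P1_def by (rule hg_prime_shear[OF fin i(1) P])
    have to_P1: "(\<lambda>z. F (shear i c z)) \<in> P1 \<longleftrightarrow> F \<in> P" if "F \<in> hg S" for F
      using hg_shear[OF fin i(1) that, of c] by (simp add: P1_def shear_shear_minus)
    have axis: "f ((\<lambda>_. 0)(i := w)) = p0 (\<lambda>j. (w / y i) * y j)" for w
      unfolding f_def shear_def by (rule arg_cong[of _ _ p0]) (use i(2) in \<open>auto simp: c_def\<close>)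
    have ex: "\<exists>l. (dq i ^^ l) f (\<lambda>_. 0) \<noteq> 0"
    proof (rule ccontr)
      assume "\<not> ?thesis"
      then have all0: "\<And>l. (dq i ^^ l) f (\<lambda>_. 0) = 0" by blast
      obtain r' B' where r': "\<And>j. 0 < r' j" and B': "bhol S r' B' f"
        by (rule hgE[OF f_hg]) (rule that; blast)
      \<comment> \<open>The point \<open>y\<close> itself may lie outside the disc on which
        \<open>f\<close> is controlled. The identity theorem on the line moves the nonzero value of
        \<open>p0\<close> inside.\<close>
      obtain \<tau> where \<tau>: "norm \<tau> < r' i / norm (y i)" "p0 (\<lambda>j. \<tau> * y j) \<noteq> 0"
        using bhol_line_nonzero[OF fin B y, of "r' i / norm (y i)"] r'[of i] i(2) by auto
      have "norm (\<tau> * y i) < r' i" using \<tau>(1) i(2) by (simp add: norm_mult field_simps)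
      from dq_all_zero_imp_axis_zero[OF B' r' i(1) all0 this] axis[of "\<tau> * y i"] \<tau>(2) i(2)
      show False by simp
    qed
    define m where "m = (LEAST l. (dq i ^^ l) f (\<lambda>_. 0) \<noteq> 0)"
    have m: "order_along i f m"
      unfolding order_along_def m_def using LeastI_ex[OF ex] not_less_Least by blast
    define Fs1 where "Fs1 = (\<lambda>F z. F (shear i c z)) ` Fs"
    have "\<exists>\<^sub>F z in near S. (\<forall>p\<in>Fs1. p z = 0) \<and> h (shear i c z) \<noteq> 0"
    proof (rule nullstellensatz_step[OF fin i(1) P1 _ m])
      show "f \<in> P1" unfolding f_def using to_P1 hg_ideal_sub[OF I] p0(1) by blast
      show "(\<lambda>z. h (shear i c z)) \<notin> P1" using to_P1[OF h(1)] h(2) by blast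
      show "finite Fs1" "Fs1 \<subseteq> P1" using Fs to_P1 hg_ideal_sub[OF I] by (auto simp: Fs1_def)
      show "\<exists>\<^sub>F z in near (S - {i}). (\<forall>p\<in>Fs'. p z = 0) \<and> h' z \<noteq> 0"
        if "hg_prime (S - {i}) P'" "h' \<in> hg (S - {i})" "h' \<notin> P'" "finite Fs'" "Fs' \<subseteq> P'" for P' h' Fs'
        using less.hyps[OF _ _ that] fin i(1) card_Diff1_less[OF fin i(1)] by blast
    qed (rule hg_shear[OF fin i(1) h(1)])
    then have "\<exists>\<^sub>F z in near S. (\<forall>p\<in>Fs. p (shear i c z) = 0) \<and> h (shear i c z) \<noteq> 0"
      by (simp add: Fs1_def)
    then show ?thesis
      unfolding frequently_def using eventually_near_shear[OF fin i(1)] by fast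
  qed
qed

section \<open>Powers of dominated functions\<close>

lemma hg_ideal_Union_chain:
  assumes "C \<noteq> {}" "subset.chain A C" "\<And>P. P \<in> A \<Longrightarrow> hg_ideal S P"
  shows "hg_ideal S (\<Union>C)"
  unfolding hg_ideal_def
proof (intro conjI ballI impI)
  have C: "hg_ideal S P" if "P \<in> C" for P using assms that by (auto simp: subset.chain_def)
  have chain: "P \<subseteq> Q \<or> Q \<subseteq> P" if "P \<in> C" "Q \<in> C" for P Q
    using assms(2) that by (auto simp: subset.chain_def)
  show "\<Union>C \<subseteq> hg S" using hg_ideal_sub[OF C] by blast
  show "(\<lambda>_. 0) \<in> \<Union>C" using assms(1) hg_ideal_zero[OF C] by blast
  show "(\<lambda>z. F z + G z) \<in> \<Union>C" if "F \<in> \<Union>C" "G \<in> \<Union>C" for F G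
  proof -
    from that obtain P Q where "P \<in> C" "F \<in> P" "Q \<in> C" "G \<in> Q" by blast
    with chain obtain R where "R \<in> C" "F \<in> R" "G \<in> R" by blast
    with hg_ideal_add[OF C] show ?thesis by blast
  qed
  show "(\<lambda>z. F z * G z) \<in> \<Union>C" if "F \<in> hg S" "G \<in> \<Union>C" for F G
    using that hg_ideal_mult[OF C] by blast
  show "G \<in> \<Union>C" if "F \<in> \<Union>C" "G \<in> hg S" "\<forall>\<^sub>F z in near S. F z = G z" for F G
    using that hg_ideal_cong[OF C] by blast
qed

text \<open>\<open>N\<close> is the ideal generated by \<open>M\<close> and \<open>F\<close>, up to
  equality near the origin; it is the competitor against which maximality of \<open>M\<close> is
  tested.\<close>

lemma hg_ideal_adjoin:
  assumes M: "hg_ideal S M" and F: "F \<in> hg S"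
  defines "N \<equiv> {H \<in> hg S. \<exists>a\<in>M. \<exists>b\<in>hg S. \<forall>\<^sub>F z in near S. H z = a z + b z * F z}"
  shows "hg_ideal S N" "M \<subseteq> N" "F \<in> N"
proof -
  show "M \<subseteq> N"
  proof
    fix H assume H: "H \<in> M"
    show "H \<in> N"
      unfolding N_def
      by (intro CollectI conjI bexI[of _ H] bexI[of _ "\<lambda>_. 0"] H hg_ideal_sub[OF M H] hg_const) simp
  qed
  show "F \<in> N"
    unfolding N_def
    by (intro CollectI conjI F bexI[of _ "\<lambda>_. 0"] bexI[of _ "\<lambda>_. 1"] hg_ideal_zero[OF M] hg_const) simp
  show "hg_ideal S N"
    unfolding hg_ideal_def
  proof (intro conjI ballI impI)
    show "N \<subseteq> hg S" by (auto simp: N_def)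
    show "(\<lambda>_. 0) \<in> N" using \<open>M \<subseteq> N\<close> hg_ideal_zero[OF M] by blast
    show "(\<lambda>z. G z + H z) \<in> N" if G: "G \<in> N" and H: "H \<in> N" for G H
    proof -
      obtain a b where ab: "a \<in> M" "b \<in> hg S" "\<forall>\<^sub>F z in near S. G z = a z + b z * F z"
        using G by (auto simp: N_def)
      obtain c d where cd: "c \<in> M" "d \<in> hg S" "\<forall>\<^sub>F z in near S. H z = c z + d z * F z"
        using H by (auto simp: N_def)
      have "\<forall>\<^sub>F z in near S. G z + H z = (a z + c z) + (b z + d z) * F z"
        using ab(3) cd(3) by eventually_elim (simp add: algebra_simps)
      moreover have "(\<lambda>z. G z + H z) \<in> hg S" using G H by (auto simp: N_def intro: hg_add)
      ultimately show ?thesis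
        unfolding N_def mem_Collect_eq using hg_ideal_add[OF M ab(1) cd(1)] hg_add[OF ab(2) cd(2)]
        by (intro conjI bexI[of _ "\<lambda>z. a z + c z"] bexI[of _ "\<lambda>z. b z + d z"])
    qed
    show "(\<lambda>z. G z * H z) \<in> N" if G: "G \<in> hg S" and H: "H \<in> N" for G H
    proof -
      obtain c d where cd: "c \<in> M" "d \<in> hg S" "\<forall>\<^sub>F z in near S. H z = c z + d z * F z"
        using H by (auto simp: N_def)
      have "\<forall>\<^sub>F z in near S. G z * H z = G z * c z + (G z * d z) * F z"
        using cd(3) by eventually_elim (simp add: algebra_simps)
      moreover have "(\<lambda>z. G z * H z) \<in> hg S" using G H by (auto simp: N_def intro: hg_mult)
      ultimately show ?thesis
        unfolding N_def mem_Collect_eq using hg_ideal_mult[OF M G cd(1)] hg_mult[OF G cd(2)]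
        by (intro conjI bexI[of _ "\<lambda>z. G z * c z"] bexI[of _ "\<lambda>z. G z * d z"])
    qed
    show "H \<in> N" if G: "G \<in> N" and H: "H \<in> hg S" and ev: "\<forall>\<^sub>F z in near S. G z = H z" for G H
    proof -
      obtain a b where ab: "a \<in> M" "b \<in> hg S" "\<forall>\<^sub>F z in near S. G z = a z + b z * F z"
        using G by (auto simp: N_def)
      have "\<forall>\<^sub>F z in near S. H z = a z + b z * F z"
        using ab(3) ev by eventually_elim simp
      then show ?thesis unfolding N_def using ab(1,2) H by blast
    qed
  qed
qed

text \<open>An ideal \<open>M\<close> maximal among those that contain \<open>J\<close> and avoid
  all powers of \<open>h\<close> is prime: if neither \<open>F\<close> nor \<open>G\<close> is in
  \<open>M\<close>, some powers of \<open>h\<close> have the form \<open>a + b F\<close> and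
  \<open>c + d G\<close>, and their product lies in \<open>M\<close> as soon as \<open>F G\<close>
  does.\<close>

lemma hg_prime_exists:
  assumes J: "hg_ideal S J" and h: "h \<in> hg S" and notin: "\<And>k. (\<lambda>z. h z ^ k) \<notin> J"
  shows "\<exists>P. hg_prime S P \<and> J \<subseteq> P \<and> h \<notin> P"
proof -
  define A where "A = {P. hg_ideal S P \<and> J \<subseteq> P \<and> (\<forall>k. (\<lambda>z. h z ^ k) \<notin> P)}"
  have "\<exists>M\<in>A. \<forall>V\<in>A. M \<subseteq> V \<longrightarrow> V = M"
  proof (rule subset_Zorn_nonempty)
    show "A \<noteq> {}" using J notin by (auto simp: A_def)
    fix C assume C: "C \<noteq> {}" "subset.chain A C"
    then have sub: "C \<subseteq> A" by (auto simp: subset.chain_def)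
    have "hg_ideal S (\<Union>C)" by (rule hg_ideal_Union_chain[OF C]) (simp add: A_def)
    moreover have "J \<subseteq> \<Union>C" using C(1) sub by (auto simp: A_def)
    moreover have "(\<lambda>z. h z ^ k) \<notin> \<Union>C" for k using sub by (auto simp: A_def)
    ultimately show "\<Union>C \<in> A" by (simp add: A_def)
  qed
  then obtain M where M: "M \<in> A" and max: "\<And>V. V \<in> A \<Longrightarrow> M \<subseteq> V \<Longrightarrow> V = M" by blast
  have I: "hg_ideal S M" and JM: "J \<subseteq> M" and pow: "\<And>k. (\<lambda>z. h z ^ k) \<notin> M"
    using M by (auto simp: A_def)
  have reach: "\<exists>k. \<exists>a\<in>M. \<exists>b\<in>hg S. \<forall>\<^sub>F z in near S. h z ^ k = a z + b z * F z"
    if F: "F \<in> hg S" "F \<notin> M" for F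
  proof -
    note adj = hg_ideal_adjoin[OF I F(1)]
    have "{H \<in> hg S. \<exists>a\<in>M. \<exists>b\<in>hg S. \<forall>\<^sub>F z in near S. H z = a z + b z * F z} \<notin> A"
      using max[OF _ adj(2)] adj(3) F(2) by blast
    then obtain k where "(\<lambda>z. h z ^ k) \<in> {H \<in> hg S. \<exists>a\<in>M. \<exists>b\<in>hg S. \<forall>\<^sub>F z in near S. H z = a z + b z * F z}"
      unfolding A_def using adj(1,2) JM by blast
    then show ?thesis by blast
  qed
  have "hg_prime S M"
    unfolding hg_prime_def
  proof (intro conjI ballI impI)
    show "hg_ideal S M" by (rule I)
    show "(\<lambda>_. 1) \<notin> M" using pow[of 0] by simp
    fix F G assume F: "F \<in> hg S" and G: "G \<in> hg S" and FG: "(\<lambda>z. F z * G z) \<in> M"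
    show "F \<in> M \<or> G \<in> M"
    proof (rule ccontr)
      assume "\<not> ?thesis"
      then obtain k a b l c d where ab: "a \<in> M" "b \<in> hg S" "\<forall>\<^sub>F z in near S. h z ^ k = a z + b z * F z"
        and cd: "c \<in> M" "d \<in> hg S" "\<forall>\<^sub>F z in near S. h z ^ l = c z + d z * G z"
        using reach[OF F] reach[OF G] by blast
      have ahg: "a \<in> hg S" "c \<in> hg S" using hg_ideal_sub[OF I] ab(1) cd(1) by auto
      have "(\<lambda>z. (c z + d z * G z) * a z + (b z * F z) * c z + (b z * d z) * (F z * G z)) \<in> M"
        by (intro hg_ideal_add[OF I] hg_ideal_mult[OF I] ab cd FG hg_add hg_mult F G ahg)
      moreover have "\<forall>\<^sub>F z in near S. (c z + d z * G z) * a z + (b z * F z) * c z + (b z * d z) * (F z * G z) = h z ^ (k + l)"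
        using ab(3) cd(3) by eventually_elim (simp add: power_add algebra_simps)
      ultimately have "(\<lambda>z. h z ^ (k + l)) \<in> M"
        by (rule hg_ideal_cong[OF I _ hg_power[OF h]])
      with pow show False ..
    qed
  qed
  moreover have "h \<notin> M" using pow[of 1] by simp
  ultimately show ?thesis using JM by blast
qed

section \<open>Finitely generated ideals and expansions along their powers\<close>

definition hg_span :: "'i set \<Rightarrow> 'j set \<Rightarrow> ('j \<Rightarrow> ('i \<Rightarrow> complex) \<Rightarrow> complex) \<Rightarrow> (('i \<Rightarrow> complex) \<Rightarrow> complex) set"
  where "hg_span S Y g =
    {H \<in> hg S. \<exists>A. (\<forall>j\<in>Y. A j \<in> hg S) \<and> (\<forall>\<^sub>F z in near S. H z = (\<Sum>j\<in>Y. A j z * g j z))}"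

lemma hg_ideal_span:
  assumes g: "\<And>j. j \<in> Y \<Longrightarrow> g j \<in> hg S" and fin: "finite Y"
  shows "hg_ideal S (hg_span S Y g)" "\<And>j. j \<in> Y \<Longrightarrow> g j \<in> hg_span S Y g"
proof -
  let ?J = "hg_span S Y g"
  note J_def = hg_span_def
  show "g j \<in> ?J" if j: "j \<in> Y" for j
  proof -
    have "(\<Sum>i\<in>Y. (if i = j then 1 else 0) * g i z) = g j z" for z
      using fin j by (simp add: if_distrib[of "\<lambda>x. x * _"] cong: if_cong)
    then have "\<forall>\<^sub>F z in near S. g j z = (\<Sum>i\<in>Y. (\<lambda>_. if i = j then 1 else 0) z * g i z)" by simp
    then show ?thesis
      unfolding J_def using g[OF j] hg_const
      by (intro CollectI conjI exI[of _ "\<lambda>i _. if i = j then 1 else 0"]) auto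
  qed
  show "hg_ideal S ?J"
    unfolding hg_ideal_def
  proof (intro conjI ballI impI)
    show "?J \<subseteq> hg S" by (auto simp: J_def)
    show "(\<lambda>_. 0) \<in> ?J"
      unfolding J_def by (intro CollectI conjI exI[of _ "\<lambda>_ _. 0"]) (auto intro: hg_const)
    show "(\<lambda>z. G z + H z) \<in> ?J" if G: "G \<in> ?J" and H: "H \<in> ?J" for G H
    proof -
      obtain a where a: "\<forall>j\<in>Y. a j \<in> hg S" "\<forall>\<^sub>F z in near S. G z = (\<Sum>j\<in>Y. a j z * g j z)"
        using G by (auto simp: J_def)
      obtain b where b: "\<forall>j\<in>Y. b j \<in> hg S" "\<forall>\<^sub>F z in near S. H z = (\<Sum>j\<in>Y. b j z * g j z)"
        using H by (auto simp: J_def)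
      have "\<forall>\<^sub>F z in near S. G z + H z = (\<Sum>j\<in>Y. (a j z + b j z) * g j z)"
        using a(2) b(2) by eventually_elim (simp add: distrib_right sum.distrib)
      with G H a(1) b(1) show ?thesis
        unfolding J_def by (intro CollectI conjI exI[of _ "\<lambda>j z. a j z + b j z"]) (auto intro: hg_add)
    qed
    show "(\<lambda>z. G z * H z) \<in> ?J" if G: "G \<in> hg S" and H: "H \<in> ?J" for G H
    proof -
      obtain b where b: "\<forall>j\<in>Y. b j \<in> hg S" "\<forall>\<^sub>F z in near S. H z = (\<Sum>j\<in>Y. b j z * g j z)"
        using H by (auto simp: J_def)
      have "\<forall>\<^sub>F z in near S. G z * H z = (\<Sum>j\<in>Y. (G z * b j z) * g j z)"
        using b(2) by eventually_elim (simp add: sum_distrib_left mult.assoc)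
      with G H b(1) show ?thesis
        unfolding J_def by (intro CollectI conjI exI[of _ "\<lambda>j z. G z * b j z"]) (auto intro: hg_mult)
    qed
    show "H \<in> ?J" if G: "G \<in> ?J" and H: "H \<in> hg S" and ev: "\<forall>\<^sub>F z in near S. G z = H z" for G H
    proof -
      obtain a where a: "\<forall>j\<in>Y. a j \<in> hg S" "\<forall>\<^sub>F z in near S. G z = (\<Sum>j\<in>Y. a j z * g j z)"
        using G by (auto simp: J_def)
      have "\<forall>\<^sub>F z in near S. H z = (\<Sum>j\<in>Y. a j z * g j z)" using a(2) ev by eventually_elim simp
      then show ?thesis unfolding J_def using a(1) H by blast
    qed
  qed
qed

text \<open>Elements of the \<open>m\<close>-th power of the ideal of \<open>hg V\<close> generated by \<open>F j\<close>, \<open>j \<in> Y\<close>. The generators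
  are indexed by variables, since \<open>Y\<close> will also provide the new variables of the larger ring
  \<open>hg (V \<union> Y)\<close>.\<close>

fun ipow :: "'i set \<Rightarrow> 'i set \<Rightarrow> ('i \<Rightarrow> ('i \<Rightarrow> complex) \<Rightarrow> complex) \<Rightarrow> nat \<Rightarrow> (('i \<Rightarrow> complex) \<Rightarrow> complex) set"
  where
    "ipow V Y F 0 = hg V"
  | "ipow V Y F (Suc m) = {e \<in> hg V. \<exists>a. (\<forall>j\<in>Y. a j \<in> ipow V Y F m) \<and> (\<forall>\<^sub>F z in near V. e z = (\<Sum>j\<in>Y. F j z * a j z))}"

lemma ipow_hg: "e \<in> ipow V Y F m \<Longrightarrow> e \<in> hg V"
  by (cases m) auto

text \<open>Hadamard's lemma, by \<open>dq_eq\<close> for the variables of \<open>T\<close> one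
  after another. The \<open>G j\<close> may still depend on variables of \<open>T\<close>.\<close>

lemma hg_hadamard:
  assumes "finite T" "T \<subseteq> S" "A \<in> hg S"
  shows "\<exists>G. (\<forall>j\<in>T. G j \<in> hg S) \<and> (\<lambda>z. A (\<lambda>i. if i \<in> T then 0 else z i)) \<in> hg (S - T) \<and>
    (\<forall>z. A z = A (\<lambda>i. if i \<in> T then 0 else z i) + (\<Sum>j\<in>T. z j * G j z))"
  using assms
proof (induction T arbitrary: S A)
  case (insert j T)
  define A1 where "A1 z = A (z(j := 0))" for z
  have "A1 \<in> hg (S - {j})" unfolding A1_def by (rule hg_upd0[OF insert.prems(2)])
  from insert.IH[OF _ this] insert.prems(1) insert.hyps(2)
  obtain G where G: "\<forall>i\<in>T. G i \<in> hg (S - {j})" "(\<lambda>z. A1 (\<lambda>i. if i \<in> T then 0 else z i)) \<in> hg (S - {j} - T)"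
    "\<forall>z. A1 z = A1 (\<lambda>i. if i \<in> T then 0 else z i) + (\<Sum>i\<in>T. z i * G i z)" by blast
  have A1: "A1 (\<lambda>i. if i \<in> T then 0 else z i) = A (\<lambda>i. if i \<in> insert j T then 0 else z i)" for z
    unfolding A1_def by (rule arg_cong[of _ _ A]) auto
  have "S - {j} - T = S - insert j T" by auto
  with G(2) have 2: "(\<lambda>z. A (\<lambda>i. if i \<in> insert j T then 0 else z i)) \<in> hg (S - insert j T)"
    by (simp only: A1)
  have 3: "A z = A (\<lambda>i. if i \<in> insert j T then 0 else z i) + (\<Sum>i\<in>insert j T. z i * (G(j := dq j A)) i z)" for z
  proof -
    have "A z = A1 z + z j * dq j A z" unfolding A1_def by (rule dq_eq)
    also have "A1 z = A (\<lambda>i. if i \<in> insert j T then 0 else z i) + (\<Sum>i\<in>T. z i * G i z)"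
      using G(3) A1 by metis
    also have "(\<Sum>i\<in>T. z i * G i z) = (\<Sum>i\<in>T. z i * (G(j := dq j A)) i z)"
      using insert.hyps by (intro sum.cong) auto
    finally show ?thesis using insert.hyps by simp
  qed
  have "(G(j := dq j A)) i \<in> hg S" if "i \<in> insert j T" for i
    using that G(1) hg_dq[OF insert.prems(2), of j] insert.prems(1) by (auto intro: hg_mono)
  with 2 3 show ?case by blast
qed simp

text \<open>The substitution \<open>y_j = \<tau> F_j(x)\<close>; the exponent of the scalar
  \<open>\<tau>\<close> counts the factors \<open>F_j\<close>.\<close>

definition scale_sub :: "'i set \<Rightarrow> ('i \<Rightarrow> ('i \<Rightarrow> complex) \<Rightarrow> complex) \<Rightarrow> ('i \<Rightarrow> complex) \<Rightarrow> complex \<Rightarrow> 'i \<Rightarrow> complex"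
  where "scale_sub Y F z \<tau> = (\<lambda>i. if i \<in> Y then \<tau> * F i z else z i)"

text \<open>As the \<open>F j\<close> vanish at the origin, one neighbourhood of \<open>x\<close>
  serves all \<open>\<tau>\<close> in the closed unit disc.\<close>

lemma eventually_scale_sub:
  assumes "finite V" "finite Y" "\<And>j. j \<in> Y \<Longrightarrow> F j \<in> hg V" "\<And>j. j \<in> Y \<Longrightarrow> F j (\<lambda>_. 0) = 0"
    and "eventually Q (near (V \<union> Y))"
  shows "\<forall>\<^sub>F z in near V. \<forall>\<tau>. norm \<tau> \<le> 1 \<longrightarrow> Q (scale_sub Y F z \<tau>)"
proof -
  obtain r where r: "\<And>j. 0 < r j" "\<And>z. z \<in> polydisc (V \<union> Y) r \<Longrightarrow> Q z"
    using assms(5) unfolding eventually_near by auto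
  have "\<forall>\<^sub>F z in near V. \<forall>j\<in>Y. norm (F j z) < r j"
  proof (intro eventually_ball_finite ballI assms(2))
    fix j assume "j \<in> Y"
    with hg_tendsto_0[OF assms(1,3) r(1), of j j] assms(4)
    show "\<forall>\<^sub>F z in near V. norm (F j z) < r j" by simp
  qed
  moreover have "\<forall>\<^sub>F z in near V. z \<in> polydisc V r" using r(1) by (rule eventually_near_polydisc)
  ultimately show ?thesis
  proof eventually_elim
    case (elim z)
    show ?case
    proof (intro allI impI r(2))
      fix \<tau> :: complex assume \<tau>: "norm \<tau> \<le> 1"
      have "norm (\<tau> * F j z) < r j" if "j \<in> Y" for j
      proof -
        have "norm (\<tau> * F j z) \<le> 1 * norm (F j z)"
          unfolding norm_mult using \<tau> by (intro mult_right_mono) auto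
        then show ?thesis using elim(1) that by force
      qed
      then show "scale_sub Y F z \<tau> \<in> polydisc (V \<union> Y) r"
        using elim(2) by (auto simp: polydisc_def scale_sub_def)
    qed
  qed
qed

text \<open>Hadamard's lemma splits \<open>A\<close> into \<open>A(x, 0)\<close> and the sum of the
  \<open>y_j G_j\<close>. Under the substitution each \<open>y_j\<close> supplies one
  \<open>\<tau>\<close> and one \<open>F_j\<close>, and the \<open>G_j\<close> are expanded in turn.
  The remainder is only bounded, which is all that comparing coefficients requires.\<close>

lemma ipow_expansion:
  assumes fin: "finite V" "finite Y" and disj: "V \<inter> Y = {}"
    and F: "\<And>j. j \<in> Y \<Longrightarrow> F j \<in> hg V" "\<And>j. j \<in> Y \<Longrightarrow> F j (\<lambda>_. 0) = 0"
    and A: "A \<in> hg (V \<union> Y)"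
  shows "\<exists>e B. (\<forall>l<m. e l \<in> ipow V Y F l) \<and> (\<forall>\<^sub>F z in near V. \<forall>\<tau>. norm \<tau> \<le> 1 \<longrightarrow>
    norm (A (scale_sub Y F z \<tau>) - (\<Sum>l<m. e l z * \<tau> ^ l)) \<le> B * norm \<tau> ^ m)"
  using A
proof (induction m arbitrary: A)
  case 0
  obtain r B where r: "\<And>j. 0 < r j" and B: "bhol (V \<union> Y) r B A"
    by (rule hgE[OF 0]) (rule that; blast)
  have "\<forall>\<^sub>F z in near (V \<union> Y). norm (A z) \<le> B"
    using eventually_near_polydisc[OF r] by eventually_elim (rule bhol_bound[OF B])
  from eventually_scale_sub[where F = F, OF fin F this] show ?case by auto
next
  case (Suc m)
  obtain G where G: "\<forall>j\<in>Y. G j \<in> hg (V \<union> Y)" "(\<lambda>z. A (\<lambda>i. if i \<in> Y then 0 else z i)) \<in> hg (V \<union> Y - Y)"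
    "\<forall>z. A z = A (\<lambda>i. if i \<in> Y then 0 else z i) + (\<Sum>j\<in>Y. z j * G j z)"
    using hg_hadamard[OF fin(2) Un_upper2 Suc.prems] by blast
  have XY: "V \<union> Y - Y = V" using disj by auto
  have "\<forall>j\<in>Y. \<exists>e B. (\<forall>l<m. e l \<in> ipow V Y F l) \<and> (\<forall>\<^sub>F z in near V. \<forall>\<tau>. norm \<tau> \<le> 1 \<longrightarrow>
    norm (G j (scale_sub Y F z \<tau>) - (\<Sum>l<m. e l z * \<tau> ^ l)) \<le> B * norm \<tau> ^ m)"
    using Suc.IH G(1) by blast
  then obtain e B where e: "\<And>j l. j \<in> Y \<Longrightarrow> l < m \<Longrightarrow> e j l \<in> ipow V Y F l"
    and ev: "\<And>j. j \<in> Y \<Longrightarrow> \<forall>\<^sub>F z in near V. \<forall>\<tau>. norm \<tau> \<le> 1 \<longrightarrow>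
    norm (G j (scale_sub Y F z \<tau>) - (\<Sum>l<m. e j l z * \<tau> ^ l)) \<le> B j * norm \<tau> ^ m"
    unfolding bchoice_iff by blast
  define E where "E l z = (case l of 0 \<Rightarrow> A (\<lambda>i. if i \<in> Y then 0 else z i) | Suc l \<Rightarrow> \<Sum>j\<in>Y. F j z * e j l z)" for l z
  have E: "E l \<in> ipow V Y F l" if l: "l < Suc m" for l
  proof (cases l)
    case 0
    then have "E l = (\<lambda>z. A (\<lambda>i. if i \<in> Y then 0 else z i))" by (intro ext) (simp add: E_def)
    with G(2) XY 0 show ?thesis by simp
  next
    case (Suc l')
    then have El: "E l = (\<lambda>z. \<Sum>j\<in>Y. F j z * e j l' z)" by (intro ext) (simp add: E_def)
    have l': "l' < m" using l Suc by simp
    have "E l \<in> hg V"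
      unfolding El using e l Suc by (intro hg_sum hg_mult F(1) ipow_hg[of _ V Y F l']) auto
    moreover have "\<forall>\<^sub>F z in near V. E l z = (\<Sum>j\<in>Y. F j z * e j l' z)" by (simp add: El)
    ultimately have "E l \<in> ipow V Y F (Suc l')" using e[OF _ l'] by (auto intro!: exI[of _ "\<lambda>j. e j l'"])
    then show ?thesis by (simp only: Suc)
  qed
  have "\<forall>\<^sub>F z in near V. \<forall>j\<in>Y. \<forall>\<tau>. norm \<tau> \<le> 1 \<longrightarrow>
    norm (G j (scale_sub Y F z \<tau>) - (\<Sum>l<m. e j l z * \<tau> ^ l)) \<le> B j * norm \<tau> ^ m"
    by (intro eventually_ball_finite ballI fin ev)
  \<comment> \<open>Absorbs the factor \<open>F j z\<close> into the constant of the error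
    term.\<close>
  moreover have "\<forall>\<^sub>F z in near V. \<forall>j\<in>Y. norm (F j z) < 1"
  proof (intro eventually_ball_finite ballI fin)
    fix j assume "j \<in> Y"
    with hg_tendsto_0[of V "F j" 1] fin(1) F
    show "\<forall>\<^sub>F z in near V. norm (F j z) < 1" by simp
  qed
  ultimately have "\<forall>\<^sub>F z in near V. \<forall>\<tau>. norm \<tau> \<le> 1 \<longrightarrow>
    norm (A (scale_sub Y F z \<tau>) - (\<Sum>l<Suc m. E l z * \<tau> ^ l)) \<le> (\<Sum>j\<in>Y. \<bar>B j\<bar>) * norm \<tau> ^ Suc m"
  proof eventually_elim
    case (elim z)
    show ?case
    proof (intro allI impI)
      fix \<tau> :: complex assume \<tau>: "norm \<tau> \<le> 1"
      define s where "s = scale_sub Y F z \<tau>"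
      have s0: "(\<lambda>i. if i \<in> Y then 0 else s i) = (\<lambda>i. if i \<in> Y then 0 else z i)"
        by (auto simp: s_def scale_sub_def)
      have "A s = E 0 z + (\<Sum>j\<in>Y. \<tau> * F j z * G j s)"
      proof -
        have "(\<Sum>j\<in>Y. s j * G j s) = (\<Sum>j\<in>Y. \<tau> * F j z * G j s)"
          by (intro sum.cong) (auto simp: s_def scale_sub_def)
        then show ?thesis using G(3)[rule_format, of s] by (simp add: s0 E_def)
      qed
      moreover have "(\<Sum>l<Suc m. E l z * \<tau> ^ l) = E 0 z + (\<Sum>j\<in>Y. \<tau> * F j z * (\<Sum>l<m. e j l z * \<tau> ^ l))"
      proof -
        have "(\<Sum>l<Suc m. E l z * \<tau> ^ l) = E 0 z + (\<Sum>l<m. (\<Sum>j\<in>Y. F j z * e j l z) * \<tau> ^ Suc l)"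
          by (simp add: sum.lessThan_Suc_shift E_def del: sum.lessThan_Suc)
        also have "(\<Sum>l<m. (\<Sum>j\<in>Y. F j z * e j l z) * \<tau> ^ Suc l) = (\<Sum>l<m. \<Sum>j\<in>Y. \<tau> * F j z * (e j l z * \<tau> ^ l))"
          by (simp add: sum_distrib_left sum_distrib_right mult_ac)
        also have "\<dots> = (\<Sum>j\<in>Y. \<tau> * F j z * (\<Sum>l<m. e j l z * \<tau> ^ l))"
          by (subst sum.swap) (simp add: sum_distrib_left)
        finally show ?thesis .
      qed
      ultimately have "A s - (\<Sum>l<Suc m. E l z * \<tau> ^ l) = (\<Sum>j\<in>Y. \<tau> * F j z * (G j s - (\<Sum>l<m. e j l z * \<tau> ^ l)))"
        by (simp add: right_diff_distrib sum_subtractf)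
      also have "norm \<dots> \<le> (\<Sum>j\<in>Y. norm (\<tau> * F j z * (G j s - (\<Sum>l<m. e j l z * \<tau> ^ l))))"
        by (rule norm_sum)
      also have "\<dots> \<le> (\<Sum>j\<in>Y. \<bar>B j\<bar> * norm \<tau> ^ Suc m)"
      proof (rule sum_mono)
        fix j assume j: "j \<in> Y"
        have "norm (G j s - (\<Sum>l<m. e j l z * \<tau> ^ l)) \<le> B j * norm \<tau> ^ m"
          using elim(1) j \<tau> by (simp add: s_def)
        also have "\<dots> \<le> \<bar>B j\<bar> * norm \<tau> ^ m" by (intro mult_right_mono) auto
        finally have b: "norm (G j s - (\<Sum>l<m. e j l z * \<tau> ^ l)) \<le> \<bar>B j\<bar> * norm \<tau> ^ m" .
        have "norm (\<tau> * F j z) \<le> norm \<tau> * 1"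
          unfolding norm_mult using elim(2) j by (intro mult_left_mono) (auto intro: less_imp_le)
        from mult_mono[OF this b]
        show "norm (\<tau> * F j z * (G j s - (\<Sum>l<m. e j l z * \<tau> ^ l))) \<le> \<bar>B j\<bar> * norm \<tau> ^ Suc m"
          by (simp add: norm_mult mult_ac)
      qed
      finally show "norm (A (scale_sub Y F z \<tau>) - (\<Sum>l<Suc m. E l z * \<tau> ^ l)) \<le> (\<Sum>j\<in>Y. \<bar>B j\<bar>) * norm \<tau> ^ Suc m"
        by (simp add: s_def sum_distrib_right)
    qed
  qed
  with E show ?case by blast
qed

text \<open>Since \<open>F\<^sub>j = y\<^sub>j h\<close> with all \<open>y\<^sub>j\<close> small contradicts the estimate unless \<open>h = 0\<close>, the Nullstellensatz
  gives \<open>h\<^sup>k = \<Sum>j. A\<^sub>j (F\<^sub>j - y\<^sub>j h)\<close> in \<open>hg (V \<union> Y)\<close>. Substituting \<open>y\<^sub>j = \<tau> F\<^sub>j\<close> turns this into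
  \<open>h\<^sup>k = (1 - \<tau> h) \<Phi> \<tau>\<close>, so that \<open>h\<^sup>k\<^sup>+\<^sup>m\<close> is the coefficient of \<open>\<tau>\<^sup>m\<close> in \<open>\<Phi> = \<Sum>j. F\<^sub>j A\<^sub>j\<close>, and the
  coefficient of \<open>\<tau>\<^sup>m\<close> in \<open>A\<^sub>j\<close> lies in the \<open>m\<close>-th power of the ideal.\<close>

theorem dominated_powers_in_ipow:
  assumes fin: "finite V" "finite Y" and disj: "V \<inter> Y = {}"
    and F: "\<And>j. j \<in> Y \<Longrightarrow> F j \<in> hg V" "\<And>j. j \<in> Y \<Longrightarrow> F j (\<lambda>_. 0) = 0"
    and h: "h \<in> hg V" and C: "0 < C"
    and dom: "\<forall>\<^sub>F z in near V. \<exists>j\<in>Y. norm (h z) \<le> C * norm (F j z)"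
  shows "\<exists>k. \<forall>m. (\<lambda>z. h z ^ (k + m)) \<in> ipow V Y F (Suc m)"
proof -
  define S where "S = V \<union> Y"
  have finS: "finite S" using fin by (simp add: S_def)
  have up: "G \<in> hg S" if "G \<in> hg V" for G using that by (rule hg_mono) (simp add: S_def)
  define g where "g j z = F j z - z j * h z" for j z
  have g: "g j \<in> hg S" if "j \<in> Y" for j
    unfolding g_def using that by (intro hg_diff hg_mult hg_coord up F h) (auto simp: S_def)
  note span = hg_ideal_span[of Y g S, OF g fin(2)]
  have "\<exists>k. (\<lambda>z. h z ^ k) \<in> hg_span S Y g"
  proof (rule ccontr)
    assume "\<not> ?thesis"
    with hg_prime_exists[OF span(1) up[OF h]] obtain P where P: "hg_prime S P" "h \<notin> P" "hg_span S Y g \<subseteq> P" by blast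
    have fr: "\<exists>\<^sub>F z in near S. (\<forall>p\<in>g ` Y. p z = 0) \<and> h z \<noteq> 0"
      using span(2) P(3) by (intro nullstellensatz[OF finS P(1) up[OF h] P(2)] finite_imageI fin) blast
    have "\<forall>\<^sub>F z in near S. \<exists>j\<in>Y. norm (h z) \<le> C * norm (F j z)"
      by (rule eventually_near_mono[OF _ dom]) (simp add: S_def)
    moreover have "\<forall>\<^sub>F z in near S. z \<in> polydisc S (\<lambda>_. 1 / C)"
      using C by (intro eventually_near_polydisc) simp
    ultimately have "\<forall>\<^sub>F z in near S. (\<exists>j\<in>Y. norm (h z) \<le> C * norm (F j z)) \<and> z \<in> polydisc S (\<lambda>_. 1 / C)"
      by (rule eventually_conj)
    from frequently_ex[OF frequently_eventually_frequently[OF fr this]] obtain z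
      where g0: "\<forall>p\<in>g ` Y. p z = 0" and z: "h z \<noteq> 0" "z \<in> polydisc S (\<lambda>_. 1 / C)"
        and "\<exists>j\<in>Y. norm (h z) \<le> C * norm (F j z)"
      by blast
    then obtain j where j: "j \<in> Y" "norm (h z) \<le> C * norm (F j z)" by blast
    have Fj: "F j z = z j * h z" using g0 j(1) by (simp add: g_def)
    have "norm (z j) < 1 / C" using z(2) j(1) by (auto simp: polydisc_def S_def)
    then have "C * norm (z j) < 1" using C by (simp add: field_simps)
    then have "C * norm (z j) * norm (h z) < 1 * norm (h z)"
      using z(1) by (intro mult_strict_right_mono) auto
    with j Fj show False by (simp add: norm_mult mult.assoc)
  qed
  then obtain k A where A: "\<And>j. j \<in> Y \<Longrightarrow> A j \<in> hg S"
    and evA: "\<forall>\<^sub>F z in near S. h z ^ k = (\<Sum>j\<in>Y. A j z * g j z)" by (auto simp: hg_span_def)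
  have "(\<lambda>z. h z ^ (k + m)) \<in> ipow V Y F (Suc m)" for m
  proof -
    have "\<forall>j\<in>Y. \<exists>e B. (\<forall>l<Suc m. e l \<in> ipow V Y F l) \<and> (\<forall>\<^sub>F z in near V. \<forall>\<tau>. norm \<tau> \<le> 1 \<longrightarrow>
      norm (A j (scale_sub Y F z \<tau>) - (\<Sum>l<Suc m. e l z * \<tau> ^ l)) \<le> B * norm \<tau> ^ Suc m)"
      using ipow_expansion[where F = F, OF fin disj F] A unfolding S_def by blast
    then obtain e B where e: "\<And>j l. j \<in> Y \<Longrightarrow> l < Suc m \<Longrightarrow> e j l \<in> ipow V Y F l"
      and ev: "\<And>j. j \<in> Y \<Longrightarrow> \<forall>\<^sub>F z in near V. \<forall>\<tau>. norm \<tau> \<le> 1 \<longrightarrow>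
        norm (A j (scale_sub Y F z \<tau>) - (\<Sum>l<Suc m. e j l z * \<tau> ^ l)) \<le> B j * norm \<tau> ^ Suc m"
      unfolding bchoice_iff by blast
    have "\<forall>\<^sub>F z in near V. \<forall>j\<in>Y. \<forall>\<tau>. norm \<tau> \<le> 1 \<longrightarrow>
        norm (A j (scale_sub Y F z \<tau>) - (\<Sum>l<Suc m. e j l z * \<tau> ^ l)) \<le> B j * norm \<tau> ^ Suc m"
      by (intro eventually_ball_finite ballI fin ev)
    moreover have "\<forall>\<^sub>F z in near V. \<forall>\<tau>. norm \<tau> \<le> 1 \<longrightarrow> h (scale_sub Y F z \<tau>) ^ k =
        (\<Sum>j\<in>Y. A j (scale_sub Y F z \<tau>) * g j (scale_sub Y F z \<tau>))"
      by (rule eventually_scale_sub[OF fin]) (use F evA in \<open>auto simp: S_def\<close>)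
    \<comment> \<open>The factor \<open>F j\<close> in front stems from \<open>g j\<close>, which
      becomes \<open>F j * (1 - \<tau> * h)\<close> after the substitution; it lifts the power of
      the ideal from \<open>m\<close> to \<open>Suc m\<close>.\<close>
    ultimately have "\<forall>\<^sub>F z in near V. h z ^ (k + m) = (\<Sum>j\<in>Y. F j z * e j m z)"
    proof eventually_elim
      case (elim z)
      define E where "E l = (\<Sum>j\<in>Y. F j z * e j l z)" for l
      define \<Phi> where "\<Phi> \<tau> = (\<Sum>j\<in>Y. F j z * A j (scale_sub Y F z \<tau>))" for \<tau>
      define K where "K = (\<Sum>j\<in>Y. norm (F j z) * B j)"
      \<comment> \<open>\<open>K\<close> accounts for the expansion of \<open>\<Phi>\<close>, the
        rest for the tail of the geometric sum. A constant depending on \<open>z\<close> is good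
        enough, as the coefficients are compared for each \<open>z\<close> separately.\<close>
      define L where "L = K + norm (h z) ^ Suc m * ((\<Sum>l<Suc m. norm (E l)) + \<bar>K\<bar>)"
      have dep: "G (scale_sub Y F z \<tau>) = G z" if "G \<in> hg V" for G \<tau>
        by (rule hg_cong[OF that]) (use disj in \<open>auto simp: scale_sub_def\<close>)
      have eq: "h z ^ k = (1 - \<tau> * h z) * \<Phi> \<tau>" if \<tau>: "norm \<tau> \<le> 1" for \<tau>
      proof -
        have "h z ^ k = (\<Sum>j\<in>Y. A j (scale_sub Y F z \<tau>) * g j (scale_sub Y F z \<tau>))"
          using elim(2) \<tau> dep[OF h, of \<tau>] by metis
        also have "\<dots> = (\<Sum>j\<in>Y. A j (scale_sub Y F z \<tau>) * (F j z - \<tau> * F j z * h z))"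
          by (intro sum.cong refl) (simp add: g_def dep h F, simp add: scale_sub_def)
        also have "\<dots> = (1 - \<tau> * h z) * \<Phi> \<tau>"
          by (simp add: \<Phi>_def sum_distrib_left algebra_simps)
        finally show ?thesis .
      qed
      have approx: "norm (\<Phi> \<tau> - (\<Sum>l<Suc m. E l * \<tau> ^ l)) \<le> K * norm \<tau> ^ Suc m" if \<tau>: "norm \<tau> \<le> 1" for \<tau>
      proof -
        have "(\<Sum>l<Suc m. E l * \<tau> ^ l) = (\<Sum>l<Suc m. \<Sum>j\<in>Y. F j z * (e j l z * \<tau> ^ l))"
          by (simp only: E_def sum_distrib_right mult.assoc)
        also have "\<dots> = (\<Sum>j\<in>Y. F j z * (\<Sum>l<Suc m. e j l z * \<tau> ^ l))"
          by (subst sum.swap) (simp only: sum_distrib_left)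
        finally have "\<Phi> \<tau> - (\<Sum>l<Suc m. E l * \<tau> ^ l)
            = (\<Sum>j\<in>Y. F j z * (A j (scale_sub Y F z \<tau>) - (\<Sum>l<Suc m. e j l z * \<tau> ^ l)))"
          by (simp only: \<Phi>_def right_diff_distrib sum_subtractf)
        also have "norm \<dots> \<le> (\<Sum>j\<in>Y. norm (F j z * (A j (scale_sub Y F z \<tau>) - (\<Sum>l<Suc m. e j l z * \<tau> ^ l))))"
          by (rule norm_sum)
        also have "\<dots> \<le> (\<Sum>j\<in>Y. norm (F j z) * (B j * norm \<tau> ^ Suc m))"
          unfolding norm_mult using elim(1) \<tau> by (intro sum_mono mult_left_mono) auto
        also have "\<dots> = K * norm \<tau> ^ Suc m" by (simp only: K_def sum_distrib_right mult.assoc)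
        finally show ?thesis .
      qed
      have bound: "norm (\<Phi> \<tau>) \<le> (\<Sum>l<Suc m. norm (E l)) + \<bar>K\<bar>" if \<tau>: "norm \<tau> \<le> 1" for \<tau>
      proof -
        have "norm (\<Sum>l<Suc m. E l * \<tau> ^ l) \<le> (\<Sum>l<Suc m. norm (E l) * 1)"
          using \<tau> by (intro order_trans[OF norm_sum] sum_mono, unfold norm_mult norm_power)
            (intro mult_left_mono power_le_one, auto)
        moreover have "K * norm \<tau> ^ Suc m \<le> \<bar>K\<bar> * 1"
          using \<tau> by (intro mult_mono power_le_one) auto
        ultimately show ?thesis
          using approx[OF \<tau>] norm_triangle_sub[of "\<Phi> \<tau>" "\<Sum>l<Suc m. E l * \<tau> ^ l"] by simp
      qed
      have "h z ^ (k + m) - E m = 0"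
      proof (rule poly_small_imp_zero[where \<delta> = 1 and m = "Suc m" and e = "\<lambda>l. h z ^ (k + l) - E l" and K = L])
        fix \<tau> :: complex assume "norm \<tau> < 1"
        then have \<tau>: "norm \<tau> \<le> 1" by simp
        have geo: "(1 - \<tau> * h z) * (\<Sum>l<Suc m. (\<tau> * h z) ^ l) = 1 - (\<tau> * h z) ^ Suc m"
          by (rule one_diff_power_eq[symmetric])
        \<comment> \<open>Multiplying \<open>h^k = (1 - \<tau> h) \<Phi>\<close> by the finite
          geometric sum gives \<open>\<Phi>\<close> up to a term with the factor
          \<open>\<tau> ^ Suc m\<close>, without dividing by \<open>1 - \<tau> h\<close>.\<close>
        have "(\<Sum>l<Suc m. (h z ^ (k + l) - E l) * \<tau> ^ l)
            = h z ^ k * (\<Sum>l<Suc m. (\<tau> * h z) ^ l) - (\<Sum>l<Suc m. E l * \<tau> ^ l)"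
          by (simp only: left_diff_distrib sum_subtractf sum_distrib_left power_add power_mult_distrib)
             (simp only: mult_ac)
        also have "h z ^ k * (\<Sum>l<Suc m. (\<tau> * h z) ^ l) = (1 - (\<tau> * h z) ^ Suc m) * \<Phi> \<tau>"
          unfolding eq[OF \<tau>] geo[symmetric] by (simp only: mult_ac)
        also have "\<dots> - (\<Sum>l<Suc m. E l * \<tau> ^ l)
            = (\<Phi> \<tau> - (\<Sum>l<Suc m. E l * \<tau> ^ l)) + (- ((\<tau> * h z) ^ Suc m * \<Phi> \<tau>))"
          by (simp only: left_diff_distrib mult_1_left) (simp only: diff_conv_add_uminus add_ac)
        also have "norm \<dots> \<le> K * norm \<tau> ^ Suc m
            + norm \<tau> ^ Suc m * norm (h z) ^ Suc m * ((\<Sum>l<Suc m. norm (E l)) + \<bar>K\<bar>)"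
          using approx[OF \<tau>] bound[OF \<tau>]
          by (intro norm_triangle_mono, simp only:, unfold norm_minus_cancel norm_mult norm_power power_mult_distrib)
             (intro mult_left_mono, auto)
        also have "\<dots> = L * norm \<tau> ^ Suc m" unfolding L_def by (simp only: distrib_left distrib_right mult_ac)
        finally show "norm (\<Sum>l<Suc m. (h z ^ (k + l) - E l) * \<tau> ^ l) \<le> L * norm \<tau> ^ Suc m" .
      qed auto
      then show ?case by (simp add: E_def)
    qed
    moreover have "(\<lambda>z. h z ^ (k + m)) \<in> hg V" by (rule hg_power[OF h])
    ultimately show ?thesis using e[of _ m] by (auto intro!: exI[of _ "\<lambda>j. e j m"])
  qed
  then show ?thesis by blast
qed

section \<open>Passage to germs\<close>

text \<open>\<open>Inl\<close> indexes the coordinates of the germs, \<open>Inr\<close> the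
  variables to be adjoined; the former are read off here, and \<open>pad_coords\<close> sets the
  latter to zero.\<close>

definition coords :: "('d + 'e \<Rightarrow> complex) \<Rightarrow> complex ^ 'd"
  where "coords z = vec_lambda (\<lambda>j. z (Inl j))"

definition pad_coords :: "complex ^ 'd \<Rightarrow> 'd + 'e \<Rightarrow> complex"
  where "pad_coords x = (\<lambda>i. case i of Inl j \<Rightarrow> vec_nth x j | Inr _ \<Rightarrow> 0)"

lemma coords_pad_coords [simp]: "coords (pad_coords x) = x"
  by (simp add: coords_def pad_coords_def)

lemma coords_zero [simp]: "coords (\<lambda>_. 0) = 0"
  by (simp add: coords_def Finite_Cartesian_Product.vec_eq_iff)

lemma norm_coords_le: "norm (coords z) \<le> (\<Sum>j\<in>UNIV. norm (z (Inl j)))"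
  unfolding norm_vec_def coords_def by (rule order_trans[OF L2_set_le_sum]) auto

lemma eventually_near_coords:
  fixes Q :: "complex ^ 'd \<Rightarrow> bool"
  assumes "\<forall>\<^sub>F x in nhds 0. Q x"
  shows "\<forall>\<^sub>F z in near (range (Inl :: 'd \<Rightarrow> 'd + 'e)). Q (coords z)"
proof -
  obtain d where d: "d > 0" "\<And>x. norm x < d \<Longrightarrow> Q x"
    using assms by (auto simp: eventually_nhds_metric)
  define \<delta> where "\<delta> = d / (real CARD('d) + 1)"
  have \<delta>: "\<delta> > 0" using d(1) by (simp add: \<delta>_def add_nonneg_pos)
  have "\<forall>\<^sub>F z in near (range (Inl :: 'd \<Rightarrow> 'd + 'e)). z \<in> polydisc (range Inl) (\<lambda>_. \<delta>)"
    using \<delta> by (rule eventually_near_polydisc)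
  then show ?thesis
  proof eventually_elim
    case (elim z)
    have "norm (coords z) \<le> (\<Sum>j\<in>(UNIV :: 'd set). \<delta>)"
      using elim by (intro order_trans[OF norm_coords_le] sum_mono) (auto simp: polydisc_def intro: less_imp_le)
    also have "\<dots> = real CARD('d) * \<delta>" by simp
    also have "\<dots> < (real CARD('d) + 1) * \<delta>" using \<delta> by (intro mult_strict_right_mono) auto
    also have "\<dots> = d" by (simp add: \<delta>_def add_nonneg_eq_0_iff)
    finally show ?case by (rule d(2))
  qed
qed

lemma pad_coords_polydisc_open:
  fixes r :: "'d :: finite + 'e \<Rightarrow> real"
  shows "open {x :: complex ^ 'd. pad_coords x \<in> polydisc (range Inl) r}"
proof -
  have eq: "{x :: complex ^ 'd. pad_coords x \<in> polydisc (range Inl) r} = (\<Inter>j. (\<lambda>x. norm (vec_nth x j)) -` {..<r (Inl j)})"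
    by (auto simp: polydisc_def pad_coords_def)
  show ?thesis
    unfolding eq by (intro open_INT open_vimage ballI continuous_intros) auto
qed

lemma eventually_nhds_pad_coords:
  fixes Q :: "('d :: finite + 'e \<Rightarrow> complex) \<Rightarrow> bool"
  assumes "eventually Q (near (range Inl))"
  shows "\<forall>\<^sub>F x in nhds 0. Q (pad_coords x)"
proof -
  obtain r where r: "\<And>i. 0 < r i" "\<And>z. z \<in> polydisc (range Inl) r \<Longrightarrow> Q z"
    using assms unfolding eventually_near by auto
  have "\<forall>\<^sub>F x in nhds 0. x \<in> {x :: complex ^ 'd. pad_coords x \<in> polydisc (range Inl) r}"
    by (rule eventually_nhds_in_open[OF pad_coords_polydisc_open]) (use r(1) in \<open>auto simp: polydisc_def pad_coords_def\<close>)
  then show ?thesis by eventually_elim (use r(2) in auto)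
qed

lemma bounded_linear_axis: "bounded_linear (axis i :: complex \<Rightarrow> complex ^ 'd)"
proof -
  have "linear (axis i :: complex \<Rightarrow> complex ^ 'd)"
    by (rule linearI) (auto simp: Finite_Cartesian_Product.vec_eq_iff axis_def)
  then show ?thesis by (simp add: linear_conv_bounded_linear)
qed

lemma holomorphic_near_0_bounded:
  assumes "holomorphic_near_0 f"
  shows "\<exists>C\<ge>0. \<forall>\<^sub>F x in nhds 0. norm (f x) \<le> C"
proof -
  obtain U where U: "0 \<in> U" "holomorphic_vec_on f U"
    using assms by (auto simp: holomorphic_near_0_def)
  then obtain D where "(f has_derivative D) (at 0)" by (auto simp: holomorphic_vec_on_def)
  then have "(f \<longlongrightarrow> f 0) (at 0)" using has_derivative_continuous isContD by blast
  then have "\<forall>\<^sub>F x in nhds 0. dist (f x) (f 0) < 1"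
    using tendstoD[of f "f 0" "nhds 0" 1] by (simp add: tendsto_at_iff_tendsto_nhds)
  then have "\<forall>\<^sub>F x in nhds 0. norm (f x) \<le> norm (f 0) + 1"
  proof eventually_elim
    case (elim x)
    then show ?case using norm_triangle_ineq2[of "f x" "f 0"] by (simp add: dist_norm)
  qed
  then show ?thesis by (intro exI[of _ "norm (f 0) + 1"]) auto
qed

text \<open>A complex-linear derivative restricts to complex derivatives along the axes, and
  continuity at the origin supplies a bound on a small polydisc.\<close>

lemma holomorphic_near_0_imp_hg:
  fixes f :: "complex ^ 'd \<Rightarrow> complex"
  assumes "holomorphic_near_0 f"
  shows "(\<lambda>z. f (coords z)) \<in> hg (range (Inl :: 'd \<Rightarrow> 'd + 'e))"
proof -
  obtain U where U: "open U" "0 \<in> U" "holomorphic_vec_on f U"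
    using assms by (auto simp: holomorphic_near_0_def)
  obtain C where "\<forall>\<^sub>F x in nhds 0. norm (f x) \<le> C"
    using holomorphic_near_0_bounded[OF assms] by blast
  moreover have "\<forall>\<^sub>F x in nhds 0. x \<in> U" using U by (intro eventually_nhds_in_open)
  ultimately have "\<forall>\<^sub>F x in nhds 0. x \<in> U \<and> norm (f x) \<le> C"
    by eventually_elim blast
  from eventually_near_coords[where 'e = 'e, OF this]
  obtain r where r: "\<And>i. 0 < r i"
    "\<And>z. z \<in> polydisc (range (Inl :: 'd \<Rightarrow> 'd + 'e)) r \<Longrightarrow> coords z \<in> U \<and> norm (f (coords z)) \<le> C"
    unfolding eventually_near by auto
  show ?thesis
  proof (rule hgI[OF r(1)], rule bholI)
    show "f (coords z) = f (coords z')" if "\<And>i. i \<in> range Inl \<Longrightarrow> z i = z' i" for z z' :: "'d + 'e \<Rightarrow> complex"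
      using that by (simp add: coords_def)
    show "norm (f (coords z)) \<le> C" if "z \<in> polydisc (range (Inl :: 'd \<Rightarrow> 'd + 'e)) r" for z
      using r(2)[OF that] by blast
    show "(\<lambda>w. f (coords (z(i := w)))) holomorphic_on ball 0 (r i)"
      if z: "z \<in> polydisc (range (Inl :: 'd \<Rightarrow> 'd + 'e)) r" and i: "i \<in> range Inl" for z i
      unfolding holomorphic_on_open[OF open_ball]
    proof
      obtain j where j: "i = Inl j" using i by blast
      have upd: "coords (z(i := w)) = coords (z(i := 0)) + axis j w" for w
        by (auto simp: coords_def Finite_Cartesian_Product.vec_eq_iff axis_def j)
      fix w :: complex assume w: "w \<in> ball 0 (r i)"
      then have "coords (z(i := w)) \<in> U" using r(2) polydisc_upd[OF z, of i w] by auto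
      then obtain D where D: "(f has_derivative D) (at (coords (z(i := w))))" "\<And>c v. D (c *s v) = c * D v"
        using U(3) by (auto simp: holomorphic_vec_on_def)
      have "((\<lambda>w. coords (z(i := 0)) + axis j w) has_derivative axis j) (at w)"
        using has_derivative_add[OF has_derivative_const bounded_linear_imp_has_derivative[OF bounded_linear_axis]]
        by simp
      moreover have "(f has_derivative D) (at (coords (z(i := 0)) + axis j w))" using D(1) by (simp only: upd[of w])
      ultimately have "((\<lambda>w. f (coords (z(i := 0)) + axis j w)) has_derivative (\<lambda>h. D (axis j h))) (at w)"
        using has_derivative_compose by blast
      moreover have "(\<lambda>h. D (axis j h)) = (*) (D (axis j 1))"
      proof
        fix h :: complex
        have "axis j h = h *s axis j 1" by (auto simp: Finite_Cartesian_Product.vec_eq_iff axis_def)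
        then show "D (axis j h) = D (axis j 1) * h" by (simp add: D(2))
      qed
      moreover have "(\<lambda>w. f (coords (z(i := w)))) = (\<lambda>w. f (coords (z(i := 0)) + axis j w))"
        by (rule ext) (rule arg_cong[OF upd])
      ultimately have "((\<lambda>w. f (coords (z(i := w)))) has_field_derivative D (axis j 1)) (at w)"
        by (simp only: has_field_derivative_def)
      then show "\<exists>f'. ((\<lambda>w. f (coords (z(i := w)))) has_field_derivative f') (at w)" ..
    qed
  qed
qed

text \<open>Partial derivatives alone would not do: the second-order estimate provides the total
  derivative, which is complex linear because it is given by coefficients \<open>d\<close>.\<close>

lemma hg_imp_holomorphic_near_0:
  fixes e :: "('d :: finite + 'e \<Rightarrow> complex) \<Rightarrow> complex"
  assumes "e \<in> hg (range Inl)"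
  shows "holomorphic_near_0 (\<lambda>x. e (pad_coords x))"
proof -
  let ?V = "range (Inl :: 'd \<Rightarrow> 'd + 'e)"
  obtain r B where r: "\<And>i. 0 < r i" and B: "bhol ?V r B e"
    by (rule hgE[OF assms]) (rule that; blast)
  define U where "U = {x :: complex ^ 'd. (pad_coords x :: 'd + 'e \<Rightarrow> complex) \<in> polydisc ?V r}"
  have sumV: "(\<Sum>i\<in>?V. g i) = (\<Sum>j\<in>UNIV. g (Inl j))" for g :: "'d + 'e \<Rightarrow> 'b :: comm_monoid_add"
    by (simp add: sum.reindex)
  have "holomorphic_vec_on (\<lambda>x. e (pad_coords x)) U"
    unfolding holomorphic_vec_on_def
  proof
    fix x assume "x \<in> U"
    then have c: "pad_coords x \<in> polydisc ?V r" by (simp add: U_def)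
    obtain d K where K: "K \<ge> 0" "\<And>z. z \<in> polydisc ?V (\<lambda>i. r i - norm (pad_coords x i)) \<Longrightarrow>
      norm (e (\<lambda>i. pad_coords x i + z i) - e (pad_coords x) - (\<Sum>i\<in>?V. d i * z i)) \<le> K * (\<Sum>i\<in>?V. norm (z i))\<^sup>2"
      using bhol_second_order[OF _ B c] by auto
    define D where "D v = (\<Sum>j\<in>UNIV. d (Inl j) * vec_nth v j)" for v :: "complex ^ 'd"
    have lin: "linear D"
      by (rule linearI) (auto simp: D_def algebra_simps sum.distrib scaleR_sum_right)
    define N where "N = real CARD('d)"
    have "open {h :: complex ^ 'd. pad_coords h \<in> polydisc ?V (\<lambda>i. r i - norm (pad_coords x i))}"
      by (rule pad_coords_polydisc_open)
    moreover have "0 \<in> {h :: complex ^ 'd. pad_coords h \<in> polydisc ?V (\<lambda>i. r i - norm (pad_coords x i))}"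
      using c by (auto simp: polydisc_def pad_coords_def)
    ultimately obtain \<epsilon> where \<epsilon>: "\<epsilon> > 0"
      "\<And>h :: complex ^ 'd. norm h < \<epsilon> \<Longrightarrow> pad_coords h \<in> polydisc ?V (\<lambda>i. r i - norm (pad_coords x i))"
      unfolding open_dist by force
    have est: "norm (e (pad_coords (x + h)) - e (pad_coords x) - D h) \<le> K * (N * norm h)\<^sup>2" if h: "norm h < \<epsilon>" for h
    proof -
      have "e (\<lambda>i. pad_coords x i + pad_coords h i) = e (pad_coords (x + h))"
        by (rule arg_cong[of _ _ e]) (auto simp: pad_coords_def split: sum.splits)
      moreover have "(\<Sum>i\<in>?V. d i * pad_coords h i) = D h" by (simp add: sumV D_def pad_coords_def)
      moreover have "(\<Sum>i\<in>?V. norm (pad_coords h i)) \<le> N * norm h"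
        unfolding sumV N_def
        by (rule order_trans[OF sum_bounded_above[of UNIV _ "norm h"]]) (auto simp: pad_coords_def Finite_Cartesian_Product.norm_nth_le)
      then have "K * (\<Sum>i\<in>?V. norm (pad_coords h i))\<^sup>2 \<le> K * (N * norm h)\<^sup>2"
        by (intro mult_left_mono power_mono K(1) sum_nonneg) auto
      ultimately show ?thesis
        using K(2)[OF \<epsilon>(2)[OF h]] by simp
    qed
    have "((\<lambda>x. e (pad_coords x)) has_derivative D) (at x)"
    proof (rule has_derivativeI_sandwich[OF \<epsilon>(1), where H = "\<lambda>y. K * N\<^sup>2 * norm (y - x)"])
      show "bounded_linear D" using lin by (simp add: linear_conv_bounded_linear)
      show "norm (e (pad_coords y) - e (pad_coords x) - D (y - x)) / norm (y - x) \<le> K * N\<^sup>2 * norm (y - x)"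
        if "y \<noteq> x" "dist y x < \<epsilon>" for y
      proof -
        have "norm (y - x) < \<epsilon>" using that(2) by (simp add: dist_norm)
        from est[OF this] show ?thesis using that(1) by (simp add: divide_simps power2_eq_square mult_ac)
      qed
      have "((\<lambda>y. K * N\<^sup>2 * norm (y - x)) \<longlongrightarrow> K * N\<^sup>2 * norm (x - x)) (at x)" by (intro tendsto_intros)
      then show "((\<lambda>y. K * N\<^sup>2 * norm (y - x)) \<longlongrightarrow> 0) (at x)" by simp
    qed
    moreover have "D (c *s v) = c * D v" for c v by (simp add: D_def sum_distrib_left mult_ac)
    ultimately show "\<exists>D. ((\<lambda>x. e (pad_coords x)) has_derivative D) (at x) \<and> (\<forall>c v. D (c *s v) = c * D v)" by blast
  qed
  moreover have "open U" unfolding U_def by (rule pad_coords_polydisc_open)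
  moreover have "0 \<in> U" using r by (auto simp: U_def polydisc_def pad_coords_def)
  ultimately show ?thesis unfolding holomorphic_near_0_def by blast
qed

lemma holomorphic_near_0_power: "holomorphic_near_0 f \<Longrightarrow> holomorphic_near_0 (\<lambda>x. f x ^ n)"
  by (induction n) (auto intro: holomorphic_near_0_mult holomorphic_near_0_const)

lemma germ_eq_refl: "holomorphic_near_0 f \<Longrightarrow> germ_eq f f"
  by (simp add: germ_eq_def)

lemma germ_of_mult:
  "holomorphic_near_0 f \<Longrightarrow> holomorphic_near_0 g \<Longrightarrow> germ_of (\<lambda>x. f x * g x) = germ_of f * germ_of g"
  by (simp add: times_germ.abs_eq germ_eq_refl)

lemma germ_of_power: "holomorphic_near_0 f \<Longrightarrow> germ_of (\<lambda>x. f x ^ n) = germ_of f ^ n"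
  by (induction n) (auto simp: one_germ_def map_fun_def germ_of_mult holomorphic_near_0_power)

lemma germ_of_cong:
  assumes "holomorphic_near_0 f" "holomorphic_near_0 g" "\<forall>\<^sub>F x in nhds 0. f x = g x"
  shows "germ_of f = germ_of g"
  using Quotient_rel_abs[OF Quotient_germ, of f g] assms by (simp add: germ_eq_def)

lemma germ_of_sum:
  assumes "\<And>i. i \<in> I \<Longrightarrow> holomorphic_near_0 (f i)"
  shows "holomorphic_near_0 (\<lambda>x. \<Sum>i\<in>I. f i x) \<and> germ_of (\<lambda>x. \<Sum>i\<in>I. f i x) = (\<Sum>i\<in>I. germ_of (f i))"
  using assms
proof (induction I rule: infinite_finite_induct)
  case (insert i I)
  then show ?case
    using holomorphic_near_0_add[of "f i" "\<lambda>x. \<Sum>i\<in>I. f i x"] by (simp add: plus_germ.abs_eq[symmetric] germ_eq_refl)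
qed (auto simp: holomorphic_near_0_const zero_germ_def map_fun_def)

lemma rep_germ_holomorphic: "holomorphic_near_0 (rep_germ a)"
  using Quotient_rep_reflp[OF Quotient_germ, of a] by (simp add: germ_eq_def)

lemma germ_of_rep_germ: "germ_of (rep_germ a) = a"
  by (rule Quotient_abs_rep[OF Quotient_germ])

text \<open>A representative is determined only near the origin, so equations between germs are
  evaluated there; the lemmas below do so for each operation.\<close>

lemma rep_germ_of:
  assumes "holomorphic_near_0 f"
  shows "\<forall>\<^sub>F x in nhds 0. rep_germ (germ_of f) x = f x"
proof -
  have "germ_eq (rep_germ (germ_of f)) f"
    using Quotient_rel[OF Quotient_germ, of "rep_germ (germ_of f)" f] assms
    by (simp add: germ_of_rep_germ germ_eq_refl rep_germ_holomorphic)
  then show ?thesis by (simp add: germ_eq_def)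
qed

lemma rep_germ_mult: "\<forall>\<^sub>F x in nhds 0. rep_germ (a * b) x = rep_germ a x * rep_germ b x"
  using rep_germ_of[OF holomorphic_near_0_mult[OF rep_germ_holomorphic rep_germ_holomorphic], of a b]
  by (simp add: germ_of_mult rep_germ_holomorphic germ_of_rep_germ)

lemma rep_germ_add: "\<forall>\<^sub>F x in nhds 0. rep_germ (a + b) x = rep_germ a x + rep_germ b x"
  using rep_germ_of[OF holomorphic_near_0_add[OF rep_germ_holomorphic rep_germ_holomorphic], of a b]
  by (simp add: plus_germ.abs_eq[symmetric] germ_eq_refl rep_germ_holomorphic germ_of_rep_germ)

lemma rep_germ_power: "\<forall>\<^sub>F x in nhds 0. rep_germ (a ^ n) x = rep_germ a x ^ n"
  using rep_germ_of[OF holomorphic_near_0_power[OF rep_germ_holomorphic], of a n]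
  by (simp add: germ_of_power rep_germ_holomorphic germ_of_rep_germ)

lemma rep_germ_zero: "\<forall>\<^sub>F x in nhds 0. rep_germ 0 x = 0"
  using rep_germ_of[OF holomorphic_near_0_const[of 0]] by (simp add: zero_germ_def map_fun_def)

lemma rep_germ_sum: "finite I \<Longrightarrow> \<forall>\<^sub>F x in nhds 0. rep_germ (\<Sum>i\<in>I. a i) x = (\<Sum>i\<in>I. rep_germ (a i) x)"
proof (induction I rule: finite_induct)
  case (insert i I)
  have "\<forall>\<^sub>F x in nhds 0. rep_germ (a i + (\<Sum>i\<in>I. a i)) x = rep_germ (a i) x + rep_germ (\<Sum>i\<in>I. a i) x"
    by (rule rep_germ_add)
  with insert.IH have "\<forall>\<^sub>F x in nhds 0. rep_germ (a i + (\<Sum>i\<in>I. a i)) x = rep_germ (a i) x + (\<Sum>i\<in>I. rep_germ (a i) x)"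
    by eventually_elim simp
  then show ?case using insert.hyps by simp
qed (simp add: rep_germ_zero)

section \<open>Ideals of germs\<close>

abbreviation (input) type_ring :: "('a :: comm_ring_1) ring"
  where "type_ring \<equiv> ring_of_type_algebra"

lemma type_ring_simps [simp]:
  "carrier (type_ring :: 'a :: comm_ring_1 ring) = UNIV"
  "x \<otimes>\<^bsub>type_ring\<^esub> y = x * y" "x \<oplus>\<^bsub>type_ring\<^esub> y = x + (y :: 'a :: comm_ring_1)"
  "\<one>\<^bsub>type_ring\<^esub> = (1 :: 'a :: comm_ring_1)" "\<zero>\<^bsub>type_ring\<^esub> = (0 :: 'a :: comm_ring_1)"
  by (simp_all add: ring_of_type_algebra_def)

lemma type_ring_power: "x [^]\<^bsub>type_ring\<^esub> (n :: nat) = x ^ n" for x :: "'a :: comm_ring_1"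
proof -
  interpret cring "type_ring :: 'a ring" by (rule cring_from_type_algebra)
  show ?thesis by (induction n) (simp_all add: mult.commute)
qed

lemma type_ring_finsum: "finsum type_ring f A = sum f A" for f :: "'b \<Rightarrow> 'a :: comm_ring_1"
proof -
  interpret cring "type_ring :: 'a ring" by (rule cring_from_type_algebra)
  show ?thesis by (induction A rule: infinite_finite_induct) simp_all
qed

lemma ideal_type_ringI:
  fixes I :: "'a :: comm_ring_1 set"
  assumes "0 \<in> I" "\<And>x y. x \<in> I \<Longrightarrow> y \<in> I \<Longrightarrow> x + y \<in> I" "\<And>a x. x \<in> I \<Longrightarrow> a * x \<in> I"
  shows "ideal I type_ring"
proof -
  interpret cring "type_ring :: 'a ring" by (rule cring_from_type_algebra)
  have minus: "\<ominus>\<^bsub>type_ring\<^esub> x = - x" for x :: 'a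
    by (rule minus_equality) simp_all
  show ?thesis
  proof (rule idealI[OF ring_axioms])
    show "subgroup I (add_monoid type_ring)"
    proof
      fix x assume "x \<in> I"
      then have "- 1 * x \<in> I" by (rule assms(3))
      then show "inv\<^bsub>add_monoid type_ring\<^esub> x \<in> I" using minus[of x] by (simp add: a_inv_def)
    qed (use assms in auto)
    show "x \<otimes>\<^bsub>type_ring\<^esub> a \<in> I" if "a \<in> I" for a x using assms(3)[OF that] by simp
    show "a \<otimes>\<^bsub>type_ring\<^esub> x \<in> I" if "a \<in> I" for a x using assms(3)[OF that, of x] by (simp add: mult.commute)
  qed
qed

lemma ideal_type_ringD:
  fixes I :: "'a :: comm_ring_1 set"
  assumes "ideal I type_ring"
  shows "0 \<in> I" "\<And>x y. x \<in> I \<Longrightarrow> y \<in> I \<Longrightarrow> x + y \<in> I" "\<And>a x. x \<in> I \<Longrightarrow> a * x \<in> I"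
  using additive_subgroup.zero_closed[OF ideal.axioms(1)[OF assms]]
    additive_subgroup.a_closed[OF ideal.axioms(1)[OF assms]] ideal.I_l_closed[OF assms] by auto

lemma ideal_type_ring_sum:
  fixes I :: "'a :: comm_ring_1 set"
  assumes "ideal I type_ring" "\<And>j. j \<in> A \<Longrightarrow> f j \<in> I"
  shows "sum f A \<in> I"
  using assms(2) by (induction A rule: infinite_finite_induct) (auto intro: ideal_type_ringD[OF assms(1)])

text \<open>The unit of the monoid of ideals is the whole ring, so an exponent truncated to
  \<open>0\<close> imposes no condition.\<close>

lemma ideal_power_0: "ideal_power type_ring I 0 = (UNIV :: 'a :: comm_ring_1 set)"
  by (simp add: nat_pow_def ideals_set_def)

lemma ideal_power_Suc:
  "ideal_power type_ring I (Suc n) = ideal_prod type_ring (ideal_power type_ring I n) I"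
  for I :: "'a :: comm_ring_1 set"
  by (simp add: nat_pow_def ideals_set_def)

lemma ideal_power_ideal:
  fixes I :: "'a :: comm_ring_1 set"
  assumes "ideal I type_ring"
  shows "ideal (ideal_power type_ring I n) type_ring"
proof (induction n)
  case 0
  then show ?case unfolding ideal_power_0 by (intro ideal_type_ringI) auto
next
  case (Suc n)
  interpret cring "type_ring :: 'a ring" by (rule cring_from_type_algebra)
  show ?case unfolding ideal_power_Suc by (rule ideal_prod_is_ideal[OF Suc assms])
qed

lemma ideal_power_add:
  fixes I :: "'a :: comm_ring_1 set"
  assumes "ideal I type_ring"
  shows "ideal_power type_ring I (m + n) = ideal_prod type_ring (ideal_power type_ring I m) (ideal_power type_ring I n)"
proof -
  interpret cring "type_ring :: 'a ring" by (rule cring_from_type_algebra)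
  interpret M: comm_monoid "ideals_set (type_ring :: 'a ring)" by (rule ideals_set_is_comm_monoid)
  have "I \<in> carrier (ideals_set type_ring)" using assms by (simp add: ideals_set_def)
  from M.nat_pow_mult[OF this, of m n] show ?thesis by (simp add: ideals_set_def)
qed

lemma ideal_power_mult_in:
  fixes I :: "'a :: comm_ring_1 set"
  assumes "ideal I type_ring" "x \<in> ideal_power type_ring I m" "y \<in> ideal_power type_ring I n"
  shows "x * y \<in> ideal_power type_ring I (m + n)"
  using ideal_prod.prod[OF assms(2,3), of type_ring] by (simp add: ideal_power_add[OF assms(1)])

lemma ideal_power_antimono:
  fixes I :: "'a :: comm_ring_1 set"
  assumes "ideal I type_ring" "m \<le> n"
  shows "ideal_power type_ring I n \<subseteq> ideal_power type_ring I m"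
proof -
  interpret cring "type_ring :: 'a ring" by (rule cring_from_type_algebra)
  have "ideal_power type_ring I (m + (n - m)) \<subseteq> ideal_power type_ring I m"
    unfolding ideal_power_add[OF assms(1)]
    using ideal_prod_inter[OF ideal_power_ideal[OF assms(1)] ideal_power_ideal[OF assms(1)]] by blast
  then show ?thesis using assms(2) by simp
qed

lemma ideal_power_1:
  fixes I :: "'a :: comm_ring_1 set"
  assumes "ideal I type_ring"
  shows "ideal_power type_ring I 1 = I"
proof -
  interpret cring "type_ring :: 'a ring" by (rule cring_from_type_algebra)
  interpret M: comm_monoid "ideals_set (type_ring :: 'a ring)" by (rule ideals_set_is_comm_monoid)
  have "I \<in> carrier (ideals_set type_ring)" using assms by (simp add: ideals_set_def)
  from M.nat_pow_eone[OF this] show ?thesis by simp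
qed

lemma power_in_ideal_power:
  fixes I :: "'a :: comm_ring_1 set"
  assumes "ideal I type_ring" "x \<in> I"
  shows "x ^ n \<in> ideal_power type_ring I n"
proof (induction n)
  case (Suc n)
  have "x \<in> ideal_power type_ring I 1" using assms by (simp only: ideal_power_1)
  from ideal_power_mult_in[OF assms(1) Suc this] show ?case
    by (simp only: Suc_eq_plus1 power_add power_one_right)
qed (simp only: ideal_power_0 UNIV_I)

lemma prod_in_ideal_power:
  fixes I :: "'a :: comm_ring_1 set"
  assumes "ideal I type_ring" "finite A" "\<And>j. j \<in> A \<Longrightarrow> f j \<in> ideal_power type_ring I (b j)"
  shows "prod f A \<in> ideal_power type_ring I (sum b A)"
  using assms(2,3)
proof (induction A rule: finite_induct)
  case empty
  show ?case by (simp only: sum.empty ideal_power_0 UNIV_I)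
qed (auto intro: ideal_power_mult_in[OF assms(1)])

lemma ideal_subset_integral_closure:
  fixes I :: "'a :: comm_ring_1 set"
  assumes "ideal I type_ring"
  shows "I \<subseteq> integral_closure type_ring I"
proof
  fix x assume x: "x \<in> I"
  have "- 1 * x \<in> I" by (rule ideal_type_ringD(3)[OF assms x])
  then have "\<forall>i\<in>{1..1}. (\<lambda>_ :: nat. - x) i \<in> ideal_power type_ring I i"
    using ideal_power_1[OF assms] by simp
  then show "x \<in> integral_closure type_ring I"
    unfolding integral_closure_def
    by (intro CollectI conjI exI[of _ 1] exI[of _ "\<lambda>_. - x"])
       (auto simp: type_ring_power type_ring_finsum)
qed

lemma genideal_ideal: "ideal (genideal type_ring S) type_ring" for S :: "'a :: comm_ring_1 set"
proof -
  interpret cring "type_ring :: 'a ring" by (rule cring_from_type_algebra)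
  show ?thesis by (rule genideal_ideal) simp
qed

lemma subset_genideal: "S \<subseteq> genideal type_ring S" for S :: "'a :: comm_ring_1 set"
  by (auto simp: genideal_def)

lemma genideal_subset: "ideal J type_ring \<Longrightarrow> S \<subseteq> J \<Longrightarrow> genideal type_ring S \<subseteq> J"
  for S :: "'a :: comm_ring_1 set"
  by (auto simp: genideal_def)

text \<open>Induction on \<open>n\<close> for all \<open>J\<close>: the colon ideal of
  \<open>J\<close> by a generator \<open>G j\<close> contains the monomials of degree
  \<open>n\<close>, hence the \<open>n\<close>-th power. A second colon ideal, by an element of that
  power, leads from the generators to the ideal they generate.\<close>

lemma genideal_power_subset:
  fixes G :: "'b \<Rightarrow> 'a :: comm_ring_1"
  assumes J: "ideal J type_ring" and fin: "finite A"
    and mon: "\<And>\<alpha> :: 'b \<Rightarrow> nat. sum \<alpha> A = n \<Longrightarrow> (\<Prod>j\<in>A. G j ^ \<alpha> j) \<in> J"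
  shows "ideal_power type_ring (genideal type_ring (G ` A)) n \<subseteq> J"
  using J mon
proof (induction n arbitrary: J)
  case 0
  have "1 \<in> J" using 0(2)[of "\<lambda>_. 0"] by simp
  then have "x \<in> J" for x using ideal_type_ringD(3)[OF 0(1), of 1 x] by simp
  then show ?case by auto
next
  case (Suc n)
  note J = ideal_type_ringD[OF Suc.prems(1)]
  have step: "b * G j \<in> J" if j: "j \<in> A" and b: "b \<in> ideal_power type_ring (genideal type_ring (G ` A)) n" for b j
  proof -
    have "ideal {x. x * G j \<in> J} type_ring"
      by (intro ideal_type_ringI) (auto simp: distrib_right mult.assoc intro: J)
    moreover have "(\<Prod>i\<in>A. G i ^ \<alpha> i) \<in> {x. x * G j \<in> J}" if "sum \<alpha> A = n" for \<alpha>
    proof -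
      have "sum (\<alpha>(j := Suc (\<alpha> j))) A = Suc (sum \<alpha> A)"
        using j fin by (simp add: sum.remove[of A j])
      then have "(\<Prod>i\<in>A. G i ^ (\<alpha>(j := Suc (\<alpha> j))) i) \<in> J" using Suc.prems(2) that by simp
      also have "(\<Prod>i\<in>A. G i ^ (\<alpha>(j := Suc (\<alpha> j))) i) = (\<Prod>i\<in>A. G i ^ \<alpha> i) * G j"
        using j fin by (simp add: prod.remove[of A j] mult_ac)
      finally show ?thesis by simp
    qed
    ultimately have "ideal_power type_ring (genideal type_ring (G ` A)) n \<subseteq> {x. x * G j \<in> J}" by (rule Suc.IH)
    with b show ?thesis by blast
  qed
  show ?case
  proof
    fix x assume "x \<in> ideal_power type_ring (genideal type_ring (G ` A)) (Suc n)"
    then show "x \<in> J"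
      unfolding ideal_power_Suc
    proof (induction rule: ideal_prod.induct)
      case (prod b c)
      have "ideal {c. b * c \<in> J} type_ring"
        by (intro ideal_type_ringI) (auto simp: distrib_left mult.left_commute intro: J)
      moreover have "G ` A \<subseteq> {c. b * c \<in> J}" using step prod(1) by blast
      ultimately have "genideal type_ring (G ` A) \<subseteq> {c. b * c \<in> J}" by (rule genideal_subset)
      with prod(2) show ?case by auto
    qed (use J(2) in auto)
  qed
qed

section \<open>Germs bounded by a real function, and integral closure\<close>

definition dominated :: "(complex ^ 'd \<Rightarrow> real) \<Rightarrow> 'd germ set"
  where "dominated \<phi> = {a. \<exists>C\<ge>0. \<forall>\<^sub>F x in nhds 0. norm (rep_germ a x) \<le> C * \<phi> x}"

lemma dominated_add: "a \<in> dominated \<phi> \<Longrightarrow> b \<in> dominated \<phi> \<Longrightarrow> a + b \<in> dominated \<phi>"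
proof -
  assume "a \<in> dominated \<phi>" "b \<in> dominated \<phi>"
  then obtain C D where C: "C \<ge> 0" "\<forall>\<^sub>F x in nhds 0. norm (rep_germ a x) \<le> C * \<phi> x"
    and D: "D \<ge> 0" "\<forall>\<^sub>F x in nhds 0. norm (rep_germ b x) \<le> D * \<phi> x" by (auto simp: dominated_def)
  have "\<forall>\<^sub>F x in nhds 0. norm (rep_germ (a + b) x) \<le> (C + D) * \<phi> x"
    using C(2) D(2) rep_germ_add[of a b]
  proof eventually_elim
    case (elim x)
    then show ?case using norm_triangle_ineq[of "rep_germ a x" "rep_germ b x"] by (simp add: distrib_right)
  qed
  with C(1) D(1) show ?thesis by (auto simp: dominated_def intro!: exI[of _ "C + D"])
qed

lemma dominated_mult:
  assumes "a \<in> dominated \<phi>" "b \<in> dominated \<psi>"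
  shows "a * b \<in> dominated (\<lambda>x. \<phi> x * \<psi> x)"
proof -
  obtain C D where C: "C \<ge> 0" "\<forall>\<^sub>F x in nhds 0. norm (rep_germ a x) \<le> C * \<phi> x"
    and D: "D \<ge> 0" "\<forall>\<^sub>F x in nhds 0. norm (rep_germ b x) \<le> D * \<psi> x" using assms by (auto simp: dominated_def)
  have "\<forall>\<^sub>F x in nhds 0. norm (rep_germ (a * b) x) \<le> (C * D) * (\<phi> x * \<psi> x)"
    using C(2) D(2) rep_germ_mult[of a b]
  proof eventually_elim
    case (elim x)
    have "norm (rep_germ a x) * norm (rep_germ b x) \<le> (C * \<phi> x) * (D * \<psi> x)"
      using elim(1,2) by (intro mult_mono) (auto intro: order_trans[OF norm_ge_zero])
    with elim(3) show ?case by (simp add: norm_mult mult_ac)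
  qed
  with C(1) D(1) show ?thesis by (auto simp: dominated_def intro!: exI[of _ "C * D"])
qed

lemma dominated_1: "a \<in> dominated (\<lambda>_. 1)"
  using holomorphic_near_0_bounded[OF rep_germ_holomorphic, of a] by (auto simp: dominated_def)

text \<open>This allows a bound to be checked on generators of an ideal.\<close>

lemma dominated_ideal: "ideal (dominated \<phi>) germ_ring"
proof (rule ideal_type_ringI)
  show "0 \<in> dominated \<phi>"
    using rep_germ_zero by (auto simp: dominated_def intro!: exI[of _ 0] elim: eventually_mono)
  show "a * x \<in> dominated \<phi>" if "x \<in> dominated \<phi>" for a x
    using dominated_mult[OF dominated_1[of a] that] by simp
qed (rule dominated_add)

lemma ideal_power_dominated:
  assumes "I \<subseteq> dominated \<phi>"
  shows "ideal_power germ_ring I n \<subseteq> dominated (\<lambda>x. \<phi> x ^ n)"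
proof (induction n)
  case 0
  then show ?case using dominated_1 by auto
next
  case (Suc n)
  show ?case
  proof
    fix x assume "x \<in> ideal_power germ_ring I (Suc n)"
    then show "x \<in> dominated (\<lambda>x. \<phi> x ^ Suc n)"
      unfolding ideal_power_Suc
    proof (induction rule: ideal_prod.induct)
      case (prod b c)
      with Suc assms have "b * c \<in> dominated (\<lambda>x. \<phi> x ^ n * \<phi> x)" by (intro dominated_mult) auto
      then show ?case by (simp add: mult.commute)
    qed (auto intro: dominated_add)
  qed
qed

text \<open>If \<open>norm x\<close> exceeded \<open>n * A * M\<close>, each lower term would be
  smaller than \<open>norm x ^ n / n\<close>, and \<open>n\<close> of them cannot balance
  \<open>x ^ n\<close>. The condition \<open>1 \<le> A\<close> makes \<open>c = n * A\<close> at
  least \<open>1\<close>, so that \<open>c \<le> c ^ i\<close>.\<close>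

lemma monic_root_bound:
  fixes x :: complex
  assumes n: "1 \<le> n" and eq: "x ^ n + (\<Sum>i\<in>{1..n}. a i * x ^ (n - i)) = 0"
    and A: "1 \<le> A" and M: "0 \<le> M" and a: "\<And>i. i \<in> {1..n} \<Longrightarrow> norm (a i) \<le> A * M ^ i"
  shows "norm x \<le> real n * A * M"
proof (rule ccontr)
  assume "\<not> ?thesis"
  then have big: "real n * A * M < norm x" by simp
  define c where "c = real n * A"
  have c: "1 \<le> c" unfolding c_def using n A mult_mono[of 1 "real n" 1 A] by simp
  have "0 \<le> c * M" using c M by simp
  then have x0: "0 < norm x" using big unfolding c_def by linarith
  have M_less: "M < norm x / c" using big c by (simp add: c_def field_simps)
  have "norm (x ^ n) = norm (\<Sum>i\<in>{1..n}. a i * x ^ (n - i))"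
    using eq by (metis add_eq_0_iff norm_minus_cancel)
  also have "\<dots> \<le> (\<Sum>i\<in>{1..n}. norm (a i * x ^ (n - i)))" by (rule norm_sum)
  also have "\<dots> < (\<Sum>i\<in>{1..n}. norm x ^ n / real n)"
  proof (rule sum_strict_mono)
    fix i assume i: "i \<in> {1..n}"
    have "M ^ i < (norm x / c) ^ i" using M_less M i by (intro power_strict_mono) auto
    also have "\<dots> = norm x ^ i / c ^ i" by (simp add: power_divide)
    also have "\<dots> \<le> norm x ^ i / c"
      using c i power_increasing[of 1 i c] by (intro divide_left_mono) auto
    finally have "A * M ^ i < A * (norm x ^ i / c)" using A by (intro mult_strict_left_mono) auto
    also have "\<dots> = norm x ^ i / real n" using A by (simp add: c_def)
    finally have "norm (a i) < norm x ^ i / real n" using a[OF i] by linarith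
    then have "norm (a i) * norm x ^ (n - i) < norm x ^ i / real n * norm x ^ (n - i)"
      using x0 by (intro mult_strict_right_mono) auto
    also have "\<dots> = norm x ^ n / real n" using i by (simp flip: power_add)
    finally show "norm (a i * x ^ (n - i)) < norm x ^ n / real n" by (simp add: norm_mult norm_power)
  qed (use n in auto)
  also have "\<dots> = norm x ^ n" using n by simp
  finally show False by (simp add: norm_power)
qed

text \<open>At points near the origin an equation of integral dependence is a monic equation whose
  \<open>i\<close>-th coefficient is at most a multiple of \<open>\<phi> ^ i\<close>; one
  \<open>A\<close> serves all coefficients.\<close>

lemma integral_closure_dominated:
  assumes I: "I \<subseteq> dominated \<phi>" and \<phi>: "\<And>x. 0 \<le> \<phi> x"
  shows "integral_closure germ_ring I \<subseteq> dominated \<phi>"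
proof
  fix r assume "r \<in> integral_closure germ_ring I"
  then obtain n a where n: "1 \<le> n" and a: "\<forall>i\<in>{1..n}. a i \<in> ideal_power germ_ring I i"
    and eq: "r ^ n + (\<Sum>i\<in>{1..n}. a i * r ^ (n - i)) = 0"
    by (auto simp: integral_closure_def type_ring_power type_ring_finsum)
  have "\<forall>i\<in>{1..n}. \<exists>C\<ge>0. \<forall>\<^sub>F x in nhds 0. norm (rep_germ (a i) x) \<le> C * \<phi> x ^ i"
    using a ideal_power_dominated[OF I] by (fastforce simp: dominated_def)
  then obtain C where C: "\<And>i. i \<in> {1..n} \<Longrightarrow> 0 \<le> C i"
    "\<And>i. i \<in> {1..n} \<Longrightarrow> \<forall>\<^sub>F x in nhds 0. norm (rep_germ (a i) x) \<le> C i * \<phi> x ^ i"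
    unfolding bchoice_iff by blast
  define A where "A = 1 + (\<Sum>i\<in>{1..n}. C i)"
  have A: "1 \<le> A" using sum_nonneg[of "{1..n}" C] C(1) by (simp add: A_def)
  have CA: "C i \<le> A" if "i \<in> {1..n}" for i
    using member_le_sum[of i "{1..n}" C] C(1) that by (simp add: A_def)
  have "\<forall>\<^sub>F x in nhds 0. \<forall>i\<in>{1..n}. norm (rep_germ (a i) x) \<le> C i * \<phi> x ^ i"
    by (intro eventually_ball_finite ballI C(2)) auto
  moreover have "\<forall>\<^sub>F x in nhds 0. rep_germ r x ^ n + (\<Sum>i\<in>{1..n}. rep_germ (a i) x * rep_germ r x ^ (n - i)) = 0"
  proof -
    have 1: "\<forall>\<^sub>F x in nhds 0. \<forall>i\<in>{1..n}. rep_germ (a i * r ^ (n - i)) x = rep_germ (a i) x * rep_germ (r ^ (n - i)) x"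
      by (intro eventually_ball_finite ballI rep_germ_mult) auto
    have 2: "\<forall>\<^sub>F x in nhds 0. \<forall>i\<in>{1..n}. rep_germ (r ^ (n - i)) x = rep_germ r x ^ (n - i)"
      by (intro eventually_ball_finite ballI rep_germ_power) auto
    have 3: "\<forall>\<^sub>F x in nhds 0. rep_germ (\<Sum>i\<in>{1..n}. a i * r ^ (n - i)) x = (\<Sum>i\<in>{1..n}. rep_germ (a i * r ^ (n - i)) x)"
      by (rule rep_germ_sum) simp
    have 4: "\<forall>\<^sub>F x in nhds 0. rep_germ 0 x = rep_germ (r ^ n) x + rep_germ (\<Sum>i\<in>{1..n}. a i * r ^ (n - i)) x"
      using rep_germ_add[of "r ^ n" "\<Sum>i\<in>{1..n}. a i * r ^ (n - i)"] by (simp only: eq)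
    show ?thesis
      using 1 2 3 4 rep_germ_zero rep_germ_power[of r n]
      by eventually_elim simp
  qed
  ultimately have "\<forall>\<^sub>F x in nhds 0. norm (rep_germ r x) \<le> real n * A * \<phi> x"
  proof eventually_elim
    case (elim x)
    show ?case
    proof (rule monic_root_bound[OF n elim(2) A \<phi>])
      fix i assume i: "i \<in> {1..n}"
      have "C i * \<phi> x ^ i \<le> A * \<phi> x ^ i" using CA[OF i] \<phi> by (intro mult_right_mono) auto
      with elim(1) i show "norm (rep_germ (a i) x) \<le> A * \<phi> x ^ i" by force
    qed
  qed
  then show "r \<in> dominated \<phi>" using A by (auto simp: dominated_def intro!: exI[of _ "real n * A"])
qed

section \<open>Comparison of the exponents\<close>

text \<open>Each of the \<open>m\<close> factors \<open>F j\<close> contributes \<open>p\<close> to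
  the exponent.\<close>

lemma ipow_in_ideal_power:
  fixes F :: "'d :: finite + nat \<Rightarrow> ('d + nat \<Rightarrow> complex) \<Rightarrow> complex"
  assumes I: "ideal I germ_ring" and fin: "finite Y"
    and F: "\<And>j. j \<in> Y \<Longrightarrow> F j \<in> hg (range Inl)"
      "\<And>j. j \<in> Y \<Longrightarrow> germ_of (\<lambda>x. F j (pad_coords x)) \<in> ideal_power germ_ring I p"
    and e: "e \<in> ipow (range Inl) Y F m"
  shows "germ_of (\<lambda>x. e (pad_coords x)) \<in> ideal_power germ_ring I (p * m)"
  using e
proof (induction m arbitrary: e)
  case 0
  show ?case by (simp only: mult_0_right ideal_power_0 UNIV_I)
next
  case (Suc m)
  from Suc.prems obtain a where e: "e \<in> hg (range Inl)" and a: "\<And>j. j \<in> Y \<Longrightarrow> a j \<in> ipow (range Inl) Y F m"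
    and ev: "\<forall>\<^sub>F z in near (range Inl). e z = (\<Sum>j\<in>Y. F j z * a j z)" by auto
  note hol = hg_imp_holomorphic_near_0
  have hol_prod: "holomorphic_near_0 (\<lambda>x. F j (pad_coords x) * a j (pad_coords x))" if "j \<in> Y" for j
    by (intro holomorphic_near_0_mult hol F(1) ipow_hg[OF a] that)
  note gsum = germ_of_sum[of Y "\<lambda>j x. F j (pad_coords x) * a j (pad_coords x)", OF hol_prod]
  have "germ_of (\<lambda>x. e (pad_coords x)) = germ_of (\<lambda>x. \<Sum>j\<in>Y. F j (pad_coords x) * a j (pad_coords x))"
    using eventually_nhds_pad_coords[OF ev] gsum by (intro germ_of_cong[OF hol[OF e]]) auto
  also have "\<dots> = (\<Sum>j\<in>Y. germ_of (\<lambda>x. F j (pad_coords x) * a j (pad_coords x)))" using gsum by blast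
  also have "\<dots> = (\<Sum>j\<in>Y. germ_of (\<lambda>x. F j (pad_coords x)) * germ_of (\<lambda>x. a j (pad_coords x)))"
    by (intro sum.cong refl germ_of_mult hol F(1) ipow_hg[OF a])
  also have "\<dots> \<in> ideal_power germ_ring I (p + p * m)"
    by (intro ideal_type_ring_sum[OF ideal_power_ideal[OF I]] ideal_power_mult_in[OF I] F(2) Suc.IH a)
  finally show ?case by (simp only: mult_Suc_right)
qed

lemma max_norm_ge: "i \<in> {1..s} \<Longrightarrow> norm (f i x) \<le> max_norm s f x"
  unfolding max_norm_def by (rule Max_ge) auto

lemma max_norm_attained:
  assumes "1 \<le> s"
  obtains i where "i \<in> {1..s}" "max_norm s f x = norm (f i x)"
proof -
  have "max_norm s f x \<in> (\<lambda>i. norm (f i x)) ` {1..s}"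
    unfolding max_norm_def by (rule Max_in) (use assms in auto)
  then show thesis using that by blast
qed

lemma max_norm_nonneg: "1 \<le> s \<Longrightarrow> 0 \<le> max_norm s f x"
  by (erule max_norm_attained[of s f x]) simp

text \<open>The expansion theorem for \<open>F_i = f_i ^ p\<close> and \<open>h = g ^ q\<close>. The
  type \<open>nat\<close> has room for the auxiliary variables whatever \<open>s\<close> is; only
  \<open>Inr i\<close> with \<open>i \<in> {1..s}\<close> are active.\<close>

lemma power_dominated_in_ideal_power:
  fixes f :: "nat \<Rightarrow> complex ^ 'd \<Rightarrow> complex" and g :: "complex ^ 'd \<Rightarrow> complex"
  assumes s: "1 \<le> s" and hol: "\<And>i. i \<in> {1..s} \<Longrightarrow> holomorphic_near_0 (f i)"
    and f0: "\<And>i. i \<in> {1..s} \<Longrightarrow> f i 0 = 0" and g: "holomorphic_near_0 g"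
    and I: "ideal I germ_ring" and fI: "\<And>i. i \<in> {1..s} \<Longrightarrow> germ_of (f i) \<in> I"
    and p: "1 \<le> p" and C: "0 < C"
    and dom: "\<forall>\<^sub>F x in nhds 0. norm (g x) ^ q \<le> C * max_norm s f x ^ p"
  shows "\<exists>k. \<forall>m. germ_of g ^ (q * (k + m)) \<in> ideal_power germ_ring I (p * m)"
proof -
  let ?V = "range (Inl :: 'd \<Rightarrow> 'd + nat)"
  define Y where "Y = (Inr :: nat \<Rightarrow> 'd + nat) ` {1..s}"
  define F where "F j z = f (projr j) (coords z) ^ p" for j :: "'d + nat" and z :: "'d + nat \<Rightarrow> complex"
  define h where "h z = g (coords z) ^ q" for z :: "'d + nat \<Rightarrow> complex"
  have F_hg: "F j \<in> hg ?V" if "j \<in> Y" for j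
    unfolding F_def using that by (intro hg_power holomorphic_near_0_imp_hg hol) (auto simp: Y_def)
  have h_hg: "h \<in> hg ?V"
    unfolding h_def by (intro hg_power holomorphic_near_0_imp_hg g)
  have F0: "F j (\<lambda>_. 0) = 0" if "j \<in> Y" for j
    using that f0 p by (auto simp: F_def Y_def)
  have fin: "finite ?V" "finite Y" and disj: "?V \<inter> Y = {}" by (auto simp: Y_def)
  have hdom: "\<forall>\<^sub>F z in near ?V. \<exists>j\<in>Y. norm (h z) \<le> C * norm (F j z)"
    using eventually_near_coords[where 'e = nat, OF dom]
  proof eventually_elim
    case (elim z)
    obtain i where "i \<in> {1..s}" "max_norm s f (coords z) = norm (f i (coords z))"
      using max_norm_attained[OF s] .
    with elim show ?case
      by (intro bexI[of _ "Inr i"]) (auto simp: h_def F_def Y_def norm_power)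
  qed
  obtain k where k: "\<And>m. (\<lambda>z. h z ^ (k + m)) \<in> ipow ?V Y F (Suc m)"
    using dominated_powers_in_ipow[of ?V Y F h C] fin disj F_hg F0 h_hg C hdom by blast
  have "germ_of g ^ (q * (k + m)) \<in> ideal_power germ_ring I (p * m)" for m
  proof -
    have Fg: "germ_of (\<lambda>x. F j (pad_coords x)) \<in> ideal_power germ_ring I p" if j: "j \<in> Y" for j
    proof -
      obtain i where i: "i \<in> {1..s}" "j = Inr i" using j by (auto simp: Y_def)
      then have "germ_of (\<lambda>x. F j (pad_coords x)) = germ_of (f i) ^ p"
        using germ_of_power[OF hol[OF i(1)]] by (simp add: F_def)
      with power_in_ideal_power[OF I fI[OF i(1)]] show ?thesis by simp
    qed
    have "germ_of (\<lambda>x. (\<lambda>z. h z ^ (k + m)) (pad_coords x)) \<in> ideal_power germ_ring I (p * Suc m)"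
      by (rule ipow_in_ideal_power[OF I fin(2) F_hg Fg k])
    moreover have "(\<lambda>x. (\<lambda>z. h z ^ (k + m)) (pad_coords x :: 'd + nat \<Rightarrow> complex)) = (\<lambda>x. g x ^ (q * (k + m)))"
      by (simp add: h_def power_mult)
    ultimately have "germ_of g ^ (q * (k + m)) \<in> ideal_power germ_ring I (p * Suc m)"
      by (simp only: germ_of_power[OF g])
    with ideal_power_antimono[OF I, of "p * m" "p * Suc m"] show ?thesis by auto
  qed
  then show ?thesis by blast
qed

text \<open>Rounding \<open>\<alpha> j\<close> down to multiples of \<open>q'\<close> and giving up
  \<open>k j\<close> of them costs at most \<open>q' * (1 + k j)\<close>, in total a constant. On
  the other side \<open>p * q' + 1 \<le> p' * q\<close> gains at least \<open>T\<close>, which from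
  the threshold on outweighs \<open>p'\<close> times that constant.\<close>

lemma monomial_exponent_bound:
  fixes \<alpha> k :: "'b \<Rightarrow> nat"
  assumes fin: "finite A" and sum: "sum \<alpha> A = q * T" and q': "1 \<le> q'" and less: "p * q' < p' * q"
    and T: "p' * q' * (card A + sum k A) \<le> T"
  shows "p * T \<le> (\<Sum>j\<in>A. p' * (\<alpha> j div q' - k j))"
proof -
  define D where "D = (\<Sum>j\<in>A. \<alpha> j div q' - k j)"
  have "\<alpha> j \<le> q' * (\<alpha> j div q' - k j) + q' * (1 + k j)" for j
  proof -
    have "\<alpha> j = q' * (\<alpha> j div q') + \<alpha> j mod q'" by simp
    also have "\<dots> \<le> q' * ((\<alpha> j div q' - k j) + k j) + q'"
      using q' by (intro add_mono mult_left_mono) (auto intro: less_imp_le)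
    finally show ?thesis by (simp add: algebra_simps)
  qed
  then have "sum \<alpha> A \<le> (\<Sum>j\<in>A. q' * (\<alpha> j div q' - k j) + q' * (1 + k j))" by (rule sum_mono)
  also have "\<dots> = q' * D + q' * (card A + sum k A)"
    by (simp add: D_def sum.distrib sum_distrib_left algebra_simps)
  finally have le: "q * T \<le> q' * D + q' * (card A + sum k A)" using sum by simp
  have "(p * q' + 1) * T \<le> p' * q * T" using less by (intro mult_right_mono) auto
  also have "\<dots> \<le> p' * (q' * D + q' * (card A + sum k A))"
    using mult_left_mono[OF le, of p'] by (simp add: mult.assoc)
  also have "\<dots> \<le> q' * (p' * D) + T" using T by (simp add: algebra_simps)
  finally have "q' * (p * T) \<le> q' * (p' * D)" by (simp add: algebra_simps)
  then have "p * T \<le> p' * D" using q' by simp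
  then show ?thesis by (simp add: D_def sum_distrib_left)
qed

lemma pos_rat_as_nat_quotient:
  assumes "0 < real_of_rat x"
  obtains a b :: nat where "1 \<le> a" "1 \<le> b" "real_of_rat x = real a / real b"
proof -
  obtain a b where ab: "x = Rat.Fract a b" "b > 0" by (cases x) auto
  have x: "real_of_rat x = real_of_int a / real_of_int b" using ab by (simp add: of_rat_rat)
  then have "a > 0" using assms ab(2) by (simp add: zero_less_divide_iff)
  with ab(2) x show thesis by (intro that[of "nat a" "nat b"]) auto
qed

lemma analytic_bound_imp_eventually_subset:
  fixes f g :: "nat \<Rightarrow> complex ^ 'd \<Rightarrow> complex"
  assumes s: "1 \<le> s"
    and f: "\<And>i. i \<in> {1..s} \<Longrightarrow> holomorphic_near_0 (f i)" "\<And>i. i \<in> {1..s} \<Longrightarrow> f i 0 = 0"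
    and g: "\<And>j. j \<in> {1..t} \<Longrightarrow> holomorphic_near_0 (g j)" "\<And>j. j \<in> {1..t} \<Longrightarrow> g j 0 = 0"
    and U: "open U" "0 \<in> U" "C > 0" "\<And>x. x \<in> U \<Longrightarrow> max_norm t g x powr \<theta> \<le> C * max_norm s f x"
    and \<theta>: "0 < \<theta>" "\<theta> < real q / real p" and p: "1 \<le> p"
  defines "\<aa> \<equiv> genideal germ_ring ((\<lambda>i. germ_of (f i)) ` {1..s})"
    and "\<bb> \<equiv> genideal germ_ring ((\<lambda>j. germ_of (g j)) ` {1..t})"
  shows "\<forall>\<^sub>F T in sequentially.
    ideal_power germ_ring \<bb> (q * T) \<subseteq> integral_closure germ_ring (ideal_power germ_ring \<aa> (p * T))"
proof -
  have \<aa>: "ideal \<aa> germ_ring" unfolding \<aa>_def by (rule genideal_ideal)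
  have f\<aa>: "germ_of (f i) \<in> \<aa>" if "i \<in> {1..s}" for i
    unfolding \<aa>_def using that by (intro subsetD[OF subset_genideal] imageI)
  obtain x :: rat where x: "\<theta> < real_of_rat x" "real_of_rat x < real q / real p"
    using of_rat_dense[OF \<theta>(2)] by blast
  have "0 < real_of_rat x" using x(1) \<theta>(1) by linarith
  then obtain q' p' where pq': "1 \<le> q'" "1 \<le> p'" and xpq: "real_of_rat x = real q' / real p'"
    by (rule pos_rat_as_nat_quotient)
  have "real q' / real p' < real q / real p" using x(2) xpq by simp
  then have "real p * real q' < real p' * real q" using p pq' by (simp add: field_simps)
  then have less: "p * q' < p' * q" by (metis of_nat_less_iff of_nat_mult)
  have evU: "\<forall>\<^sub>F x in nhds 0. x \<in> U" using U(1,2) by (rule eventually_nhds_in_open)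
  have "\<exists>k. \<forall>m. germ_of (g j) ^ (q' * (k + m)) \<in> ideal_power germ_ring \<aa> (p' * m)" if j: "j \<in> {1..t}" for j
  proof (rule power_dominated_in_ideal_power[OF s f g(1)[OF j] \<aa> f\<aa> pq'(2)])
    show "0 < C ^ p'" using U(3) by simp
    \<comment> \<open>Here \<open>g j 0 = 0\<close> enters: where the norm is below
      \<open>1\<close>, raising the exponent from \<open>\<theta>\<close> to \<open>q' / p'\<close>
      only lowers the power.\<close>
    have "\<forall>\<^sub>F z in near (range (Inl :: 'd \<Rightarrow> 'd + nat)). norm (g j (coords z)) < 1"
      using hg_tendsto_0[OF _ holomorphic_near_0_imp_hg[OF g(1)[OF j]], of 1] g(2)[OF j] by simp
    from eventually_nhds_pad_coords[OF this] have "\<forall>\<^sub>F x in nhds 0. norm (g j x) < 1"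
      by eventually_elim simp
    with evU show "\<forall>\<^sub>F x in nhds 0. norm (g j x) ^ q' \<le> C ^ p' * max_norm s f x ^ p'"
    proof eventually_elim
      case (elim y)
      have "norm (g j y) powr (real q' / real p') \<le> norm (g j y) powr \<theta>"
        using elim(2) x(1) xpq by (intro powr_mono') auto
      also have "\<dots> \<le> max_norm t g y powr \<theta>"
        using max_norm_ge[OF j] \<theta>(1) by (intro powr_mono2) auto
      also have "\<dots> \<le> C * max_norm s f y" by (rule U(4)[OF elim(1)])
      finally have le: "norm (g j y) powr (real q' / real p') \<le> C * max_norm s f y" .
      have "norm (g j y) ^ q' = (norm (g j y) powr (real q' / real p')) ^ p'"
      proof (cases "g j y = 0")
        case False
        then have "(norm (g j y) powr (real q' / real p')) ^ p' = norm (g j y) powr (real q' / real p' * real p')"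
          by (simp add: powr_powr flip: powr_realpow)
        then show ?thesis using False pq' by (simp add: powr_realpow)
      qed (use pq' in \<open>auto simp: power_0_left\<close>)
      also have "\<dots> \<le> (C * max_norm s f y) ^ p'" by (rule power_mono[OF le]) simp
      finally show ?case by (simp add: power_mult_distrib)
    qed
  qed
  then have "\<forall>j\<in>{1..t}. \<exists>k. \<forall>m. germ_of (g j) ^ (q' * (k + m)) \<in> ideal_power germ_ring \<aa> (p' * m)" by blast
  then obtain k where k: "\<And>j m. j \<in> {1..t} \<Longrightarrow> germ_of (g j) ^ (q' * (k j + m)) \<in> ideal_power germ_ring \<aa> (p' * m)"
    unfolding bchoice_iff by blast
  \<comment> \<open>The remainder of \<open>n\<close> modulo \<open>q'\<close> is given up. If
    \<open>n div q' < k j\<close>, the truncated difference is \<open>0\<close>, and the zeroth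
    power is the whole ring.\<close>
  have factor: "germ_of (g j) ^ n \<in> ideal_power germ_ring \<aa> (p' * (n div q' - k j))" if j: "j \<in> {1..t}" for j n
  proof (cases "k j \<le> n div q'")
    case True
    have "n = n mod q' + q' * (k j + (n div q' - k j))" using True by simp
    then have "germ_of (g j) ^ n = germ_of (g j) ^ (n mod q') * germ_of (g j) ^ (q' * (k j + (n div q' - k j)))"
      by (metis power_add)
    with ideal_type_ringD(3)[OF ideal_power_ideal[OF \<aa>] k[OF j]] show ?thesis by simp
  next
    case False
    then have "p' * (n div q' - k j) = 0" by simp
    then show ?thesis by (simp only: ideal_power_0 UNIV_I)
  qed
  show ?thesis
    unfolding eventually_sequentially
  proof (intro exI[of _ "p' * q' * (card {1..t} + sum k {1..t})"] allI impI)
    fix T assume T: "p' * q' * (card {1..t} + sum k {1..t}) \<le> T"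
    have "ideal_power germ_ring \<bb> (q * T) \<subseteq> ideal_power germ_ring \<aa> (p * T)"
      unfolding \<bb>_def
    proof (rule genideal_power_subset[OF ideal_power_ideal[OF \<aa>]])
      fix \<alpha> :: "nat \<Rightarrow> nat" assume sum: "sum \<alpha> {1..t} = q * T"
      have "(\<Prod>j\<in>{1..t}. germ_of (g j) ^ \<alpha> j) \<in> ideal_power germ_ring \<aa> (\<Sum>j\<in>{1..t}. p' * (\<alpha> j div q' - k j))"
        by (intro prod_in_ideal_power[OF \<aa>] factor) auto
      moreover have "p * T \<le> (\<Sum>j\<in>{1..t}. p' * (\<alpha> j div q' - k j))"
        by (rule monomial_exponent_bound[OF _ sum pq'(1) less T]) simp
      ultimately show "(\<Prod>j\<in>{1..t}. germ_of (g j) ^ \<alpha> j) \<in> ideal_power germ_ring \<aa> (p * T)"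
        using ideal_power_antimono[OF \<aa>] by blast
    qed simp
    also have "\<dots> \<subseteq> integral_closure germ_ring (ideal_power germ_ring \<aa> (p * T))"
      by (rule ideal_subset_integral_closure[OF ideal_power_ideal[OF \<aa>]])
    finally show "ideal_power germ_ring \<bb> (q * T) \<subseteq> integral_closure germ_ring (ideal_power germ_ring \<aa> (p * T))" .
  qed
qed

text \<open>The inclusion for a single \<open>T \<ge> 1\<close> suffices: it bounds
  \<open>norm (g j x) ^ (q * T)\<close> by a multiple of \<open>max_norm s f x ^ (p * T)\<close>,
  and a root of order \<open>p * T\<close> can be extracted.\<close>

lemma subset_imp_analytic_bound:
  fixes f g :: "nat \<Rightarrow> complex ^ 'd \<Rightarrow> complex"
  assumes s: "1 \<le> s" and t: "1 \<le> t"
    and f: "\<And>i. i \<in> {1..s} \<Longrightarrow> holomorphic_near_0 (f i)"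
    and g: "\<And>j. j \<in> {1..t} \<Longrightarrow> holomorphic_near_0 (g j)"
    and p: "1 \<le> p" and T: "1 \<le> T"
    and sub: "ideal_power germ_ring (genideal germ_ring ((\<lambda>j. germ_of (g j)) ` {1..t})) (q * T) \<subseteq>
      integral_closure germ_ring (ideal_power germ_ring (genideal germ_ring ((\<lambda>i. germ_of (f i)) ` {1..s})) (p * T))"
  shows "\<exists>U C. open U \<and> 0 \<in> U \<and> C > 0 \<and>
    (\<forall>x\<in>U. max_norm t g x powr (real q / real p) \<le> C * max_norm s f x)"
proof -
  let ?\<aa> = "genideal germ_ring ((\<lambda>i. germ_of (f i)) ` {1..s})"
  let ?\<bb> = "genideal germ_ring ((\<lambda>j. germ_of (g j)) ` {1..t})"
  have pT: "0 < p * T" using p T by simp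
  have "?\<aa> \<subseteq> dominated (max_norm s f)"
  proof (rule genideal_subset[OF dominated_ideal], rule image_subsetI)
    fix i assume i: "i \<in> {1..s}"
    have "\<forall>\<^sub>F x in nhds 0. norm (rep_germ (germ_of (f i)) x) \<le> 1 * max_norm s f x"
      using rep_germ_of[OF f[OF i]] by eventually_elim (use max_norm_ge[OF i] in simp)
    then show "germ_of (f i) \<in> dominated (max_norm s f)"
      unfolding dominated_def by (intro CollectI exI[of _ 1]) simp
  qed
  then have closure: "integral_closure germ_ring (ideal_power germ_ring ?\<aa> (p * T)) \<subseteq> dominated (\<lambda>x. max_norm s f x ^ (p * T))"
    by (intro integral_closure_dominated ideal_power_dominated zero_le_power max_norm_nonneg[OF s])
  have "\<exists>C\<ge>0. \<forall>\<^sub>F x in nhds 0. norm (g j x) ^ (q * T) \<le> C * max_norm s f x ^ (p * T)" if j: "j \<in> {1..t}" for j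
  proof -
    have "germ_of (g j) \<in> ?\<bb>" using j by (intro subsetD[OF subset_genideal] imageI)
    from power_in_ideal_power[OF genideal_ideal this]
    have "germ_of (\<lambda>x. g j x ^ (q * T)) \<in> dominated (\<lambda>x. max_norm s f x ^ (p * T))"
      using sub closure germ_of_power[OF g[OF j]] by auto
    then obtain C where C: "C \<ge> 0"
      "\<forall>\<^sub>F x in nhds 0. norm (rep_germ (germ_of (\<lambda>x. g j x ^ (q * T))) x) \<le> C * max_norm s f x ^ (p * T)"
      by (auto simp: dominated_def)
    have "\<forall>\<^sub>F x in nhds 0. norm (g j x) ^ (q * T) \<le> C * max_norm s f x ^ (p * T)"
      using C(2) rep_germ_of[OF holomorphic_near_0_power[OF g[OF j]], of "q * T"]
      by eventually_elim (simp add: norm_power)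
    with C(1) show ?thesis by blast
  qed
  then have "\<forall>j\<in>{1..t}. \<exists>C\<ge>0. \<forall>\<^sub>F x in nhds 0. norm (g j x) ^ (q * T) \<le> C * max_norm s f x ^ (p * T)" by blast
  then obtain C where C: "\<And>j. j \<in> {1..t} \<Longrightarrow> 0 \<le> C j"
    "\<And>j. j \<in> {1..t} \<Longrightarrow> \<forall>\<^sub>F x in nhds 0. norm (g j x) ^ (q * T) \<le> C j * max_norm s f x ^ (p * T)"
    unfolding bchoice_iff by blast
  \<comment> \<open>Besides dominating every \<open>C j\<close>, this constant is at least
    \<open>1\<close>, so \<open>A \<le> A ^ (p * T)\<close> and \<open>A\<close> still serves after
    the root is taken.\<close>
  define A where "A = 1 + sum C {1..t}"
  have A: "1 \<le> A" using sum_nonneg[of "{1..t}" C] C(1) by (simp add: A_def)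
  have CA: "C j \<le> A" if "j \<in> {1..t}" for j
    using member_le_sum[of j "{1..t}" C] C(1) that by (simp add: A_def)
  have "\<forall>\<^sub>F x in nhds 0. \<forall>j\<in>{1..t}. norm (g j x) ^ (q * T) \<le> C j * max_norm s f x ^ (p * T)"
    by (intro eventually_ball_finite ballI C(2)) auto
  then have "\<forall>\<^sub>F x in nhds 0. max_norm t g x powr (real q / real p) \<le> A * max_norm s f x"
  proof eventually_elim
    case (elim x)
    obtain j where j: "j \<in> {1..t}" "max_norm t g x = norm (g j x)" using max_norm_attained[OF t] .
    define M where "M = max_norm s f x"
    have M: "0 \<le> M" using max_norm_nonneg[OF s] by (simp add: M_def)
    have "norm (g j x) ^ (q * T) \<le> C j * M ^ (p * T)" using elim j(1) by (simp add: M_def)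
    also have "\<dots> \<le> A ^ (p * T) * M ^ (p * T)"
      using CA[OF j(1)] A pT M self_le_power[of A "p * T"] by (intro mult_right_mono) auto
    finally have le: "norm (g j x) ^ (q * T) \<le> (A * M) ^ (p * T)" by (simp add: power_mult_distrib)
    have "(norm (g j x) powr (real q / real p)) ^ (p * T) \<le> (A * M) ^ (p * T)"
    proof (cases "g j x = 0")
      case False
      then have "(norm (g j x) powr (real q / real p)) ^ (p * T) = norm (g j x) powr (real q / real p * real (p * T))"
        by (simp add: powr_powr flip: powr_realpow)
      also have "real q / real p * real (p * T) = real (q * T)" using p by simp
      finally show ?thesis using le False by (simp add: powr_realpow del: of_nat_mult)
    qed (use pT A M in simp)
    then have "norm (g j x) powr (real q / real p) \<le> A * M"
      by (rule power_le_imp_le_base[of _ "p * T - 1", unfolded Suc_pred'[OF pT, symmetric]]) (use A M in simp)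
    then show ?case using j(2) by (simp add: M_def)
  qed
  then obtain U where "open U" "0 \<in> U" "\<And>x. x \<in> U \<Longrightarrow> max_norm t g x powr (real q / real p) \<le> A * max_norm s f x"
    unfolding eventually_nhds by blast
  with A show ?thesis by (intro exI[of _ U] exI[of _ A]) auto
qed

theorem theorem4p5:
  fixes f g :: "nat \<Rightarrow> complex ^ 'd \<Rightarrow> complex" and s t :: nat
    and \<aa> \<bb> :: "'d germ set"
  assumes "s \<ge> 1" and "t \<ge> 1"
    and "\<And>i. i \<in> {1..s} \<Longrightarrow> holomorphic_near_0 (f i)"
    and "\<And>j. j \<in> {1..t} \<Longrightarrow> holomorphic_near_0 (g j)"
    and "\<And>i. i \<in> {1..s} \<Longrightarrow> f i 0 = 0"
    and "\<And>j. j \<in> {1..t} \<Longrightarrow> g j 0 = 0"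
    and "\<aa> = genideal germ_ring ((\<lambda>i. germ_of (f i)) ` {1..s})"
    and "\<bb> = genideal germ_ring ((\<lambda>j. germ_of (g j)) ` {1..t})"
  shows "analytic_exponent s f t g = algebraic_exponent germ_ring \<aa> \<bb>"
proof (rule antisym)
  show "analytic_exponent s f t g \<le> algebraic_exponent germ_ring \<aa> \<bb>"
    unfolding algebraic_exponent_def
  proof (rule Inf_greatest)
    fix y assume "y \<in> {ereal (real q / real p) | p q :: nat. p \<ge> 1 \<and> q \<ge> 1 \<and>
      (\<forall>\<^sub>F T in sequentially.
         ideal_power germ_ring \<bb> (q * T) \<subseteq> integral_closure germ_ring (ideal_power germ_ring \<aa> (p * T)))}"
    then obtain p q where y: "y = ereal (real q / real p)" and pq: "1 \<le> p" "1 \<le> q"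
      and ev: "\<forall>\<^sub>F T in sequentially.
         ideal_power germ_ring \<bb> (q * T) \<subseteq> integral_closure germ_ring (ideal_power germ_ring \<aa> (p * T))" by blast
    obtain T0 where T0: "\<And>T. T \<ge> T0 \<Longrightarrow>
         ideal_power germ_ring \<bb> (q * T) \<subseteq> integral_closure germ_ring (ideal_power germ_ring \<aa> (p * T))"
      using ev unfolding eventually_sequentially by blast
    \<comment> \<open>The maximum with \<open>1\<close> excludes \<open>T = 0\<close>, for which no
      root could be extracted.\<close>
    have "\<exists>U C. open U \<and> 0 \<in> U \<and> C > 0 \<and>
        (\<forall>x\<in>U. max_norm t g x powr (real q / real p) \<le> C * max_norm s f x)"
      by (rule subset_imp_analytic_bound[where T = "max 1 T0"])
         (use assms(1-4) pq T0[of "max 1 T0"] in \<open>simp_all add: assms(7,8)\<close>)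
    then show "analytic_exponent s f t g \<le> y"
      unfolding analytic_exponent_def y using pq by (intro Inf_lower) auto
  qed
  show "algebraic_exponent germ_ring \<aa> \<bb> \<le> analytic_exponent s f t g"
    unfolding analytic_exponent_def
  proof (rule Inf_greatest)
    fix y assume "y \<in> {ereal \<theta> | \<theta>. \<theta> > 0 \<and> (\<exists>U C. open U \<and> 0 \<in> U \<and> C > 0 \<and>
         (\<forall>x\<in>U. C * max_norm s f x \<ge> max_norm t g x powr \<theta>))}"
    then obtain \<theta> U C where y: "y = ereal \<theta>" and \<theta>: "0 < \<theta>"
      and U: "open U" "0 \<in> U" "C > 0" "\<And>x. x \<in> U \<Longrightarrow> max_norm t g x powr \<theta> \<le> C * max_norm s f x" by blast
    show "algebraic_exponent germ_ring \<aa> \<bb> \<le> y"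
    \<comment> \<open>\<open>\<theta>\<close> need not be rational, and the argument needs room
      above it. Every rational above \<open>\<theta>\<close> lies in the algebraic set, which is
      enough for the infimum.\<close>
    proof (rule dense_ge)
      fix z assume "y < z"
      then obtain x :: rat where x: "\<theta> < real_of_rat x" "ereal (real_of_rat x) < z"
        using ereal_dense3[of y z] by (auto simp: y)
      have "0 < real_of_rat x" using x(1) \<theta> by linarith
      then obtain q p where pq: "1 \<le> q" "1 \<le> p" and xpq: "real_of_rat x = real q / real p"
        by (rule pos_rat_as_nat_quotient)
      have "\<forall>\<^sub>F T in sequentially. ideal_power germ_ring \<bb> (q * T) \<subseteq>
          integral_closure germ_ring (ideal_power germ_ring \<aa> (p * T))"
        unfolding assms(7,8)
        by (rule analytic_bound_imp_eventually_subset[where \<theta> = \<theta> and U = U and C = C])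
           (use assms(1-6) U \<theta> x(1) xpq pq in auto)
      then have "algebraic_exponent germ_ring \<aa> \<bb> \<le> ereal (real q / real p)"
        unfolding algebraic_exponent_def using pq by (intro Inf_lower) force
      then show "algebraic_exponent germ_ring \<aa> \<bb> \<le> z" using x(2) xpq by simp
    qed
  qed
qed

end
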